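(* Let $F$ be the random map associated with a finite collection $\{T_1,\dots,T_N\}$ of good and bad maps containing at least one good and at least one bad map, and with a strictly positive probability vector $\mathbf p=(p_j)_{j\in\Sigma}$. Let $\theta=\sum_{b\in\Sigma_B}p_b\ell_b$. If $\theta<1$, then $F$ admits a unique acs probability measure $\mu$. Moreover, $F$ is mixing with respect to $\mathbb P\times\mu$, and the density $\frac{d\mu}{d\lambda}$ is bounded away from zero.
   Context: A map $T_g:[0,1]\to[0,1]$ is called good if, for some $r_g\ge 1$, $T_g(x)=1-2^{r_g}(\frac12-x)^{r_g}$ for $x\in[0,\frac12)$ and $T_g(x)=2x-1$ for $x\in[\frac12,1]$. A map $T_b:[0,1]\to[0,1]$ is called bad if, for some $\ell_b>1$, $T_b(x)=\frac12-2^{\ell_b-1}(\frac12-x)^{\ell_b}$ for $x\in[0,\frac12)$ and $T_b(x)=2x-1$ for $x\in[\frac12,1]$. For a finite collection $T_1,\dots,T_N$ of good and bad maps put $\Sigma=\{1,\dots,N\}$, $\Sigma_G=\{j: T_j\text{ is good}\}$, $\Sigma_B=\{j:T_j\text{ is bad}\}$; both $\Sigma_G$ and $\Sigma_B$ are assumed nonempty. The parameter of $T_g$ ($g\in\Sigma_G$) is $r_g$ and that of $T_b$ ($b\in\Sigma_B$) is $\ell_b$. The random map is $F:\Sigma^{\mathbb N}\times[0,1]\to\Sigma^{\mathbb N}\times[0,1]$, $F(\omega,x)=(\sigma\omega,T_{\omega_1}(x))$, with $\sigma$ the left shift. $\lambda$ is Lebesgue measure on $[0,1]$. Given a probability vector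 $\mathbf p=(p_j)_{j\in\Sigma}$ with strictly positive entries, $\mathbb P$ is the $\mathbf p$-Bernoulli measure on $\Sigma^{\mathbb N}$. An acs (absolutely continuous stationary) measure for $F$ is a Borel measure $\mu$ on $[0,1]$ that is absolutely continuous with respect to $\lambda$ and satisfies $\sum_{j\in\Sigma}p_j\mu(T_j^{-1}A)=\mu(A)$ for all Borel sets $A\subseteq[0,1]$; then $\mathbb P\times\mu$ is $F$-invariant. *)

theory Defs
  imports "HOL-Probability.Probability"
begin

text \<open>
  Maps \<open>[0,1] \<rightarrow> [0,1]\<close> are functions on the reals of which only the values on \<open>{0..1}\<close> matter.
\<close>

definition good_map :: "real \<Rightarrow> (real \<Rightarrow> real) \<Rightarrow> bool" where
  "good_map r T \<longleftrightarrow> r \<ge> 1 \<and>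
     (\<forall>x\<in>{0..<1/2}. T x = 1 - 2 powr r * (1/2 - x) powr r) \<and>
     (\<forall>x\<in>{1/2..1}. T x = 2 * x - 1)"

definition bad_map :: "real \<Rightarrow> (real \<Rightarrow> real) \<Rightarrow> bool" where
  "bad_map l T \<longleftrightarrow> l > 1 \<and>
     (\<forall>x\<in>{0..<1/2}. T x = 1/2 - 2 powr (l - 1) * (1/2 - x) powr l) \<and>
     (\<forall>x\<in>{1/2..1}. T x = 2 * x - 1)"

definition good_indices :: "nat \<Rightarrow> (nat \<Rightarrow> real \<Rightarrow> real) \<Rightarrow> nat set" where
  "good_indices N T = {j\<in>{1..N}. \<exists>r. good_map r (T j)}"

definition bad_indices :: "nat \<Rightarrow> (nat \<Rightarrow> real \<Rightarrow> real) \<Rightarrow> nat set" where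
  "bad_indices N T = {j\<in>{1..N}. \<exists>l. bad_map l (T j)}"

abbreviation lborel_01 :: "real measure" where
  "lborel_01 \<equiv> restrict_space lborel {0..1}"

text \<open>Sequences are indexed from \<open>0\<close>, so \<open>\<omega> 0\<close> is the first symbol.\<close>

definition bernoulli_measure :: "nat \<Rightarrow> (nat \<Rightarrow> real) \<Rightarrow> (nat \<Rightarrow> nat) measure" where
  "bernoulli_measure N p =
     PiM (UNIV :: nat set) (\<lambda>_. point_measure {1..N} (\<lambda>j. ennreal (p j)))"

definition random_map ::
    "(nat \<Rightarrow> real \<Rightarrow> real) \<Rightarrow> (nat \<Rightarrow> nat) \<times> real \<Rightarrow> (nat \<Rightarrow> nat) \<times> real" where
  "random_map T = (\<lambda>(\<omega>, x). (\<lambda>n. \<omega> (Suc n), T (\<omega> 0) x))"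

definition acs_measure ::
    "nat \<Rightarrow> (nat \<Rightarrow> real \<Rightarrow> real) \<Rightarrow> (nat \<Rightarrow> real) \<Rightarrow> real measure \<Rightarrow> bool" where
  "acs_measure N T p \<mu> \<longleftrightarrow>
     sets \<mu> = sets (restrict_space borel {0..1}) \<and>
     absolutely_continuous lborel_01 \<mu> \<and>
     (\<forall>A\<in>sets (restrict_space borel {0..1}).
        (\<Sum>j\<in>{1..N}. ennreal (p j) * emeasure \<mu> (T j -` A \<inter> {0..1})) = emeasure \<mu> A)"

definition mixing :: "'a measure \<Rightarrow> ('a \<Rightarrow> 'a) \<Rightarrow> bool" where
  "mixing M f \<longleftrightarrow>
     prob_space M \<and> f \<in> M \<rightarrow>\<^sub>M M \<and> distr M M f = M \<and>
     (\<forall>A\<in>sets M. \<forall>B\<in>sets M.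
        (\<lambda>n. measure M (A \<inter> (f ^^ n) -` B)) \<longlonglongrightarrow> measure M A * measure M B)"

text \<open>The density is only determined almost everywhere, so the lower bound is an a.e. one.\<close>

definition density_bounded_away_from_zero :: "'a measure \<Rightarrow> 'a measure \<Rightarrow> bool" where
  "density_bounded_away_from_zero M \<mu> \<longleftrightarrow>
     (\<exists>c::real. c > 0 \<and> (AE x in M. ennreal c \<le> RN_deriv M \<mu> x))"

end

(*
On the left half put y = 1 - 2x. A bad map acts as y -> y^l, a good map sends x to 1 - y^r, and close to 1
every map doubles the distance to 1. The only obstruction to a stationary density is mass that
accumulates to the left of 1/2 and of 1.

All transfer operators preserve the cone of nonnegative functions that are nondecreasing on [0,1/2) and on
[1/2,1), and such a function f satisfies f(x) (1/2 - x) <= int f and f(x) (1 - x) <= int f. If q > 2 is so close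
to 2 that sum_b p_b l_b^(q-1) < 1, which is possible because theta < 1, the averaged operator P also preserves a
pointwise bound by an integrable H of order 1 / (y (1 - ln y)^q) at 1/2 and of order 1 / (d (1 - ln d)^(q-1)),
d = 1 - x, at 1. So no mass escapes: a function of this class with integral at least eps is bounded below
near 1/2 or near 1, a good map carries mass from 1/2 to 1, the right branches spread it over [0,1), and P^n f >= c
with n and c depending only on eps.

Subtracting a constant does not leave the cone. Hence the common part c can be removed from two densities again
and again, P^n contracts differences in L1 uniformly over the class, P^n 1 is a Cauchy sequence, and its limit h
satisfies P^n f -> (int f) h for every integrable f. This gives existence, uniqueness and the lower bound,
and, because the symbols are independent, mixing of the skew product on cylinder boxes, hence on all sets.
*)

theory Submission
  imports Defs "HOL-Real_Asymp.Real_Asymp"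
begin

section \<open>Transfer operators of a single map\<close>

text \<open>Why theta < 1 is the right condition, and why the two singularities have different
  orders. In the coordinate t = - ln y a bad map multiplies t by l, so it reproduces a tail (1 +
  t)^-q with a factor l^(q-1); averaged over the bad maps this factor is theta at q = 2 and stays
  below 1 for q slightly larger. Good maps carry the tail from 1/2 to 1, where t = - ln d only
  decreases by ln 2 in each step. Mass that enters at depth t needs about t / ln 2 steps to leave,
  so the tails accumulate to (1 + t)^-(q-1), which is integrable only for q > 2. The majorant need
  not be an eigenfunction, only a supersolution: its left coefficient is fixed against bounded
  contributions, its right one afterwards against the inflow from the left half. The monotone cone
  is what bounds those contributions, with no distortion estimate. For mixing, conditioning on the
  first symbols replaces a density by its images under single maps, which need not lie in the
  dominated class. Hence convergence is needed for every integrable function.\<close>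

lemma nn_integral_powr_substitution:
  fixes e :: real and k :: "real \<Rightarrow> ennreal"
  assumes e: "e \<ge> 1" and k [measurable]: "k \<in> borel_measurable borel"
  shows "(\<integral>\<^sup>+y. k y * indicator {0..1} y \<partial>lborel) =
    (\<integral>\<^sup>+w. ennreal (w powr (1/e - 1) / e) * k (w powr (1/e)) * indicator {0..1} w \<partial>lborel)"
proof (cases "e = 1")
  case True
  \<comment> \<open>For e = 1 the weight is \<open>y powr 0\<close>, which is 1 except at y = 0,
    where \<open>powr\<close> returns 0.\<close>
  have "k y * indicator {0..1} y = ennreal (y powr (1/e - 1) / e) * k (y powr (1/e)) * indicator {0..1} y"
    if "y \<noteq> 0" for y
    using True that by (auto split: split_indicator)
  then have "AE y in lborel. k y * indicator {0..1} y =
      ennreal (y powr (1/e - 1) / e) * k (y powr (1/e)) * indicator {0..1} y"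
    using AE_lborel_singleton[of 0] by (auto elim: eventually_mono)
  then show ?thesis by (rule nn_integral_cong_AE)
next
  case False
  with e have e1: "e > 1" by simp
  \<comment> \<open>Cutting off at 0 makes the power differentiable from both sides at 0, with
    derivative 0, as the substitution rule demands at the end of the interval. For e = 1 there would
    be a kink, hence the separate case.\<close>
  define g where "g = (\<lambda>y::real. max 0 y powr e)"
  define g' where "g' = (\<lambda>y::real. e * max 0 y powr (e - 1))"
  define F where "F = (\<lambda>w. ennreal (w powr (1/e - 1) / e) * k (w powr (1/e)))"
  have der: "(g has_real_derivative g' y) (at y)" if y: "y \<in> {0..1}" for y
  proof (cases "y = 0")
    case True
    have "((\<lambda>h. g h / h) \<longlongrightarrow> 0) (at 0)"
    proof (rule Lim_null_comparison)
      have "\<bar>g h / h\<bar> \<le> \<bar>h\<bar> powr (e - 1)" if "h \<noteq> 0" for h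
      proof (cases "h > 0")
        case True
        then show ?thesis using e1 by (simp add: g_def powr_diff)
      next
        case False
        then have "g h = 0" by (simp add: g_def)
        then show ?thesis by simp
      qed
      then show "\<forall>\<^sub>F h in at 0. norm (g h / h) \<le> \<bar>h\<bar> powr (e - 1)"
        by (auto simp: eventually_at intro!: exI[of _ 1])
      have "((\<lambda>h::real. \<bar>h\<bar> powr (e - 1)) \<longlongrightarrow> 0 powr (e - 1)) (at 0)"
        by (rule tendsto_powr') (use e1 in \<open>auto intro!: tendsto_eq_intros\<close>)
      then show "((\<lambda>h::real. \<bar>h\<bar> powr (e - 1)) \<longlongrightarrow> 0) (at 0)" using e1 by simp
    qed
    then show ?thesis using True e1 by (simp add: has_field_derivative_iff g_def g'_def)
  next
    case False
    with y have y: "y > 0" by simp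
    have "((\<lambda>y. y powr e) has_real_derivative g' y) (at y)"
      using y e1 by (auto intro!: derivative_eq_intros simp: g'_def powr_diff)
    then show ?thesis
      by (rule has_field_derivative_transform_within_open[where S="{0<..}"])
         (use y in \<open>auto simp: g_def\<close>)
  qed
  have cont: "continuous_on {0..1} g'"
    unfolding g'_def by (intro continuous_intros continuous_on_powr') (use e1 in auto)
  have [measurable]: "F \<in> borel_measurable borel" unfolding F_def by measurable
  have "(\<integral>\<^sup>+w. F w * indicator {g 0..g 1} w \<partial>lborel) =
      (\<integral>\<^sup>+y. F (g y) * ennreal (g' y) * indicator {0..1} y \<partial>lborel)"
    by (rule nn_integral_substitution_aux) (use der cont e1 in \<open>auto simp: g'_def\<close>)
  also have "\<dots> = (\<integral>\<^sup>+y. k y * indicator {0..1} y \<partial>lborel)"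
  proof (rule nn_integral_cong_AE)
    have *: "F (g y) * ennreal (g' y) * indicator {0..1} y = k y * indicator {0..1} y" if "y \<noteq> 0" for y
    proof (cases "y \<in> {0<..1}")
      case True
      then have y: "0 < y" "y \<le> 1" by auto
      have "ennreal (g y powr (1/e - 1) / e) * ennreal (g' y) = 1"
      proof -
        have "(y powr e) powr (1/e - 1) / e * (e * y powr (e - 1)) = 1"
          using y e1 by (simp add: powr_powr right_diff_distrib powr_add [symmetric])
        then show ?thesis
          using y e1 by (simp add: g_def g'_def ennreal_mult [symmetric])
      qed
      moreover have "g y powr (1/e) = y" using y e1 by (simp add: g_def powr_powr)
      ultimately show ?thesis by (simp add: F_def mult_ac)
    qed (use that in \<open>auto split: split_indicator\<close>)
    show "AE y in lborel. F (g y) * ennreal (g' y) * indicator {0..1} y = k y * indicator {0..1} y"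
      using AE_lborel_singleton[of 0] by eventually_elim (rule *)
  qed
  finally show ?thesis using e1 by (simp add: F_def g_def)
qed

text \<open>Good maps are the case \<open>k = 1\<close> and bad maps the case \<open>k = 1/2\<close>; \<open>e\<close> is the exponent.\<close>

definition branch_map :: "real \<Rightarrow> real \<Rightarrow> real \<Rightarrow> real" where
  "branch_map k e x = (if x < 1/2 then k * (1 - (1 - 2 * x) powr e) else 2 * x - 1)"

definition left_inv :: "real \<Rightarrow> real \<Rightarrow> real \<Rightarrow> real" where
  "left_inv k e z = (1 - (1 - z / k) powr (1/e)) / 2"

text \<open>The factor in front of \<open>f\<close> is the derivative of
  \<open>left_inv k e\<close>, the inverse of the left branch, whose values fill [0, k).\<close>

definition left_transfer :: "real \<Rightarrow> real \<Rightarrow> (real \<Rightarrow> real) \<Rightarrow> real \<Rightarrow> real" where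
  "left_transfer k e f z =
     (if z < k then (1 - z / k) powr (1/e - 1) / (2 * k * e) * f (left_inv k e z) else 0)"

text \<open>This is the Perron-Frobenius operator of \<open>branch_map k e\<close>; the second term
  comes from the right branch, which has slope 2.\<close>

definition transfer :: "real \<Rightarrow> real \<Rightarrow> (real \<Rightarrow> real) \<Rightarrow> real \<Rightarrow> real" where
  "transfer k e f z = left_transfer k e f z + f ((1 + z) / 2) / 2"

lemma measurable_branch_map [measurable]: "branch_map k e \<in> borel_measurable borel"
  unfolding branch_map_def by measurable

lemma measurable_left_inv [measurable]: "left_inv k e \<in> borel_measurable borel"
  unfolding left_inv_def by measurable

lemma measurable_left_transfer [measurable]:
  assumes [measurable]: "f \<in> borel_measurable borel"
  shows "left_transfer k e f \<in> borel_measurable borel"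
  unfolding left_transfer_def by measurable

lemma measurable_transfer [measurable]:
  assumes [measurable]: "f \<in> borel_measurable borel"
  shows "transfer k e f \<in> borel_measurable borel"
  unfolding transfer_def by measurable

lemma nn_integral_lborel_01:
  fixes f :: "real \<Rightarrow> ennreal"
  shows "(\<integral>\<^sup>+x. f x \<partial>lborel_01) = (\<integral>\<^sup>+x. f x * indicator {0..1} x \<partial>lborel)"
  by (simp add: nn_integral_restrict_space)

text \<open>Three substitutions in a row: y = 1 - 2 x, then w = y powr e, then z = k (1 - w). The
  integrands in between are \<open>K\<close> and \<open>W\<close>.\<close>

lemma nn_integral_left_branch:
  fixes G :: "real \<Rightarrow> ennreal"
  assumes k: "0 < k" "k \<le> 1" and e: "e \<ge> 1"
    and [measurable]: "f \<in> borel_measurable borel" "G \<in> borel_measurable borel"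
    and f: "\<And>x. f x \<ge> 0"
  shows "(\<integral>\<^sup>+x. ennreal (f x) * G (branch_map k e x) * indicator {0..<1/2} x \<partial>lborel) =
    (\<integral>\<^sup>+z. ennreal (left_transfer k e f z) * G z * indicator {0..1} z \<partial>lborel)"
proof -
  define K where "K = (\<lambda>y. ennreal (f ((1 - y) / 2)) * G (k * (1 - y powr e)))"
  define W where "W = (\<lambda>w. ennreal (w powr (1/e - 1) / e * f ((1 - w powr (1/e)) / 2)) * G (k * (1 - w)))"
  have [measurable]: "K \<in> borel_measurable borel" "W \<in> borel_measurable borel"
    unfolding K_def W_def by measurable
  have "(\<integral>\<^sup>+x. ennreal (f x) * G (branch_map k e x) * indicator {0..<1/2} x \<partial>lborel) =
     ennreal \<bar>- 1/2\<bar> * (\<integral>\<^sup>+y. ennreal (f (1/2 + (-1/2) * y)) * G (branch_map k e (1/2 + (-1/2) * y))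
        * indicator {0..<1/2} (1/2 + (-1/2) * y) \<partial>lborel)"
    by (subst nn_integral_real_affine[where c="-1/2" and t="1/2"]) auto
  also have "(\<integral>\<^sup>+y. ennreal (f (1/2 + (-1/2) * y)) * G (branch_map k e (1/2 + (-1/2) * y))
        * indicator {0..<1/2} (1/2 + (-1/2) * y) \<partial>lborel) =
     (\<integral>\<^sup>+y. K y * indicator {0..1} y \<partial>lborel)"
  proof (rule nn_integral_cong_AE)
    have *: "ennreal (f (1/2 + (-1/2) * y)) * G (branch_map k e (1/2 + (-1/2) * y))
        * indicator {0..<1/2} (1/2 + (-1/2) * y) = K y * indicator {0..1} y" if "y \<noteq> 0" for y
      using that by (auto simp: K_def branch_map_def diff_divide_distrib split: split_indicator)
    show "AE y in lborel. ennreal (f (1/2 + (-1/2) * y)) * G (branch_map k e (1/2 + (-1/2) * y))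
        * indicator {0..<1/2} (1/2 + (-1/2) * y) = K y * indicator {0..1} y"
      using AE_lborel_singleton[of 0] by eventually_elim (rule *)
  qed
  also have "\<dots> = (\<integral>\<^sup>+w. ennreal (w powr (1/e - 1) / e) * K (w powr (1/e)) * indicator {0..1} w \<partial>lborel)"
    by (rule nn_integral_powr_substitution) (use e in auto)
  also have "\<dots> = (\<integral>\<^sup>+w. W w * indicator {0..1} w \<partial>lborel)"
  proof (rule nn_integral_cong)
    fix w :: real
    have "ennreal (w powr (1/e - 1) / e) * ennreal (f ((1 - w powr (1/e)) / 2)) =
        ennreal (w powr (1/e - 1) / e * f ((1 - w powr (1/e)) / 2))"
      using e f by (subst ennreal_mult [symmetric]) auto
    then show "ennreal (w powr (1/e - 1) / e) * K (w powr (1/e)) * indicator {0..1} w = W w * indicator {0..1} w"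
      using e by (auto simp: K_def W_def powr_powr mult.assoc [symmetric] split: split_indicator)
  qed
  also have "\<dots> = ennreal \<bar>-1/k\<bar> * (\<integral>\<^sup>+z. W (1 + (-1/k) * z) * indicator {0..1} (1 + (-1/k) * z) \<partial>lborel)"
    using k by (subst nn_integral_real_affine[where c="-1/k" and t=1]) auto
  also have "ennreal \<bar>-1/2\<bar> * \<dots> = ennreal (1/(2*k)) * (\<integral>\<^sup>+z. W (1 + (-1/k) * z) * indicator {0..1} (1 + (-1/k) * z) \<partial>lborel)"
  proof -
    have "ennreal \<bar>-1/2\<bar> * ennreal \<bar>-1/k\<bar> = ennreal (1/(2*k))"
      using k by (subst ennreal_mult [symmetric]) auto
    then show ?thesis by (simp only: mult.assoc [symmetric])
  qed
  also have "\<dots> = (\<integral>\<^sup>+z. ennreal (1/(2*k)) * (W (1 + (-1/k) * z) * indicator {0..1} (1 + (-1/k) * z)) \<partial>lborel)"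
    by (simp add: nn_integral_cmult)
  also have "\<dots> = (\<integral>\<^sup>+z. ennreal (left_transfer k e f z) * G z * indicator {0..1} z \<partial>lborel)"
  proof (rule nn_integral_cong_AE)
    have *: "ennreal (1/(2*k)) * (W (1 + (-1/k) * z) * indicator {0..1} (1 + (-1/k) * z)) =
      ennreal (left_transfer k e f z) * G z * indicator {0..1} z" if z: "z \<noteq> k" for z
    proof (cases "z \<in> {0..<k}")
      case True
      have "ennreal (1/(2*k)) * ennreal ((1 - z/k) powr (1/e - 1) / e * f ((1 - (1 - z/k) powr (1/e)) / 2)) =
        ennreal ((1 - z/k) powr (1/e - 1) / (2*k*e) * f ((1 - (1 - z/k) powr (1/e)) / 2))"
        using k e f by (subst ennreal_mult [symmetric]) auto
      then show ?thesis using True k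
        by (simp add: W_def left_transfer_def left_inv_def mult.assoc [symmetric])
    next
      case False
      then show ?thesis using k z
        by (auto simp: left_transfer_def field_simps split: split_indicator)
    qed
    show "AE z in lborel. ennreal (1/(2*k)) * (W (1 + (-1/k) * z) * indicator {0..1} (1 + (-1/k) * z)) =
      ennreal (left_transfer k e f z) * G z * indicator {0..1} z"
      using AE_lborel_singleton[of k] by eventually_elim (rule *)
  qed
  finally show ?thesis .
qed

lemma nn_integral_right_branch:
  fixes G :: "real \<Rightarrow> ennreal"
  assumes [measurable]: "f \<in> borel_measurable borel" "G \<in> borel_measurable borel"
    and f: "\<And>x. f x \<ge> 0"
  shows "(\<integral>\<^sup>+x. ennreal (f x) * G (branch_map k e x) * indicator {1/2..1} x \<partial>lborel) =
    (\<integral>\<^sup>+z. ennreal (f ((1 + z) / 2) / 2) * G z * indicator {0..1} z \<partial>lborel)"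
proof -
  have "(\<integral>\<^sup>+x. ennreal (f x) * G (branch_map k e x) * indicator {1/2..1} x \<partial>lborel) =
     ennreal \<bar>1/2\<bar> * (\<integral>\<^sup>+y. ennreal (f (1/2 + (1/2) * y)) * G (branch_map k e (1/2 + (1/2) * y))
        * indicator {1/2..1} (1/2 + (1/2) * y) \<partial>lborel)"
    by (subst nn_integral_real_affine[where c="1/2" and t="1/2"]) auto
  also have "\<dots> = (\<integral>\<^sup>+y. ennreal \<bar>1/2\<bar> * (ennreal (f (1/2 + (1/2) * y)) * G (branch_map k e (1/2 + (1/2) * y))
        * indicator {1/2..1} (1/2 + (1/2) * y)) \<partial>lborel)"
    by (simp add: nn_integral_cmult)
  also have "\<dots> = (\<integral>\<^sup>+z. ennreal (f ((1 + z) / 2) / 2) * G z * indicator {0..1} z \<partial>lborel)"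
  proof (rule nn_integral_cong)
    fix y
    have "ennreal (1/2) * ennreal (f ((1 + y) / 2)) = ennreal (f ((1 + y) / 2) / 2)"
      using f by (subst ennreal_mult [symmetric]) auto
    then show "ennreal \<bar>1/2\<bar> * (ennreal (f (1/2 + (1/2) * y)) * G (branch_map k e (1/2 + (1/2) * y))
        * indicator {1/2..1} (1/2 + (1/2) * y)) = ennreal (f ((1 + y) / 2) / 2) * G y * indicator {0..1} y"
      by (auto simp: branch_map_def add_divide_distrib mult.assoc [symmetric] split: split_indicator)
  qed
  finally show ?thesis .
qed

lemma left_transfer_nonneg: "k > 0 \<Longrightarrow> e \<ge> 1 \<Longrightarrow> (\<And>x. f x \<ge> 0) \<Longrightarrow> left_transfer k e f z \<ge> 0"
  by (simp add: left_transfer_def)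

text \<open>Duality between composition with the map and its transfer operator, obtained by
  splitting the interval at 1/2. Later G = 1 gives conservation of mass, indicators give
  stationarity, and probabilities of fibres give the skew product.\<close>

lemma nn_integral_transfer:
  fixes G :: "real \<Rightarrow> ennreal"
  assumes k: "0 < k" "k \<le> 1" and e: "e \<ge> 1"
    and [measurable]: "f \<in> borel_measurable borel" "G \<in> borel_measurable borel"
    and f: "\<And>x. f x \<ge> 0"
  shows "(\<integral>\<^sup>+x. ennreal (f x) * G (branch_map k e x) \<partial>lborel_01) =
    (\<integral>\<^sup>+z. ennreal (transfer k e f z) * G z \<partial>lborel_01)"
proof -
  have "(\<integral>\<^sup>+x. ennreal (f x) * G (branch_map k e x) \<partial>lborel_01) =
    (\<integral>\<^sup>+x. ennreal (f x) * G (branch_map k e x) * indicator {0..<1/2} x +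
          ennreal (f x) * G (branch_map k e x) * indicator {1/2..1} x \<partial>lborel)"
    unfolding nn_integral_lborel_01 by (intro nn_integral_cong) (auto split: split_indicator)
  also have "\<dots> = (\<integral>\<^sup>+z. ennreal (left_transfer k e f z) * G z * indicator {0..1} z +
      ennreal (f ((1 + z) / 2) / 2) * G z * indicator {0..1} z \<partial>lborel)"
    using k e f by (simp add: nn_integral_add nn_integral_left_branch nn_integral_right_branch)
  also have "\<dots> = (\<integral>\<^sup>+z. ennreal (transfer k e f z) * G z \<partial>lborel_01)"
    unfolding nn_integral_lborel_01 transfer_def
    using k e f left_transfer_nonneg[of k e f]
    by (intro nn_integral_cong) (auto simp: ring_distribs split: split_indicator)
  finally show ?thesis .
qed

section \<open>Integrable functions and the averaged transfer operator\<close>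

text \<open>Densities are Borel functions on the whole line of which only the values on \<open>{0..1}\<close> matter.\<close>

definition L1 :: "(real \<Rightarrow> real) \<Rightarrow> bool" where
  "L1 f \<longleftrightarrow> f \<in> borel_measurable borel \<and> integrable lborel_01 f"

lemma
  assumes "L1 f"
  shows L1_integrable: "integrable lborel_01 f" and L1_measurable: "f \<in> borel_measurable borel"
  using assms by (simp_all only: L1_def)

lemma measurable_lborel_01:
  fixes f :: "real \<Rightarrow> 'a::topological_space"
  shows "f \<in> borel_measurable borel \<Longrightarrow> f \<in> borel_measurable lborel_01"
  by (rule measurable_restrict_space1) simp

lemma L1_diff [intro]: "L1 f \<Longrightarrow> L1 g \<Longrightarrow> L1 (\<lambda>x. f x - g x)"
  unfolding L1_def by (elim conjE, intro conjI borel_measurable_diff Bochner_Integration.integrable_diff)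

lemma L1_add [intro]: "L1 f \<Longrightarrow> L1 g \<Longrightarrow> L1 (\<lambda>x. f x + g x)"
  unfolding L1_def by (elim conjE, intro conjI borel_measurable_add Bochner_Integration.integrable_add)

lemma L1_cmult [intro]: "L1 f \<Longrightarrow> L1 (\<lambda>x. c * f x)"
  unfolding L1_def
  by (elim conjE, intro conjI borel_measurable_times borel_measurable_const integrable_mult_right)

lemma L1_abs: "L1 f \<Longrightarrow> L1 (\<lambda>x. \<bar>f x\<bar>)"
  unfolding L1_def by (elim conjE, intro conjI borel_measurable_abs integrable_abs)

lemma L1_sum: "(\<And>i. i \<in> I \<Longrightarrow> L1 (f i)) \<Longrightarrow> L1 (\<lambda>x. \<Sum>i\<in>I. f i x)"
  using borel_measurable_sum[of I f borel] Bochner_Integration.integrable_sum[of I lborel_01 f]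
  unfolding L1_def by blast

lemma L1_bound:
  assumes g: "L1 g" and f: "f \<in> borel_measurable borel"
    and le: "\<And>x. x \<in> {0..1} \<Longrightarrow> \<bar>f x\<bar> \<le> g x"
  shows "L1 f"
proof -
  have "integrable lborel_01 f"
  proof (rule Bochner_Integration.integrable_bound[OF L1_integrable[OF g]])
    have "norm (f x) \<le> norm (g x)" if "x \<in> space lborel_01" for x
      using le[of x] that by (simp add: space_restrict_space)
    then show "AE x in lborel_01. norm (f x) \<le> norm (g x)" by (rule AE_I2)
  qed (rule measurable_lborel_01[OF f])
  then show ?thesis using f by (simp only: L1_def)
qed

definition L1_norm :: "(real \<Rightarrow> real) \<Rightarrow> real" where
  "L1_norm f = (\<integral>x. \<bar>f x\<bar> \<partial>lborel_01)"

lemma space_lborel_01 [simp]: "space lborel_01 = {0..1}"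
  by (simp add: space_restrict_space)

lemma emeasure_lborel_01: "emeasure lborel_01 {0..1} = 1"
  by (simp add: emeasure_restrict_space)

lemma finite_measure_lborel_01: "finite_measure lborel_01"
  by (rule finite_measureI) (simp add: emeasure_lborel_01)

lemma prob_space_lborel_01: "prob_space lborel_01"
  by (rule prob_spaceI) (simp add: emeasure_lborel_01)

lemma L1_const [intro, simp]: "L1 (\<lambda>x. c)"
  using finite_measure.integrable_const[OF finite_measure_lborel_01]
  by (simp only: L1_def measurable_const) simp

lemma L1_norm_nonneg [simp]: "L1_norm f \<ge> 0"
  by (simp add: L1_norm_def)

lemma L1_norm_triangle: "L1 f \<Longrightarrow> L1 g \<Longrightarrow> L1_norm (\<lambda>x. f x + g x) \<le> L1_norm f + L1_norm g"
  unfolding L1_norm_def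
  by (subst Bochner_Integration.integral_add [symmetric])
     (auto intro!: integral_mono L1_integrable L1_abs)

lemma L1_norm_diff_le: "L1 f \<Longrightarrow> L1 g \<Longrightarrow> L1_norm (\<lambda>x. f x - g x) \<le> L1_norm f + L1_norm g"
  unfolding L1_norm_def
  by (subst Bochner_Integration.integral_add [symmetric])
     (auto intro!: integral_mono L1_integrable L1_abs)

lemma L1_norm_commute: "L1_norm (\<lambda>x. f x - g x) = L1_norm (\<lambda>x. g x - f x)"
  unfolding L1_norm_def by (simp add: abs_minus_commute)

lemma L1_norm_diff_triangle:
  assumes "L1 f" "L1 g" "L1 h"
  shows "L1_norm (\<lambda>x. f x - h x) \<le> L1_norm (\<lambda>x. f x - g x) + L1_norm (\<lambda>x. g x - h x)"
  using L1_norm_triangle[of "\<lambda>x. f x - g x" "\<lambda>x. g x - h x"] assms by auto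

lemma abs_integral_le_L1_norm: "L1 f \<Longrightarrow> \<bar>\<integral>x. f x \<partial>lborel_01\<bar> \<le> L1_norm f"
  unfolding L1_norm_def by (rule integral_abs_bound)

lemma transfer_diff: "transfer k e (\<lambda>x. f x - g x) z = transfer k e f z - transfer k e g z"
  and transfer_add: "transfer k e (\<lambda>x. f x + g x) z = transfer k e f z + transfer k e g z"
  and transfer_cmult: "transfer k e (\<lambda>x. c * f x) z = c * transfer k e f z"
  by (simp_all add: transfer_def left_transfer_def algebra_simps diff_divide_distrib add_divide_distrib)

lemma transfer_nonneg: "k > 0 \<Longrightarrow> e \<ge> 1 \<Longrightarrow> (\<And>x. f x \<ge> 0) \<Longrightarrow> transfer k e f z \<ge> 0"
  by (simp add: transfer_def left_transfer_nonneg)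

lemma abs_transfer_le:
  assumes "k > 0" "e \<ge> 1"
  shows "\<bar>transfer k e f z\<bar> \<le> transfer k e (\<lambda>x. \<bar>f x\<bar>) z"
proof -
  have "\<bar>left_transfer k e f z\<bar> = left_transfer k e (\<lambda>x. \<bar>f x\<bar>) z"
    using assms by (simp add: left_transfer_def abs_mult)
  then show ?thesis unfolding transfer_def by linarith
qed

lemma branch_map_range: "0 < k \<Longrightarrow> k \<le> 1 \<Longrightarrow> e \<ge> 1 \<Longrightarrow> x \<in> {0..1} \<Longrightarrow> branch_map k e x \<in> {0..1}"
  by (auto simp: branch_map_def powr_le_one_le mult_le_one powr_le1)

lemma integral_transfer_aux:
  assumes k: "0 < k" "k \<le> 1" and e: "e \<ge> 1" and f: "L1 f" "\<And>x. f x \<ge> 0"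
    and [measurable]: "G \<in> borel_measurable borel" and G: "\<And>x. 0 \<le> G x" "\<And>x. G x \<le> (1::real)"
  shows "integrable lborel_01 (\<lambda>x. f x * G (branch_map k e x))"
    and "integrable lborel_01 (\<lambda>z. transfer k e f z * G z)"
    and "(\<integral>x. f x * G (branch_map k e x) \<partial>lborel_01) = (\<integral>z. transfer k e f z * G z \<partial>lborel_01)"
proof -
  note [measurable] = L1_measurable[OF f(1)]
  have 1: "L1 (\<lambda>x. f x * G (branch_map k e x))"
  proof (rule L1_bound[OF f(1)])
    show "\<bar>f x * G (branch_map k e x)\<bar> \<le> f x" for x
      using mult_left_le[OF G(2) f(2), of x "branch_map k e x"] f(2)[of x] G(1)[of "branch_map k e x"]
      by simp
  qed measurable
  then show I: "integrable lborel_01 (\<lambda>x. f x * G (branch_map k e x))" by (rule L1_integrable)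
  have eq: "(\<integral>\<^sup>+x. ennreal (f x * G (branch_map k e x)) \<partial>lborel_01) =
      (\<integral>\<^sup>+z. ennreal (transfer k e f z * G z) \<partial>lborel_01)"
    using nn_integral_transfer[OF k e, of f "\<lambda>x. ennreal (G x)"] f G transfer_nonneg[OF k(1) e f(2)]
    by (simp add: ennreal_mult)
  have nn: "0 \<le> transfer k e f z * G z" for z
    using G transfer_nonneg[OF k(1) e f(2)] by simp
  show "integrable lborel_01 (\<lambda>z. transfer k e f z * G z)"
  proof (rule integrableI_nonneg)
    show "(\<integral>\<^sup>+z. ennreal (transfer k e f z * G z) \<partial>lborel_01) < \<infinity>"
      using I f G unfolding eq [symmetric] by (simp add: integrable_iff_bounded)
  qed (use nn in \<open>auto intro!: measurable_lborel_01\<close>)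
  show "(\<integral>x. f x * G (branch_map k e x) \<partial>lborel_01) = (\<integral>z. transfer k e f z * G z \<partial>lborel_01)"
    using eq nn f G by (subst (1 2) integral_eq_nn_integral) (auto intro!: measurable_lborel_01)
qed

text \<open>The signed case follows by positive and negative parts. Test functions with values in
  [0, 1] cover indicators and probabilities, and keep all products integrable.\<close>

lemma integral_transfer:
  assumes k: "0 < k" "k \<le> 1" and e: "e \<ge> 1" and f: "L1 f"
    and G [measurable]: "G \<in> borel_measurable borel" and G: "\<And>x. 0 \<le> G x" "\<And>x. G x \<le> (1::real)"
  shows "integrable lborel_01 (\<lambda>x. f x * G (branch_map k e x))"
    and "integrable lborel_01 (\<lambda>z. transfer k e f z * G z)"
    and "(\<integral>x. f x * G (branch_map k e x) \<partial>lborel_01) = (\<integral>z. transfer k e f z * G z \<partial>lborel_01)"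
proof -
  define f1 where "f1 = (\<lambda>x. max (f x) 0)"
  define f2 where "f2 = (\<lambda>x. max (- f x) 0)"
  note [measurable] = L1_measurable[OF f]
  have f1: "L1 f1" "\<And>x. f1 x \<ge> 0"
    by (rule L1_bound[OF L1_abs[OF f]]) (auto simp: f1_def)
  have f2: "L1 f2" "\<And>x. f2 x \<ge> 0"
    by (rule L1_bound[OF L1_abs[OF f]]) (auto simp: f2_def)
  have ff: "f = (\<lambda>x. f1 x - f2 x)" by (auto simp: f1_def f2_def)
  note a1 = integral_transfer_aux[OF k e f1 \<open>G \<in> _\<close> G]
  note a2 = integral_transfer_aux[OF k e f2 \<open>G \<in> _\<close> G]
  have t: "transfer k e f z = transfer k e f1 z - transfer k e f2 z" for z
    by (subst ff) (rule transfer_diff)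
  have f': "f x = f1 x - f2 x" for x by (auto simp: f1_def f2_def)
  show "integrable lborel_01 (\<lambda>x. f x * G (branch_map k e x))"
    unfolding f' left_diff_distrib using a1 a2 by (intro Bochner_Integration.integrable_diff)
  show "integrable lborel_01 (\<lambda>z. transfer k e f z * G z)"
    unfolding t left_diff_distrib using a1 a2 by (intro Bochner_Integration.integrable_diff)
  show "(\<integral>x. f x * G (branch_map k e x) \<partial>lborel_01) = (\<integral>z. transfer k e f z * G z \<partial>lborel_01)"
    unfolding t unfolding f' left_diff_distrib using a1 a2 by (subst (1 2) Bochner_Integration.integral_diff) auto
qed

lemma L1_transfer:
  assumes "0 < k" "k \<le> 1" "e \<ge> 1" "L1 f"
  shows "L1 (transfer k e f)"
  using integral_transfer(2)[OF assms, of "\<lambda>_. 1"] measurable_transfer[OF L1_measurable[OF assms(4)]]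
  by (simp add: L1_def)

section \<open>The averaged operator: positivity, conservation of mass, iterates\<close>

locale good_bad_system =
  fixes J Bad :: "nat set" and p e :: "nat \<Rightarrow> real"
  assumes finite_J: "finite J"
    and p_pos: "\<And>j. j \<in> J \<Longrightarrow> p j > 0"
    and p_sum: "(\<Sum>j\<in>J. p j) = 1"
    and e_ge1: "\<And>j. j \<in> J \<Longrightarrow> e j \<ge> 1"
    and theta: "(\<Sum>j\<in>J \<inter> Bad. p j * e j) < 1"
    and good_exists: "J - Bad \<noteq> {}"
begin

text \<open>The left branch of map \<open>j\<close> covers [0, \<open>height j\<close>), so this is
  the parameter k of \<open>branch_map\<close>.\<close>

definition height :: "nat \<Rightarrow> real" where
  "height j = (if j \<in> Bad then 1/2 else 1)"

abbreviation branch_transfer :: "nat \<Rightarrow> (real \<Rightarrow> real) \<Rightarrow> real \<Rightarrow> real" where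
  "branch_transfer j \<equiv> transfer (height j) (e j)"

text \<open>The annealed transfer operator: up to null sets, its fixed points are the densities of
  the stationary measures (see \<open>stationary_sum\<close>).\<close>

definition P :: "(real \<Rightarrow> real) \<Rightarrow> real \<Rightarrow> real" where
  "P f z = (\<Sum>j\<in>J. p j * branch_transfer j f z)"

lemma height: "0 < height j" "height j \<le> 1"
  by (auto simp: height_def)

text \<open>All maps share the right branch, so its terms carry the total weight 1.\<close>

lemma P_alt: "P f z = (\<Sum>j\<in>J. p j * left_transfer (height j) (e j) f z) + f ((1 + z) / 2) / 2"
  unfolding P_def transfer_def ring_distribs sum.distrib sum_distrib_right [symmetric] p_sum by simp

lemma P_diff: "P (\<lambda>x. f x - g x) = (\<lambda>z. P f z - P g z)"
  and P_add: "P (\<lambda>x. f x + g x) = (\<lambda>z. P f z + P g z)"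
  and P_cmult: "P (\<lambda>x. c * f x) = (\<lambda>z. c * P f z)"
  by (auto simp: P_def transfer_diff transfer_add transfer_cmult algebra_simps sum_subtractf
      sum.distrib sum_distrib_left)

lemma P_nonneg: "(\<And>x. f x \<ge> 0) \<Longrightarrow> P f z \<ge> 0"
  unfolding P_def using height e_ge1 p_pos by (intro sum_nonneg mult_nonneg_nonneg transfer_nonneg) (auto simp: less_imp_le)

lemma abs_P_le: "\<bar>P f z\<bar> \<le> P (\<lambda>x. \<bar>f x\<bar>) z"
proof -
  have "\<bar>P f z\<bar> \<le> (\<Sum>j\<in>J. \<bar>p j * branch_transfer j f z\<bar>)" unfolding P_def by (rule sum_abs)
  also have "\<dots> \<le> (\<Sum>j\<in>J. p j * branch_transfer j (\<lambda>x. \<bar>f x\<bar>) z)"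
  proof (rule sum_mono)
    fix j assume "j \<in> J"
    then show "\<bar>p j * branch_transfer j f z\<bar> \<le> p j * branch_transfer j (\<lambda>x. \<bar>f x\<bar>) z"
      using p_pos[of j] abs_transfer_le[of "height j" "e j" f z] height e_ge1[of j]
      by (simp add: abs_mult)
  qed
  finally show ?thesis by (simp add: P_def)
qed

lemma L1_P: "L1 f \<Longrightarrow> L1 (P f)"
  unfolding P_def[abs_def] using height e_ge1 by (intro L1_sum L1_cmult L1_transfer) auto

lemma integral_P_mult:
  assumes f: "L1 f" and G: "G \<in> borel_measurable borel" "\<And>x. 0 \<le> G x" "\<And>x. G x \<le> (1::real)"
  shows "(\<integral>z. P f z * G z \<partial>lborel_01) =
    (\<Sum>j\<in>J. p j * (\<integral>x. f x * G (branch_map (height j) (e j) x) \<partial>lborel_01))"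
proof -
  note it = integral_transfer[OF height e_ge1 f G]
  have "(\<integral>z. P f z * G z \<partial>lborel_01) = (\<integral>z. (\<Sum>j\<in>J. p j * (branch_transfer j f z * G z)) \<partial>lborel_01)"
    by (simp add: P_def sum_distrib_right mult.assoc)
  also have "\<dots> = (\<Sum>j\<in>J. p j * (\<integral>z. branch_transfer j f z * G z \<partial>lborel_01))"
    using it by (subst Bochner_Integration.integral_sum) auto
  finally show ?thesis using it by simp
qed

lemma integral_P: "L1 f \<Longrightarrow> (\<integral>z. P f z \<partial>lborel_01) = (\<integral>z. f z \<partial>lborel_01)"
  using integral_P_mult[of f "\<lambda>_. 1"] by (simp add: sum_distrib_right [symmetric] p_sum)

lemma L1_norm_P_le: "L1 f \<Longrightarrow> L1_norm (P f) \<le> L1_norm f"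
proof -
  assume f: "L1 f"
  have "L1_norm (P f) \<le> (\<integral>z. P (\<lambda>x. \<bar>f x\<bar>) z \<partial>lborel_01)"
    unfolding L1_norm_def using f abs_P_le
    by (intro integral_mono) (auto intro!: L1_integrable L1_abs L1_P)
  also have "\<dots> = L1_norm f" using f by (simp add: integral_P L1_abs L1_norm_def)
  finally show ?thesis .
qed

lemma iter_diff: "(P ^^ n) (\<lambda>x. f x - g x) = (\<lambda>z. (P ^^ n) f z - (P ^^ n) g z)"
  by (induction n) (auto simp: P_diff)

lemma iter_add: "(P ^^ n) (\<lambda>x. f x + g x) = (\<lambda>z. (P ^^ n) f z + (P ^^ n) g z)"
  by (induction n) (auto simp: P_add)

lemma iter_cmult: "(P ^^ n) (\<lambda>x. c * f x) = (\<lambda>z. c * (P ^^ n) f z)"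
  by (induction n) (auto simp: P_cmult)

lemma L1_iter: "L1 f \<Longrightarrow> L1 ((P ^^ n) f)"
  by (induction n) (auto intro: L1_P)

lemma integral_iter: "L1 f \<Longrightarrow> (\<integral>z. (P ^^ n) f z \<partial>lborel_01) = (\<integral>z. f z \<partial>lborel_01)"
  by (induction n) (auto simp: integral_P L1_iter)

lemma L1_norm_iter_le: "L1 f \<Longrightarrow> L1_norm ((P ^^ n) f) \<le> L1_norm f"
proof (induction n)
  case (Suc n)
  then show ?case using L1_norm_P_le[OF L1_iter[OF Suc.prems, of n]] by simp
qed simp

end

section \<open>An invariant class of dominated densities\<close>

lemma one_minus_ln_powr_le:
  fixes q y :: real
  assumes "q \<ge> 1" "0 < y" "y \<le> 1"
  shows "y * (1 - ln y) powr q \<le> q powr q"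
proof -
  define u where "u = - ln y"
  have u: "u \<ge> 0" "y = exp (- u)" using assms by (simp_all add: u_def)
  \<comment> \<open>Using u / q instead of u makes the q-th power equal to exp u, which cancels y.
    The resulting bound keeps \<open>log_weight\<close> away from 0, so that multiples of it
    dominate constants.\<close>
  have "1 + u / q \<le> exp (u / q)" by (rule exp_ge_add_one_self)
  then have "1 + u \<le> q * exp (u / q)" using assms u by (simp add: field_simps)
  then have "(1 + u) powr q \<le> (q * exp (u / q)) powr q"
    using assms u by (intro powr_mono2) auto
  also have "\<dots> = q powr q * exp u"
    using assms by (simp add: powr_mult exp_powr_real)
  finally have "exp (- u) * (1 + u) powr q \<le> exp (- u) * (q powr q * exp u)"
    by (rule mult_left_mono) simp
  also have "\<dots> = q powr q" by (simp add: exp_minus)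
  finally have "exp (- u) * (1 + u) powr q \<le> q powr q" .
  moreover have "1 - ln y = 1 + u" by (simp add: u_def)
  ultimately show ?thesis using u(2) by simp
qed

text \<open>In the logarithmic coordinate \<open>u = - ln y\<close> this is the density \<open>(1 + u) powr - q\<close>,
  and \<open>y \<mapsto> y powr e\<close> becomes multiplication of \<open>u\<close> by \<open>e\<close>.\<close>

definition log_weight :: "real \<Rightarrow> real \<Rightarrow> real" where
  "log_weight q y = 1 / (y * (1 - ln y) powr q)"

lemma measurable_log_weight [measurable]: "log_weight q \<in> borel_measurable borel"
  unfolding log_weight_def by measurable

lemma log_weight_nonneg: "0 \<le> y \<Longrightarrow> 0 \<le> log_weight q y"
  by (simp add: log_weight_def)

lemma log_weight_ge:
  assumes "q \<ge> 1" "0 < y" "y \<le> 1"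
  shows "1 / q powr q \<le> log_weight q y"
proof -
  have "1 - ln y > 0" using assms by (smt (verit) ln_le_zero_iff)
  then show ?thesis unfolding log_weight_def
    using one_minus_ln_powr_le[OF assms] assms by (intro divide_left_mono) auto
qed

lemma log_weight_antimono:
  assumes "q \<le> s" "0 < y" "y \<le> 1"
  shows "log_weight s y \<le> log_weight q y"
proof -
  define L where "L = 1 - ln y"
  have l: "L \<ge> 1" using assms by (simp add: L_def)
  then have "L powr q \<le> L powr s" using assms by (intro powr_mono) auto
  then show ?thesis unfolding log_weight_def L_def [symmetric]
    using l assms by (intro divide_left_mono mult_left_mono) auto
qed

text \<open>The antiderivative (1 - ln y)^(1 - s) / (s - 1) tends to 0 at 0 because s > 1. This is
  what limits the admissible exponents.\<close>

lemma set_integrable_log_weight: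
  assumes s: "s > 1"
  shows "set_integrable lborel {0<..<1} (log_weight s)"
proof -
  define F where "F = (\<lambda>y::real. (1 - ln y) powr (1 - s) / (s - 1))"
  have "set_integrable lborel (einterval (ereal 0) (ereal 1)) (log_weight s)"
  proof (rule interval_integral_FTC_nonneg(1))
    fix x :: real assume "ereal 0 < ereal x" "ereal x < ereal 1"
    then have x: "0 < x" "x < 1" by auto
    then have l: "1 - ln x > 1" by simp
    have "((\<lambda>y. (1 - ln y) powr (1 - s)) has_real_derivative
        (1 - s) * (1 - ln x) powr (1 - s - 1) * (- (1 / x))) (at x)"
    proof (rule DERIV_chain2[where f = "\<lambda>z. z powr (1 - s)" and g = "\<lambda>y. 1 - ln y"])
      show "((\<lambda>z. z powr (1 - s)) has_real_derivative (1 - s) * (1 - ln x) powr (1 - s - 1)) (at (1 - ln x))"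
        using l by (intro has_real_derivative_powr) linarith
      show "((\<lambda>y. 1 - ln y) has_real_derivative - (1 / x)) (at x)"
        using x by (auto intro!: derivative_eq_intros simp: field_simps)
    qed
    moreover have "(1 - s) * (1 - ln x) powr (1 - s - 1) * (- (1 / x)) / (s - 1) = log_weight s x"
    proof -
      have 1: "(1 - s) * B * (- (1 / x)) / (s - 1) = B / x" for B
        using s x by (simp add: field_simps)
      have 2: "(1 - ln x) powr (1 - s - 1) = 1 / (1 - ln x) powr s"
        by (simp add: powr_minus_divide)
      show ?thesis unfolding 1 unfolding 2 log_weight_def by simp
    qed
    ultimately show "DERIV F x :> log_weight s x"
      unfolding F_def by (metis DERIV_cdivide)
    show "isCont (log_weight s) x"
      unfolding log_weight_def
    proof (intro continuous_intros)
      have "ln x \<noteq> 1" using l by linarith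
      then show "x * (1 - ln x) powr s \<noteq> 0" using x by simp
    qed (use x l in \<open>linarith+\<close>)
  next
    show "AE x in lborel. ereal 0 < ereal x \<longrightarrow> ereal x < ereal 1 \<longrightarrow> 0 \<le> log_weight s x"
      by (intro AE_I2) (auto intro: log_weight_nonneg)
    have "((\<lambda>y::real. (1 - ln y) powr (1 - s) / (s - 1)) \<longlongrightarrow> 0) (at_right 0)"
      using s by real_asymp
    then show "((F \<circ> real_of_ereal) \<longlongrightarrow> 0) (at_right (ereal 0))"
      unfolding F_def by (simp only: ereal_tendsto_simps)
    have "((\<lambda>y::real. (1 - ln y) powr (1 - s) / (s - 1)) \<longlongrightarrow> 1 / (s - 1)) (at_left 1)"
      using s by (auto intro!: tendsto_eq_intros)
    then show "((F \<circ> real_of_ereal) \<longlongrightarrow> 1 / (s - 1)) (at_left (ereal 1))"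
      unfolding F_def by (simp only: ereal_tendsto_simps)
  qed simp
  then show ?thesis by (simp add: einterval_eq)
qed

lemma integrable_log_weight_affine:
  assumes s: "s > 1" and c: "c > 0"
  shows "integrable lborel (\<lambda>x. indicator {0<..<1} (1 - c * x) * log_weight s (1 - c * x))"
  using lborel_integrable_real_affine[of "\<lambda>y. indicator {0<..<1} y * log_weight s y" "-c" 1]
    set_integrable_log_weight[OF s] c
  by (simp add: set_integrable_def)

text \<open>The left side is the density \<open>log_weight q\<close> transported by y -> y^e. With t
  = - ln u the estimate is just 1 + t / e \<ge> (1 + t) / e. The factor e^(q-1) is the source of the
  condition on the sum over the bad maps.\<close>

lemma log_weight_powr_le:
  assumes e: "e \<ge> 1" and q: "q \<ge> 1" and u: "0 < u" "u \<le> 1"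
  shows "u powr (1/e - 1) / e * log_weight q (u powr (1/e)) \<le> e powr (q - 1) * log_weight q u"
proof -
  have ln: "ln u \<le> 0" using u by simp
  then have 1: "(1 - ln u) / e \<le> 1 - ln u / e"
    using e by (simp add: field_simps)
  have pos: "0 < (1 - ln u) / e" using e ln by simp
  have a: "u powr (1/e - 1) = u powr (1/e) / u" "u powr (1/e) > 0" "ln (u powr (1/e)) = ln u / e"
    using u by (simp_all add: powr_diff ln_powr)
  have "u powr (1/e - 1) / e * log_weight q (u powr (1/e)) = 1 / (u * e * (1 - ln u / e) powr q)"
    using a(2) u e unfolding log_weight_def a(1,3) by (simp del: powr_gt_zero)
  also have "\<dots> \<le> 1 / (u * e * ((1 - ln u) / e) powr q)"
  proof -
    have "((1 - ln u) / e) powr q \<le> (1 - ln u / e) powr q"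
      using 1 pos q by (intro powr_mono2) linarith+
    moreover have "0 < ((1 - ln u) / e) powr q" using pos by (metis powr_gt_zero less_irrefl)
    moreover have "1 / (u * e * b) \<le> 1 / (u * e * a)" if "a \<le> b" "0 < a" for a b
      using u e that by (intro divide_left_mono mult_left_mono mult_pos_pos) auto
    ultimately show ?thesis by blast
  qed
  also have "\<dots> = e powr (q - 1) * log_weight q u"
    using e u ln by (simp add: log_weight_def powr_divide powr_diff field_simps)
  finally show ?thesis .
qed

text \<open>Supersolution inequality for the doubling near 1. Halving d shifts L = 1 - ln d by ln 2,
  and the resulting decrease of L^-(q-1) is of order L^-q, enough to pay for a source of that order.
  Hence the exponent drops by one between 1/2 and 1.\<close>

lemma log_weight_half_le:
  assumes q: "q \<ge> 2" and d: "0 < d" "d \<le> 1"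
  shows "log_weight (q - 1) (d / 2) / 2 + ln 2 / (1 + ln 2) * log_weight q d \<le> log_weight (q - 1) d"
proof -
  define L where "L = 1 - ln d"
  define M where "M = L + ln 2"
  have L: "L \<ge> 1" using d by (simp add: L_def)
  have l2: "ln (2::real) > 0" by simp
  have M: "M > L" "M > 0" unfolding M_def using L l2 by linarith+
  have eq: "1 - ln (d / 2) = M" using d by (simp add: M_def L_def ln_div)
  \<comment> \<open>The base is below 1 and q - 1 is at least 1, so lowering the exponent to 1 can
    only increase the power.\<close>
  have "(L / M) powr (q - 1) \<le> (L / M) powr 1"
    using q L M by (intro powr_mono') auto
  also have "\<dots> = 1 - ln 2 / M" using L M by (simp add: M_def field_simps)
  also have "\<dots> \<le> 1 - ln 2 / (1 + ln 2) / L"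
  proof -
    \<comment> \<open>From L \<ge> 1; this produces the constant ln 2 / (1 + ln 2).\<close>
    have "M \<le> (1 + ln 2) * L" using L l2 mult_left_mono[OF L, of "ln 2"] by (simp add: M_def algebra_simps)
    then have "ln 2 / ((1 + ln 2) * L) \<le> ln 2 / M"
      using M L l2 by (intro divide_left_mono) auto
    then show ?thesis by simp
  qed
  finally have *: "L powr (q - 1) / M powr (q - 1) + ln 2 / (1 + ln 2) / L \<le> 1"
    using L M by (simp add: powr_divide)
  have "log_weight (q - 1) (d / 2) / 2 + ln 2 / (1 + ln 2) * log_weight q d =
     (L powr (q - 1) / M powr (q - 1) + ln 2 / (1 + ln 2) / L) * log_weight (q - 1) d"
  proof -
    have "log_weight (q - 1) (d / 2) / 2 = L powr (q - 1) / M powr (q - 1) * log_weight (q - 1) d"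
      using L M d by (simp add: log_weight_def eq L_def [symmetric])
    moreover have "log_weight q d = 1 / L * log_weight (q - 1) d"
      using L d by (simp add: log_weight_def L_def [symmetric] powr_diff)
    ultimately show ?thesis by (simp add: ring_distribs)
  qed
  also have "\<dots> \<le> 1 * log_weight (q - 1) d"
    using * log_weight_nonneg[of d "q - 1"] d by (intro mult_right_mono) auto
  finally show ?thesis by simp
qed

text \<open>The two halves are not compared with each other: images of bad left branches end at 1/2,
  so a drop there is unavoidable. Nothing is asked at the point 1, where densities blow up.
  Nonnegativity on the whole line spares domain conditions for the transfer operators.\<close>

definition cone :: "(real \<Rightarrow> real) \<Rightarrow> bool" where
  "cone f \<longleftrightarrow> f \<in> borel_measurable borel \<and> (\<forall>x. 0 \<le> f x) \<and> mono_on {0..<1/2} f \<and> mono_on {1/2..<1} f"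

lemma cone_nonneg: "cone f \<Longrightarrow> 0 \<le> f x"
  by (simp add: cone_def)

lemma cone_measurable: "cone f \<Longrightarrow> f \<in> borel_measurable borel"
  by (simp add: cone_def)

lemma left_inv_bounds:
  assumes "0 < k" "e \<ge> 1" "0 \<le> z" "z < k"
  shows "left_inv k e z \<in> {0..<1/2}"
  using assms by (auto simp: left_inv_def powr_le1)

text \<open>Both factors are nondecreasing in z: 1 - z / k decreases but has the exponent 1/e - 1
  \<le> 0, and \<open>left_inv\<close> increases within [0, 1/2).\<close>

lemma left_transfer_mono:
  assumes k: "0 < k" and e: "e \<ge> 1" and f: "cone f" and z: "0 \<le> x" "x \<le> z" "z < k"
  shows "left_transfer k e f x \<le> left_transfer k e f z"
proof -
  have u: "0 < 1 - z / k" "1 - z / k \<le> 1 - x / k" using k z by (auto simp: divide_right_mono)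
  have "(1 - x / k) powr (1/e - 1) \<le> (1 - z / k) powr (1/e - 1)"
    using u e by (intro powr_mono2') auto
  moreover have "left_inv k e x \<le> left_inv k e z"
    unfolding left_inv_def using u e by (auto intro!: divide_right_mono powr_mono2)
  then have "f (left_inv k e x) \<le> f (left_inv k e z)"
    using f left_inv_bounds[OF k e, of x] left_inv_bounds[OF k e, of z] z
    by (auto simp: cone_def mono_on_def)
  ultimately show ?thesis
    using k e z f by (auto simp: left_transfer_def cone_nonneg intro!: mult_mono divide_right_mono)
qed

lemma interval_le_integral:
  assumes f: "cone f" "L1 f" and x: "0 \<le> x" "x \<le> b" "b \<le> 1" and c: "\<And>y. y \<in> {x..<b} \<Longrightarrow> c \<le> f y"
  shows "c * (b - x) \<le> (\<integral>y. f y \<partial>lborel_01)"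
proof -
  have m: "emeasure lborel_01 {x..<b} = ennreal (b - x)"
    using x by (subst emeasure_restrict_space) auto
  have s: "{x..<b} \<in> sets lborel_01"
    using x by (auto simp: sets_restrict_space intro!: image_eqI[of _ _ "{x..<b}"])
  have "c * (b - x) = (\<integral>y. c * indicator {x..<b} y \<partial>lborel_01)"
  proof -
    have "{x..<b} \<inter> {0..1} = {x..<b}" using x by auto
    then show ?thesis using x m by (simp add: measure_def)
  qed
  also have "\<dots> \<le> (\<integral>y. f y \<partial>lborel_01)"
  proof (rule integral_mono)
    show "integrable lborel_01 (\<lambda>y. c * indicator {x..<b} y)"
      using m s by (intro integrable_mult_right integrable_real_indicator) auto
    show "c * indicator {x..<b} y \<le> f y" for y
      using c[of y] cone_nonneg[OF f(1), of y] by (auto split: split_indicator)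
  qed (rule L1_integrable[OF f(2)])
  finally show ?thesis .
qed

text \<open>By monotonicity f is at least f x on all of [x, 1/2). This turns mass into a pointwise
  bound at any fixed distance from the singularity.\<close>

lemma cone_bound_left:
  assumes "cone f" "L1 f" "0 \<le> x" "x < 1/2"
  shows "f x * (1/2 - x) \<le> (\<integral>y. f y \<partial>lborel_01)"
  using assms by (intro interval_le_integral) (auto simp: cone_def mono_on_def)

lemma cone_bound_right:
  assumes "cone f" "L1 f" "1/2 \<le> x" "x < 1"
  shows "f x * (1 - x) \<le> (\<integral>y. f y \<partial>lborel_01)"
  using assms by (intro interval_le_integral) (auto simp: cone_def mono_on_def)

context good_bad_system
begin

text \<open>Each term is nondecreasing as long as it is present; terms of bad left branches
  disappear exactly at 1/2, which is the break point of the cone.\<close>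

lemma cone_P:
  assumes f: "cone f"
  shows "cone (P f)"
  unfolding cone_def
proof (intro conjI)
  note [measurable] = cone_measurable[OF f]
  show "P f \<in> borel_measurable borel" unfolding P_def[abs_def] by measurable
  show "\<forall>x. 0 \<le> P f x" using P_nonneg cone_nonneg[OF f] by blast
  have right: "f ((1 + x) / 2) \<le> f ((1 + z) / 2)" if "0 \<le> x" "x \<le> z" "z < 1" for x z
    using f that by (auto simp: cone_def mono_on_def)
  \<comment> \<open>The condition \<open>h\<close> says that no left branch ends between x and z, so
    no summand drops to 0 on the way.\<close>
  have mono: "P f x \<le> P f z"
    if xz: "0 \<le> x" "x \<le> z" "z < 1" and h: "\<And>j. z < height j \<or> height j \<le> x" for x z
    unfolding P_alt
  proof (intro add_mono sum_mono mult_left_mono)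
    fix j assume j: "j \<in> J"
    show "left_transfer (height j) (e j) f x \<le> left_transfer (height j) (e j) f z"
    proof (cases "z < height j")
      case True
      then show ?thesis using xz height e_ge1[OF j] f by (intro left_transfer_mono) auto
    next
      case False
      then show ?thesis using h[of j] xz by (auto simp: left_transfer_def)
    qed
  qed (use right[OF xz] p_pos in \<open>auto simp: less_imp_le\<close>)
  show "mono_on {0..<1/2} (P f)" "mono_on {1/2..<1} (P f)"
    by (auto intro!: mono_onI mono simp: height_def)
qed

text \<open>At q = 2 the sum is theta < 1, and it is continuous in q.\<close>

lemma exists_exponent: "\<exists>q>2. (\<Sum>j\<in>J \<inter> Bad. p j * e j powr (q - 1)) < 1"
proof -
  have "((\<lambda>q. \<Sum>j\<in>J \<inter> Bad. p j * e j powr (q - 1)) \<longlongrightarrow> (\<Sum>j\<in>J \<inter> Bad. p j * e j powr (2 - 1))) (at_right 2)"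
    using e_ge1 by (intro tendsto_intros) force
  moreover have "(\<Sum>j\<in>J \<inter> Bad. p j * e j powr (2 - 1)) < 1"
    using theta e_ge1 by (smt (verit) IntD1 powr_one sum.cong)
  ultimately have "\<forall>\<^sub>F q in at_right 2. (\<Sum>j\<in>J \<inter> Bad. p j * e j powr (q - 1)) < 1"
    by (rule order_tendstoD)
  moreover have "\<forall>\<^sub>F q in at_right (2::real). q > 2" by (rule eventually_at_right_less)
  ultimately have "\<forall>\<^sub>F q in at_right 2. q > 2 \<and> (\<Sum>j\<in>J \<inter> Bad. p j * e j powr (q - 1)) < 1"
    by eventually_elim auto
  then show ?thesis by (auto dest!: eventually_happens)
qed

text \<open>H is A times the weight of exponent q towards 1/2 and D times the weight of exponent q -
  1 towards 1. Both exponents exceed 1, so H is integrable. On the left half only the bad branches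
  see the singularity, with total factor \<theta> < 1; on the right half the inflow from the left is
  absorbed by \<open>log_weight_half_le\<close>.\<close>

lemma exists_majorant:
  obtains H where "L1 H" "\<And>x. 0 \<le> H x" "\<And>x. x \<in> {0..<1} \<Longrightarrow> 1 \<le> H x"
    "\<forall>f. cone f \<and> L1 f \<and> (\<integral>y. f y \<partial>lborel_01) \<le> 1 \<and> (\<forall>y\<in>{0..<1}. f y \<le> H y) \<longrightarrow>
      (\<forall>x\<in>{0..<1}. P f x \<le> H x)"
proof -
  obtain q where q: "q > 2" and th: "(\<Sum>j\<in>J \<inter> Bad. p j * e j powr (q - 1)) < 1"
    using exists_exponent by auto
  define \<theta> where "\<theta> = (\<Sum>j\<in>J \<inter> Bad. p j * e j powr (q - 1))"
  have \<theta>: "0 \<le> \<theta>" "\<theta> < 1"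
    using th p_pos by (auto simp: \<theta>_def less_imp_le intro!: sum_nonneg)
  define Q where "Q = q powr q"
  have Q: "Q > 0" using q by (simp add: Q_def)
  \<comment> \<open>Solves A \<theta> w + 6 \<le> A w for all w \<ge> 1 / Q, where 1 / Q is the
    minimum guaranteed by \<open>log_weight_ge\<close>. Here 6 = 4 + 2 collects the good left
    branches (\<open>lg\<close>) and the right branch (\<open>r\<close>).\<close>
  define A where "A = 6 * Q / (1 - \<theta>)"
  have A: "A \<ge> Q" "A > 0" "A * (1 - \<theta>) = 6 * Q"
    using \<theta> Q by (auto simp: A_def field_simps)
  define R where "R = (\<Sum>j\<in>J. p j * e j powr (q - 1))"
  have R: "R \<ge> 0" using p_pos by (auto simp: R_def less_imp_le intro!: sum_nonneg)
  define c0 :: real where "c0 = ln 2 / (1 + ln 2)"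
  have c0: "c0 > 0" by (simp add: c0_def add_pos_pos)
  \<comment> \<open>The second summand makes D c0 at least A R / 2, the size of the inflow from the
    left half; the first gives H \<ge> 1 on the right half.\<close>
  define D where "D = Q + A * R / (2 * c0)"
  have "0 \<le> A * R / (2 * c0)" using A R c0 by simp
  moreover have "D * c0 = Q * c0 + A * R / 2" using c0 by (simp add: D_def field_simps)
  ultimately have D: "D \<ge> Q" "D > 0" "A * R / 2 \<le> D * c0"
    using Q c0 by (auto simp: D_def add_pos_nonneg)
  define H where "H = (\<lambda>x. indicator {0..<1/2} x * (A * log_weight q (1 - 2 * x)) +
      indicator {1/2..<1} x * (D * log_weight (q - 1) (1 - x)))"
  have Hl: "H x = A * log_weight q (1 - 2 * x)" if "0 \<le> x" "x < 1/2" for x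
    using that by (simp add: H_def)
  have Hr: "H x = D * log_weight (q - 1) (1 - x)" if "1/2 \<le> x" "x < 1" for x
    using that by (simp add: H_def)
  have H_nonneg: "0 \<le> H x" for x
    unfolding H_def using A D by (auto split: split_indicator intro!: log_weight_nonneg mult_nonneg_nonneg)
  have H_ge1: "1 \<le> H x" if "x \<in> {0..<1}" for x
  proof (cases "x < 1/2")
    case True
    have "1 = Q * (1 / q powr q)" using Q by (simp add: Q_def)
    also have "\<dots> \<le> A * log_weight q (1 - 2 * x)"
      using that True A Q q log_weight_ge[of q "1 - 2 * x"] by (intro mult_mono) auto
    finally show ?thesis using that True by (simp add: Hl)
  next
    case False
    have "1 = Q * (1 / q powr q)" using Q by (simp add: Q_def)
    also have "\<dots> \<le> D * log_weight q (1 - x)"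
      using that False D Q q log_weight_ge[of q "1 - x"] by (intro mult_mono) auto
    also have "\<dots> \<le> D * log_weight (q - 1) (1 - x)"
      using that D log_weight_antimono[of "q - 1" q "1 - x"] by (intro mult_left_mono) auto
    finally show ?thesis using that False by (simp add: Hr)
  qed
  have [measurable]: "H \<in> borel_measurable borel" unfolding H_def by measurable
  have "integrable lborel H"
  proof (rule integrable_cong_AE_imp)
    show "integrable lborel (\<lambda>x. A * (indicator {0<..<1} (1 - 2 * x) * log_weight q (1 - 2 * x)) +
       indicator {1/2..<1} x *\<^sub>R (D * (indicator {0<..<1} (1 - 1 * x) * log_weight (q - 1) (1 - 1 * x))))"
      using q by (intro Bochner_Integration.integrable_add integrable_mult_right integrable_mult_indicator
        integrable_log_weight_affine) auto
    have *: "H x = A * (indicator {0<..<1} (1 - 2 * x) * log_weight q (1 - 2 * x)) +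
       indicator {1/2..<1} x *\<^sub>R (D * (indicator {0<..<1} (1 - 1 * x) * log_weight (q - 1) (1 - 1 * x)))"
      if "x \<noteq> 0" for x using that by (auto simp: H_def split: split_indicator)
    show "AE x in lborel. A * (indicator {0<..<1} (1 - 2 * x) * log_weight q (1 - 2 * x)) +
       indicator {1/2..<1} x *\<^sub>R (D * (indicator {0<..<1} (1 - 1 * x) * log_weight (q - 1) (1 - 1 * x))) = H x"
      using AE_lborel_singleton[of 0] by eventually_elim (rule *[symmetric])
  qed simp
  then have "integrable lborel_01 H"
    using integrable_mult_indicator[of "{0..1}" lborel H] by (simp add: integrable_restrict_space)
  then have L1H: "L1 H" by (simp add: L1_def)
  have main: "P f z \<le> H z"
    if f: "cone f" "L1 f" "(\<integral>y. f y \<partial>lborel_01) \<le> 1" and fH: "\<And>y. y \<in> {0..<1} \<Longrightarrow> f y \<le> H y"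
      and z: "z \<in> {0..<1}" for f z
  proof -
    \<comment> \<open>Used with u = 1 - z / k: once for the bad maps when z < 1/2, and once for the
      good maps when z \<ge> 1/2.\<close>
    have core: "u powr (1/e j - 1) / e j * f ((1 - u powr (1/e j)) / 2) \<le> A * (e j powr (q - 1) * log_weight q u)"
      if j: "j \<in> J" and u: "0 < u" "u \<le> 1" for j u
    proof -
      note e = e_ge1[OF j]
      have x: "(1 - u powr (1/e j)) / 2 \<in> {0..<1/2}" using u e by (auto simp: powr_le1)
      then have "(1 - u powr (1/e j)) / 2 \<in> {0..<1}" by (rule subsetD[rotated]) auto
      then have "f ((1 - u powr (1/e j)) / 2) \<le> A * log_weight q (u powr (1/e j))"
        using fH[of "(1 - u powr (1/e j)) / 2"] Hl[of "(1 - u powr (1/e j)) / 2"] x by (auto simp: diff_divide_distrib)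
      then have "u powr (1/e j - 1) / e j * f ((1 - u powr (1/e j)) / 2) \<le>
          u powr (1/e j - 1) / e j * (A * log_weight q (u powr (1/e j)))"
        using e by (intro mult_left_mono) auto
      also have "\<dots> = A * (u powr (1/e j - 1) / e j * log_weight q (u powr (1/e j)))" by simp
      also have "\<dots> \<le> A * (e j powr (q - 1) * log_weight q u)"
        using log_weight_powr_le[OF e _ u, of q] q A by (intro mult_left_mono) auto
      finally show ?thesis .
    qed
    show ?thesis
    proof (cases "z < 1/2")
      case True
      define w where "w = log_weight q (1 - 2 * z)"
      have w: "1 / Q \<le> w" using True z q unfolding w_def Q_def by (intro log_weight_ge) auto
      have lb: "left_transfer (height j) (e j) f z \<le> A * (e j powr (q - 1) * w)" if j: "j \<in> J \<inter> Bad" for j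
        using core[of j "1 - 2 * z"] j True z
        by (simp add: left_transfer_def left_inv_def height_def w_def mult_ac)
      \<comment> \<open>For z < 1/2 the preimage under a good left branch is at distance at least
        1/4 from 1/2, so the cone bound gives f x \<le> 4, while the weight is at most 1.\<close>
      have lg: "left_transfer (height j) (e j) f z \<le> 4" if j: "j \<in> J - Bad" for j
      proof -
        have e: "e j \<ge> 1" using j e_ge1 by auto
        define u where "u = 1 - z"
        have u: "1/2 \<le> u" "u \<le> 1" using True z by (auto simp: u_def)
        have "u powr (1/e j - 1) \<le> u powr (- 1)" using u e by (intro powr_mono') auto
        also have "\<dots> \<le> 2" using u by (simp add: powr_minus field_simps)
        finally have 1: "u powr (1/e j - 1) \<le> 2" .
        define x where "x = left_inv 1 (e j) z"
        have x: "x \<in> {0..<1/2}" unfolding x_def using True z e by (intro left_inv_bounds) auto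
        have "u powr 1 \<le> u powr (1/e j)" using u e by (intro powr_mono') auto
        then have "1/4 \<le> 1/2 - x" using u by (simp add: x_def left_inv_def u_def)
        then have "f x * (1/4) \<le> f x * (1/2 - x)"
          using cone_nonneg[OF f(1)] by (intro mult_left_mono) auto
        also have "\<dots> \<le> 1" using cone_bound_left[OF f(1,2), of x] x f(3) by auto
        finally have 2: "f x \<le> 4" by simp
        have "u powr (1/e j - 1) / (2 * e j) \<le> 2 / 2" using 1 e by (intro frac_le) auto
        then have "u powr (1/e j - 1) / (2 * e j) * f x \<le> 1 * 4"
          using 2 cone_nonneg[OF f(1)] by (intro mult_mono) auto
        then show ?thesis using j True by (simp add: left_transfer_def height_def x_def u_def)
      qed
      \<comment> \<open>The preimage (1 + z) / 2 stays below 3/4, at distance at least 1/4 from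
        1.\<close>
      have r: "f ((1 + z) / 2) / 2 \<le> 2"
      proof -
        have "f ((1 + z) / 2) * (1/4) \<le> f ((1 + z) / 2) * (1 - (1 + z) / 2)"
          using cone_nonneg[OF f(1)] True by (intro mult_left_mono) auto
        also have "\<dots> \<le> 1" using cone_bound_right[OF f(1,2), of "(1 + z) / 2"] z f(3) by auto
        finally show ?thesis by simp
      qed
      have "(\<Sum>j\<in>J. p j * left_transfer (height j) (e j) f z) =
        (\<Sum>j\<in>J \<inter> Bad. p j * left_transfer (height j) (e j) f z) + (\<Sum>j\<in>J - Bad. p j * left_transfer (height j) (e j) f z)"
        by (rule sum.Int_Diff[OF finite_J])
      also have "\<dots> \<le> (\<Sum>j\<in>J \<inter> Bad. p j * (A * (e j powr (q - 1) * w))) + (\<Sum>j\<in>J - Bad. p j * 4)"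
        using lb lg p_pos by (intro add_mono sum_mono mult_left_mono) (auto simp: less_imp_le)
      also have "(\<Sum>j\<in>J \<inter> Bad. p j * (A * (e j powr (q - 1) * w))) = A * \<theta> * w"
        by (simp add: \<theta>_def sum_distrib_left sum_distrib_right mult_ac)
      also have "(\<Sum>j\<in>J - Bad. p j * 4) \<le> 4"
      proof -
        have "(\<Sum>j\<in>J - Bad. p j) \<le> (\<Sum>j\<in>J. p j)"
          using finite_J p_pos by (intro sum_mono2) (auto simp: less_imp_le)
        then show ?thesis by (simp add: p_sum sum_distrib_right [symmetric])
      qed
      finally have "P f z \<le> A * \<theta> * w + 6" using r unfolding P_alt by simp
      also have "6 \<le> A * (1 - \<theta>) * w"
        using mult_left_mono[OF w, of "6 * Q"] Q by (simp add: A(3))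
      finally have "P f z \<le> A * w" by (simp add: algebra_simps)
      then show ?thesis using True z by (simp add: Hl w_def)
    next
      case False
      define w where "w = log_weight q (1 - z)"
      have w: "0 \<le> w" using z by (auto simp: w_def intro: log_weight_nonneg)
      \<comment> \<open>Bad left branches do not reach the right half; for good ones the factor 1/2
        comes from k = 1 in the weight 1 / (2 k e).\<close>
      have l: "left_transfer (height j) (e j) f z \<le> A / 2 * (e j powr (q - 1) * w)" if j: "j \<in> J" for j
      proof (cases "j \<in> Bad")
        case True
        then show ?thesis using False A w by (simp add: left_transfer_def height_def)
      next
        case good: False
        have "left_transfer (height j) (e j) f z = ((1 - z) powr (1/e j - 1) / e j * f ((1 - (1 - z) powr (1/e j)) / 2)) / 2"
          using good z by (simp add: left_transfer_def left_inv_def height_def)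
        also have "\<dots> \<le> (A * (e j powr (q - 1) * w)) / 2"
          unfolding w_def using core[of j "1 - z"] j z by (intro divide_right_mono) auto
        finally show ?thesis by simp
      qed
      have "(\<Sum>j\<in>J. p j * left_transfer (height j) (e j) f z) \<le> (\<Sum>j\<in>J. p j * (A / 2 * (e j powr (q - 1) * w)))"
        using l p_pos by (intro sum_mono mult_left_mono) (auto simp: less_imp_le)
      also have "\<dots> = A * R / 2 * w" by (simp add: R_def sum_distrib_left sum_distrib_right mult_ac)
      also have "\<dots> \<le> D * c0 * w" using D w by (intro mult_right_mono) auto
      finally have 1: "(\<Sum>j\<in>J. p j * left_transfer (height j) (e j) f z) \<le> D * c0 * w" .
      have "f ((1 + z) / 2) \<le> D * log_weight (q - 1) ((1 - z) / 2)"
        using fH[of "(1 + z) / 2"] Hr[of "(1 + z) / 2"] z False by (auto simp: diff_divide_distrib add_divide_distrib)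
      then have "P f z \<le> D * (log_weight (q - 1) ((1 - z) / 2) / 2 + c0 * w)"
        using 1 unfolding P_alt by (simp add: algebra_simps)
      also have "\<dots> \<le> D * log_weight (q - 1) (1 - z)"
        unfolding c0_def w_def using q z D by (intro mult_left_mono log_weight_half_le) auto
      finally show ?thesis using False z by (simp add: Hr)
    qed
  qed
  show thesis by (rule that[OF L1H H_nonneg H_ge1]) (use main in blast)+
qed

end

section \<open>A uniform lower bound and contraction\<close>

lemma AE_lborel_01_less_1: "AE x in lborel_01. x < 1"
proof -
  have "AE x in lborel. x \<in> {0..1} \<longrightarrow> x < (1::real)"
    using AE_lborel_singleton[of 1] by eventually_elim auto
  then show ?thesis by (subst AE_restrict_space_iff) auto
qed

text \<open>Cone functions and H are controlled on [0, 1) only; the point 1 is a null set.\<close>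

lemma AE_lborel_01I:
  assumes "\<And>x. x \<in> {0..<1} \<Longrightarrow> Q x"
  shows "AE x in lborel_01. Q x"
proof -
  have "AE x in lborel_01. x \<in> {0..1}" by (rule AE_I2) simp
  with AE_lborel_01_less_1 show ?thesis by eventually_elim (use assms in auto)
qed

lemma L1_norm_eq_0_iff:
  assumes "L1 f"
  shows "L1_norm f = 0 \<longleftrightarrow> (AE x in lborel_01. f x = 0)"
  unfolding L1_norm_def
  using integral_nonneg_eq_0_iff_AE[of lborel_01 "\<lambda>x. \<bar>f x\<bar>"] L1_integrable[OF L1_abs[OF assms]] by simp

lemma L1_norm_nonneg_eq: "(\<And>x. 0 \<le> f x) \<Longrightarrow> L1_norm f = (\<integral>x. f x \<partial>lborel_01)"
  by (simp add: L1_norm_def)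

lemma L1_norm_cmult: "L1_norm (\<lambda>x. c * f x) = \<bar>c\<bar> * L1_norm f"
  by (simp add: L1_norm_def abs_mult)

lemma L1_indicator:
  assumes "A \<in> sets borel"
  shows "L1 (indicator A)"
  by (rule L1_bound[OF L1_const[of 1]]) (use assms in \<open>auto split: split_indicator\<close>)

lemma integral_indicator_01: "(\<integral>x. indicator {0..<1} x \<partial>lborel_01) = (1::real)"
proof -
  have "(\<integral>x. indicator {0..<1} x \<partial>lborel_01) = (\<integral>x. (1::real) \<partial>lborel_01)"
    by (intro integral_cong_AE AE_lborel_01I measurable_lborel_01) auto
  also have "\<dots> = 1" by (simp add: measure_def emeasure_lborel_01)
  finally show ?thesis .
qed

context good_bad_system
begin

lemma cone_iter: "cone f \<Longrightarrow> cone ((P ^^ n) f)"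
  by (induction n) (auto intro: cone_P)

lemma P_ge_right:
  assumes "cone f"
  shows "f ((1 + z) / 2) / 2 \<le> P f z"
  unfolding P_alt
  using assms height e_ge1 p_pos
  by (auto simp: less_imp_le cone_nonneg intro!: sum_nonneg mult_nonneg_nonneg left_transfer_nonneg)

lemma P_ge_left:
  assumes "cone f" "j \<in> J"
  shows "p j * left_transfer (height j) (e j) f z \<le> P f z"
proof -
  have "p j * left_transfer (height j) (e j) f z \<le> (\<Sum>j\<in>J. p j * left_transfer (height j) (e j) f z)"
    using assms height e_ge1 p_pos finite_J
    by (intro member_le_sum) (auto simp: less_imp_le cone_nonneg intro!: mult_nonneg_nonneg left_transfer_nonneg)
  then show ?thesis unfolding P_alt using cone_nonneg[OF assms(1), of "(1 + z) / 2"] by linarith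
qed

text \<open>The right inverse branch halves the distance to 1, so each step doubles the
  neighbourhood of 1 on which a bound holds and halves the bound.\<close>

lemma iter_ge_near_1:
  assumes f: "cone f" and c: "\<And>x. x \<in> {0..<1} \<Longrightarrow> 1 - \<eta> \<le> x \<Longrightarrow> c \<le> f x"
  shows "x \<in> {0..<1} \<Longrightarrow> 1 - 2 ^ k * \<eta> \<le> x \<Longrightarrow> c / 2 ^ k \<le> (P ^^ k) f x"
proof (induction k arbitrary: x)
  case 0
  then show ?case using c by auto
next
  case (Suc k)
  have "c / 2 ^ k \<le> (P ^^ k) f ((1 + x) / 2)"
    using Suc.prems by (intro Suc.IH) (auto simp: field_simps)
  then show ?case using P_ge_right[OF cone_iter[OF f, of k], of x] by simp
qed

text \<open>A good left branch maps the \<eta>-neighbourhood to the left of 1/2 onto one of length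
  (2 \<eta>)^(e g) to the left of 1, and its weight there is at least 1 / (2 e).\<close>

lemma P_ge_near_1:
  assumes f: "cone f" and g: "g \<in> J - Bad" and c: "0 \<le> c" and \<eta>: "0 < \<eta>"
    and fc: "\<And>x. x \<in> {1/2 - \<eta>..<1/2} \<Longrightarrow> 0 \<le> x \<Longrightarrow> c \<le> f x"
    and z: "z \<in> {0..<1}" "1 - (2 * \<eta>) powr e g \<le> z"
  shows "p g * (c / (2 * e g)) \<le> P f z"
proof -
  have e: "e g \<ge> 1" using g e_ge1 by auto
  have "(1 - z) powr (1 / e g) \<le> ((2 * \<eta>) powr e g) powr (1 / e g)"
    using z e by (intro powr_mono2) auto
  also have "\<dots> = 2 * \<eta>" using \<eta> e by (simp add: powr_powr)
  finally have "1/2 - \<eta> \<le> left_inv 1 (e g) z" by (simp add: left_inv_def field_simps)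
  moreover have "left_inv 1 (e g) z \<in> {0..<1/2}" using z e by (intro left_inv_bounds) auto
  ultimately have fx: "c \<le> f (left_inv 1 (e g) z)" by (intro fc) auto
  have "(1 - z) powr 0 \<le> (1 - z) powr (1 / e g - 1)" using z e by (intro powr_mono') auto
  then have "1 / (2 * e g) * c \<le> (1 - z) powr (1 / e g - 1) / (2 * e g) * f (left_inv 1 (e g) z)"
    using fx c e z by (intro mult_mono divide_right_mono) auto
  then have "c / (2 * e g) \<le> left_transfer (height g) (e g) f z"
    using g z by (simp add: left_transfer_def height_def)
  then have "p g * (c / (2 * e g)) \<le> p g * left_transfer (height g) (e g) f z"
    using g p_pos by (intro mult_left_mono) (auto simp: less_imp_le)
  also have "\<dots> \<le> P f z" using P_ge_left[OF f] g by auto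
  finally show ?thesis .
qed

end

text \<open>From here on the formula for H is forgotten. \<open>H_ge1\<close> puts the constants in
  [0, 1] and the indicators of half-lines into the dominated class.\<close>

locale dominated_system = good_bad_system +
  fixes H :: "real \<Rightarrow> real"
  assumes L1_H: "L1 H" and H_nonneg: "\<And>x. 0 \<le> H x" and H_ge1: "\<And>x. x \<in> {0..<1} \<Longrightarrow> 1 \<le> H x"
    and P_le_H: "\<And>f x. cone f \<Longrightarrow> L1 f \<Longrightarrow> (\<integral>y. f y \<partial>lborel_01) \<le> 1 \<Longrightarrow>
      (\<And>y. y \<in> {0..<1} \<Longrightarrow> f y \<le> H y) \<Longrightarrow> x \<in> {0..<1} \<Longrightarrow> P f x \<le> H x"
begin

text \<open>Mass at most 1, rather than equal to 1, so that common mass may be taken away.\<close>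

definition dom_cone :: "(real \<Rightarrow> real) \<Rightarrow> bool" where
  "dom_cone f \<longleftrightarrow> cone f \<and> L1 f \<and> (\<integral>y. f y \<partial>lborel_01) \<le> 1 \<and> (\<forall>x\<in>{0..<1}. f x \<le> H x)"

lemma dom_coneD:
  assumes "dom_cone f"
  shows "cone f" "L1 f" "(\<integral>y. f y \<partial>lborel_01) \<le> 1" "\<And>x. x \<in> {0..<1} \<Longrightarrow> f x \<le> H x"
  using assms by (auto simp: dom_cone_def)

lemma dom_cone_P: "dom_cone f \<Longrightarrow> dom_cone (P f)"
  unfolding dom_cone_def using P_le_H by (auto simp: cone_P L1_P integral_P)

lemma dom_cone_iter: "dom_cone f \<Longrightarrow> dom_cone ((P ^^ n) f)"
  by (induction n) (auto intro: dom_cone_P)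

text \<open>The shift by 3 keeps the width below 1/2, so each interval lies inside its own
  half.\<close>

definition tail :: "nat \<Rightarrow> real set" where
  "tail n = {1/2 - 1 / (real n + 3)..<1/2} \<union> {1 - 1 / (real n + 3)..<1}"

text \<open>The sets shrink to the empty set and H is integrable. This is the uniform statement that
  no mass escapes to 1/2 or 1.\<close>

lemma tail_integral_tendsto: "(\<lambda>n. \<integral>x. indicator (tail n) x * H x \<partial>lborel_01) \<longlonglongrightarrow> 0"
proof -
  note [measurable] = L1_measurable[OF L1_H]
  have [measurable]: "tail n \<in> sets borel" for n by (simp add: tail_def)
  have lim: "(\<lambda>n. indicator (tail n) x * H x) \<longlonglongrightarrow> 0" for x
  proof (rule tendsto_eventually)
    have "((\<lambda>n. 1 / (real n + 3)) \<longlongrightarrow> 0) sequentially" by real_asymp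
    moreover have "0 < (if x < 1/2 then 1/2 - x else 1 - x)" if "x < 1" using that by auto
    ultimately have "\<forall>\<^sub>F n in sequentially. x < 1 \<longrightarrow> 1 / (real n + 3) < (if x < 1/2 then 1/2 - x else 1 - x)"
      by (cases "x < 1") (auto dest: order_tendstoD(2))
    moreover have "\<forall>\<^sub>F n in sequentially. 1 / (real n + 3) < 1/2" by real_asymp
    ultimately show "\<forall>\<^sub>F n in sequentially. indicator (tail n) x * H x = 0"
      by eventually_elim (auto simp: tail_def split: if_splits split_indicator)
  qed
  have "(\<lambda>n. \<integral>x. indicator (tail n) x * H x \<partial>lborel_01) \<longlonglongrightarrow> (\<integral>x. 0 \<partial>lborel_01)"
  proof (rule integral_dominated_convergence[where w = H])
    show "integrable lborel_01 H" by (rule L1_integrable[OF L1_H])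
    show "AE x in lborel_01. (\<lambda>n. indicator (tail n) x * H x) \<longlonglongrightarrow> 0" using lim by (intro AE_I2)
    show "AE x in lborel_01. norm (indicator (tail n) x * H x) \<le> H x" for n
      using H_nonneg by (intro AE_I2) (auto split: split_indicator)
  qed (intro measurable_lborel_01; measurable)+
  then show ?thesis by simp
qed

text \<open>Suppose f falls below \<epsilon> / 2 at a point of each tail interval. Then by
  monotonicity f \<le> \<epsilon> / 2 off the tail, while the tail itself carries less than
  \<epsilon> / 2 because f \<le> H, so the total mass would be below \<epsilon>.\<close>

lemma peak:
  assumes "\<epsilon> > 0"
  obtains \<eta> where "0 < \<eta>"
    "\<And>f. dom_cone f \<Longrightarrow> \<epsilon> \<le> (\<integral>y. f y \<partial>lborel_01) \<Longrightarrow>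
      (\<forall>x\<in>{1/2 - \<eta>..<1/2}. 0 \<le> x \<longrightarrow> \<epsilon> / 2 \<le> f x) \<or> (\<forall>x\<in>{0..<1}. 1 - \<eta> \<le> x \<longrightarrow> \<epsilon> / 2 \<le> f x)"
proof -
  have "\<forall>\<^sub>F n in sequentially. (\<integral>x. indicator (tail n) x * H x \<partial>lborel_01) < \<epsilon> / 2"
    using tail_integral_tendsto assms by (intro order_tendstoD) auto
  then obtain n where n: "(\<integral>x. indicator (tail n) x * H x \<partial>lborel_01) < \<epsilon> / 2"
    by (auto simp: eventually_sequentially)
  define \<eta> where "\<eta> = 1 / (real n + 3)"
  have \<eta>: "0 < \<eta>" "\<eta> < 1/2" by (auto simp: \<eta>_def field_simps)
  have "tail n \<in> sets borel" by (simp add: tail_def)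
  then have iH: "L1 (\<lambda>x. indicator (tail n) x * H x)"
    using L1_measurable[OF L1_H] H_nonneg by (intro L1_bound[OF L1_H]) (auto split: split_indicator)
  show thesis
  proof (rule that[OF \<eta>(1)], rule ccontr)
    fix f assume f: "dom_cone f" "\<epsilon> \<le> (\<integral>y. f y \<partial>lborel_01)"
    assume "\<not> ((\<forall>x\<in>{1/2 - \<eta>..<1/2}. 0 \<le> x \<longrightarrow> \<epsilon> / 2 \<le> f x) \<or> (\<forall>x\<in>{0..<1}. 1 - \<eta> \<le> x \<longrightarrow> \<epsilon> / 2 \<le> f x))"
    then obtain a b where a: "a \<in> {1/2 - \<eta>..<1/2}" "0 \<le> a" "f a < \<epsilon> / 2"
      and b: "b \<in> {0..<1}" "1 - \<eta> \<le> b" "f b < \<epsilon> / 2" by (auto simp: not_le)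
    note fD = dom_coneD[OF f(1)]
    have le: "f x \<le> indicator (tail n) x * H x + \<epsilon> / 2" if x: "x \<in> {0..<1}" for x
    proof (cases "x \<in> tail n")
      case True
      then show ?thesis using fD(4)[OF x] assms by simp
    next
      case False
      have "f x \<le> \<epsilon> / 2"
      proof (cases "x < 1/2")
        case True
        then have "f x \<le> f a"
          using fD(1) a x False by (auto simp: cone_def mono_on_def tail_def \<eta>_def)
        then show ?thesis using a by simp
      next
        case ge: False
        then have "f x \<le> f b"
          using fD(1) b x False \<eta> by (auto simp: cone_def mono_on_def tail_def \<eta>_def)
        then show ?thesis using b by simp
      qed
      then show ?thesis using False by simp
    qed
    have "(\<integral>y. f y \<partial>lborel_01) \<le> (\<integral>x. indicator (tail n) x * H x + \<epsilon> / 2 \<partial>lborel_01)"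
      by (intro integral_mono_AE L1_integrable L1_add iH fD(2) L1_const AE_lborel_01I le)
    also have "\<dots> = (\<integral>x. indicator (tail n) x * H x \<partial>lborel_01) + \<epsilon> / 2"
      using L1_integrable[OF iH] L1_integrable[OF L1_const[of "\<epsilon> / 2"]]
      by (simp add: measure_def emeasure_lborel_01)
    finally show False using n f(2) by simp
  qed
qed

text \<open>A peak at 1 is spread over [0, 1) by k + 1 doublings; a peak at 1/2 is first moved to 1
  by a good map and then spread by k doublings.\<close>

lemma uniform_lower_bound:
  assumes \<epsilon>: "\<epsilon> > 0"
  obtains n c where "c > 0"
    "\<And>f x. dom_cone f \<Longrightarrow> \<epsilon> \<le> (\<integral>y. f y \<partial>lborel_01) \<Longrightarrow> x \<in> {0..<1} \<Longrightarrow> c \<le> (P ^^ n) f x"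
proof -
  obtain \<eta> where \<eta>: "0 < \<eta>"
    "\<And>f. dom_cone f \<Longrightarrow> \<epsilon> \<le> (\<integral>y. f y \<partial>lborel_01) \<Longrightarrow>
      (\<forall>x\<in>{1/2 - \<eta>..<1/2}. 0 \<le> x \<longrightarrow> \<epsilon> / 2 \<le> f x) \<or> (\<forall>x\<in>{0..<1}. 1 - \<eta> \<le> x \<longrightarrow> \<epsilon> / 2 \<le> f x)"
    using peak[OF \<epsilon>] by blast
  obtain g where g: "g \<in> J - Bad" using good_exists by auto
  have pg: "p g > 0" "e g \<ge> 1" using g p_pos e_ge1 by auto
  \<comment> \<open>The minimum of the two widths near 1 lets one k serve both cases, so that n does
    not depend on where the peak is.\<close>
  define \<zeta> where "\<zeta> = min \<eta> ((2 * \<eta>) powr e g)"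
  have \<zeta>: "\<zeta> > 0" using \<eta> by (simp add: \<zeta>_def)
  obtain k where "1 / \<zeta> < 2 ^ k" using real_arch_pow[of 2 "1 / \<zeta>"] by auto
  then have k: "1 \<le> 2 ^ k * \<zeta>" using \<zeta> by (simp add: field_simps)
  have "2 ^ k * \<zeta> \<le> 2 ^ k * \<eta>" "2 ^ k * \<zeta> \<le> 2 ^ k * (2 * \<eta>) powr e g"
    by (intro mult_left_mono; simp add: \<zeta>_def)+
  with k have k1: "1 \<le> 2 ^ k * \<eta>" and k2: "1 \<le> 2 ^ k * (2 * \<eta>) powr e g" by linarith+
  define c where "c = min (\<epsilon> / 2 / 2 ^ Suc k) (p g * (\<epsilon> / 2 / (2 * e g)) / 2 ^ k)"
  show thesis
  proof (rule that[of c "Suc k"])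
    show "c > 0" using \<epsilon> pg by (simp add: c_def)
    fix f x assume f: "dom_cone f" "\<epsilon> \<le> (\<integral>y. f y \<partial>lborel_01)" and x: "x \<in> {0..<1::real}"
    note cf = dom_coneD(1)[OF f(1)]
    from \<eta>(2)[OF f] show "c \<le> (P ^^ Suc k) f x"
    proof
      assume l: "\<forall>x\<in>{1/2 - \<eta>..<1/2}. 0 \<le> x \<longrightarrow> \<epsilon> / 2 \<le> f x"
      have "p g * (\<epsilon> / 2 / (2 * e g)) \<le> P f z" if "z \<in> {0..<1}" "1 - (2 * \<eta>) powr e g \<le> z" for z
        using P_ge_near_1[OF cf g _ \<eta>(1) _ that, of "\<epsilon> / 2"] l \<epsilon> by auto
      then have "p g * (\<epsilon> / 2 / (2 * e g)) / 2 ^ k \<le> (P ^^ k) (P f) x"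
        using k2 x by (intro iter_ge_near_1[OF cone_P[OF cf], where \<eta> = "(2 * \<eta>) powr e g"]) auto
      then show ?thesis by (simp add: c_def funpow_swap1)
    next
      assume r: "\<forall>x\<in>{0..<1}. 1 - \<eta> \<le> x \<longrightarrow> \<epsilon> / 2 \<le> f x"
      have "1 - 2 ^ Suc k * \<eta> \<le> x" using k1 x by auto
      then have "\<epsilon> / 2 / 2 ^ Suc k \<le> (P ^^ Suc k) f x"
        using r x by (intro iter_ge_near_1[OF cf, where \<eta> = \<eta>]) auto
      then show ?thesis by (simp add: c_def)
    qed
  qed
qed

text \<open>Subtracting a constant keeps a function in the cone, because only monotonicity on the two halves
  is required. So the part of the mass that two densities have in common can be removed repeatedly.\<close>

lemma dom_cone_minus:
  assumes f: "dom_cone f" and c: "c \<ge> 0" "\<And>x. x \<in> {0..<1} \<Longrightarrow> c \<le> f x"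
  defines "f' \<equiv> \<lambda>x. f x - c * indicator {0..<1} x"
  shows "dom_cone f'" "(\<integral>x. f' x \<partial>lborel_01) = (\<integral>x. f x \<partial>lborel_01) - c"
proof -
  note fD = dom_coneD[OF f]
  have i: "L1 (\<lambda>x. c * indicator {0..<1} x)" by (intro L1_cmult L1_indicator) auto
  have L1: "L1 f'" unfolding f'_def by (rule L1_diff[OF fD(2) i])
  have "(\<integral>x. f' x \<partial>lborel_01) = (\<integral>x. f x \<partial>lborel_01) - (\<integral>x. c * indicator {0..<1} x \<partial>lborel_01)"
    unfolding f'_def by (rule Bochner_Integration.integral_diff[OF L1_integrable[OF fD(2)] L1_integrable[OF i]])
  then show eq: "(\<integral>x. f' x \<partial>lborel_01) = (\<integral>x. f x \<partial>lborel_01) - c"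
    by (simp only: integral_mult_right_zero integral_indicator_01 mult_1_right)
  have "cone f'"
    using fD(1) c L1_measurable[OF L1] unfolding cone_def
    by (auto simp: mono_on_def f'_def split: split_indicator)
  moreover have "f' x \<le> H x" if "x \<in> {0..<1}" for x
    using fD(4)[OF that] c by (auto simp: f'_def split: split_indicator)
  ultimately show "dom_cone f'" using L1 eq fD(3) c by (auto simp: dom_cone_def)
qed

text \<open>Every n steps the common constant c is removed from both functions as long as their mass
  exceeds \<epsilon>. At most about 1 / c removals are possible, so M depends on \<epsilon> alone;
  what is left has norm at most \<epsilon> on each side.\<close>

lemma contraction:
  assumes \<epsilon>: "\<epsilon> > 0"
  obtains M where "\<And>m f g. m \<ge> M \<Longrightarrow> dom_cone f \<Longrightarrow> dom_cone g \<Longrightarrow>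
    (\<integral>x. f x \<partial>lborel_01) = (\<integral>x. g x \<partial>lborel_01) \<Longrightarrow>
    L1_norm (\<lambda>x. (P ^^ m) f x - (P ^^ m) g x) \<le> 2 * \<epsilon>"
proof -
  obtain n c where c: "c > 0" and low:
    "\<And>f x. dom_cone f \<Longrightarrow> \<epsilon> \<le> (\<integral>y. f y \<partial>lborel_01) \<Longrightarrow> x \<in> {0..<1} \<Longrightarrow> c \<le> (P ^^ n) f x"
    by (rule uniform_lower_bound[OF \<epsilon>], rule that)
  have small: "L1_norm (\<lambda>x. (P ^^ m) f x - (P ^^ m) g x) \<le> 2 * \<epsilon>"
    if f: "dom_cone f" and g: "dom_cone g" and eq: "(\<integral>x. f x \<partial>lborel_01) = (\<integral>x. g x \<partial>lborel_01)"
      and le: "(\<integral>x. f x \<partial>lborel_01) \<le> \<epsilon>" for m f g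
  proof -
    note fD = dom_coneD[OF f] and gD = dom_coneD[OF g]
    have "L1_norm (\<lambda>x. (P ^^ m) f x - (P ^^ m) g x) \<le> L1_norm ((P ^^ m) f) + L1_norm ((P ^^ m) g)"
      using fD gD by (intro L1_norm_diff_le L1_iter)
    also have "\<dots> \<le> L1_norm f + L1_norm g" using fD gD by (intro add_mono L1_norm_iter_le)
    also have "\<dots> \<le> 2 * \<epsilon>"
      using le eq cone_nonneg[OF fD(1)] cone_nonneg[OF gD(1)] by (simp add: L1_norm_nonneg_eq)
    finally show ?thesis .
  qed
  \<comment> \<open>Here k bounds the number of removals that are still to be made.\<close>
  have main: "L1_norm (\<lambda>x. (P ^^ m) f x - (P ^^ m) g x) \<le> 2 * \<epsilon>"
    if "dom_cone f" "dom_cone g" "(\<integral>x. f x \<partial>lborel_01) = (\<integral>x. g x \<partial>lborel_01)"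
      "(\<integral>x. f x \<partial>lborel_01) \<le> \<epsilon> + real k * c" "m \<ge> k * n" for k m f g
    using that
  proof (induction k arbitrary: f g m)
    case 0
    then show ?case using small by simp
  next
    case (Suc k)
    show ?case
    proof (cases "(\<integral>x. f x \<partial>lborel_01) \<le> \<epsilon>")
      case True
      then show ?thesis using small Suc.prems by blast
    next
      case False
      define f' where "f' = (\<lambda>x. (P ^^ n) f x - c * indicator {0..<1} x)"
      define g' where "g' = (\<lambda>x. (P ^^ n) g x - c * indicator {0..<1} x)"
      note fD = dom_coneD[OF Suc.prems(1)] and gD = dom_coneD[OF Suc.prems(2)]
      have f': "dom_cone f'" "(\<integral>x. f' x \<partial>lborel_01) = (\<integral>x. f x \<partial>lborel_01) - c"
        using dom_cone_minus[OF dom_cone_iter[OF Suc.prems(1), of n], of c] c low[OF Suc.prems(1)] False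
          integral_iter[OF fD(2), of n] by (auto simp: f'_def)
      have g': "dom_cone g'" "(\<integral>x. g' x \<partial>lborel_01) = (\<integral>x. g x \<partial>lborel_01) - c"
        using dom_cone_minus[OF dom_cone_iter[OF Suc.prems(2), of n], of c] c low[OF Suc.prems(2)] False
          integral_iter[OF gD(2), of n] Suc.prems(3) by (auto simp: g'_def)
      define l where "l = m - n"
      have l: "m = l + n" "l \<ge> k * n" using Suc.prems(5) by (simp_all add: l_def)
      have "(\<lambda>x. (P ^^ m) f x - (P ^^ m) g x) = (P ^^ l) (\<lambda>x. (P ^^ n) f x - (P ^^ n) g x)"
        by (simp add: l funpow_add iter_diff)
      \<comment> \<open>The removed constant is the same for f and g, so it cancels in the
        difference.\<close>
      also have "\<dots> = (P ^^ l) (\<lambda>x. f' x - g' x)" by (simp add: f'_def g'_def)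
      also have "\<dots> = (\<lambda>x. (P ^^ l) f' x - (P ^^ l) g' x)" by (rule iter_diff)
      finally have eq: "(\<lambda>x. (P ^^ m) f x - (P ^^ m) g x) = (\<lambda>x. (P ^^ l) f' x - (P ^^ l) g' x)" .
      show ?thesis unfolding eq
        by (rule Suc.IH) (use f' g' l Suc.prems in \<open>auto simp: algebra_simps\<close>)
    qed
  qed
  obtain K :: nat where K: "1 \<le> real K * c"
    using reals_Archimedean3[OF c] by (metis less_imp_le)
  show thesis
  proof (rule that[of "K * n"])
    fix m f g assume "m \<ge> K * n" "dom_cone f" "dom_cone g"
      "(\<integral>x. f x \<partial>lborel_01) = (\<integral>x. g x \<partial>lborel_01)"
    then show "L1_norm (\<lambda>x. (P ^^ m) f x - (P ^^ m) g x) \<le> 2 * \<epsilon>"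
      using K \<epsilon> dom_coneD(3)[of f] by (intro main[of f g K]) auto
  qed
qed

end

section \<open>The stationary density and asymptotic stability\<close>

context dominated_system
begin

lemma dom_cone_const: "0 \<le> c \<Longrightarrow> c \<le> 1 \<Longrightarrow> dom_cone (\<lambda>x. c)"
  using H_ge1 unfolding dom_cone_def cone_def
  by (auto simp: mono_on_def measure_def emeasure_lborel_01 intro: order.trans)

definition iterates :: "nat \<Rightarrow> real \<Rightarrow> real" where
  "iterates n = (P ^^ n) (\<lambda>x. 1)"

lemma dom_cone_iterates: "dom_cone (iterates n)"
  unfolding iterates_def by (intro dom_cone_iter dom_cone_const) auto

lemma integral_iterates: "(\<integral>x. iterates n x \<partial>lborel_01) = 1"
  unfolding iterates_def by (subst integral_iter) (auto simp: measure_def emeasure_lborel_01)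

text \<open>Both functions are images under the same power of \<open>P\<close> of two densities in
  the class with integral 1, to which the uniform contraction applies.\<close>

lemma iterates_Cauchy:
  assumes "\<epsilon> > 0"
  shows "\<exists>M. \<forall>i\<ge>M. \<forall>j\<ge>M. L1_norm (\<lambda>x. iterates i x - iterates j x) \<le> \<epsilon>"
proof -
  have \<epsilon>2: "\<epsilon> / 2 > 0" using assms by simp
  obtain M where M: "\<And>m f g. m \<ge> M \<Longrightarrow> dom_cone f \<Longrightarrow> dom_cone g \<Longrightarrow>
    (\<integral>x. f x \<partial>lborel_01) = (\<integral>x. g x \<partial>lborel_01) \<Longrightarrow>
    L1_norm (\<lambda>x. (P ^^ m) f x - (P ^^ m) g x) \<le> 2 * (\<epsilon> / 2)"
    by (rule contraction[OF \<epsilon>2], rule that)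
  have "L1_norm (\<lambda>x. iterates i x - iterates j x) \<le> \<epsilon>" if "i \<ge> M" "j \<ge> M" for i j
  proof -
    have eq: "iterates k = (P ^^ M) (iterates (k - M))" if "k \<ge> M" for k
      using that by (simp add: iterates_def funpow_add [symmetric, THEN fun_cong, unfolded comp_def])
    show ?thesis
      using M[OF order_refl dom_cone_iterates[of "i - M"] dom_cone_iterates[of "j - M"]]
      by (simp add: integral_iterates eq[OF that(1)] eq[OF that(2)])
  qed
  then show ?thesis by blast
qed

text \<open>A subsequence converges almost everywhere; H dominates it, so it converges in L1 as
  well, and the Cauchy property carries this over to the whole sequence.\<close>

lemma exists_limit:
  obtains h where "L1 h" "\<And>x. 0 \<le> h x" "(\<lambda>n. L1_norm (\<lambda>x. iterates n x - h x)) \<longlonglongrightarrow> 0"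
    "\<exists>c>0. AE x in lborel_01. c \<le> h x"
proof -
  note D = dom_coneD[OF dom_cone_iterates]
  have "\<exists>M. \<forall>i\<ge>M. \<forall>j\<ge>M. LINT x|lborel_01. norm (iterates i x - iterates j x) < \<epsilon>" if "\<epsilon> > 0" for \<epsilon>
  proof -
    obtain M where M: "\<And>i j. i \<ge> M \<Longrightarrow> j \<ge> M \<Longrightarrow> L1_norm (\<lambda>x. iterates i x - iterates j x) \<le> \<epsilon> / 2"
      using iterates_Cauchy[of "\<epsilon> / 2"] \<open>\<epsilon> > 0\<close> by auto
    have "LINT x|lborel_01. norm (iterates i x - iterates j x) < \<epsilon>" if "i \<ge> M" "j \<ge> M" for i j
      using M[OF that] \<open>\<epsilon> > 0\<close> by (simp add: L1_norm_def)
    then show ?thesis by blast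
  qed
  then obtain r where r: "strict_mono r" "AE x in lborel_01. Cauchy (\<lambda>i. iterates (r i) x)"
    using cauchy_L1_AE_cauchy_subseq[of lborel_01 iterates] L1_integrable[OF D(2)] by blast
  \<comment> \<open>The indicator and \<open>max 0\<close> make h nonnegative on the whole line,
    also where the subsequence does not converge.\<close>
  define h where "h = (\<lambda>x. indicator {0..<1} x * max 0 (lim (\<lambda>i. iterates (r i) x)))"
  have meas [measurable]: "iterates n \<in> borel_measurable borel" for n by (rule L1_measurable[OF D(2)])
  have [measurable]: "h \<in> borel_measurable borel" unfolding h_def by measurable
  have AE01: "AE x in lborel_01. x \<in> {0..<1}" by (rule AE_lborel_01I)
  have lim: "AE x in lborel_01. (\<lambda>i. iterates (r i) x) \<longlonglongrightarrow> h x"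
    using r(2) AE01
  proof eventually_elim
    case (elim x)
    then have "(\<lambda>i. iterates (r i) x) \<longlonglongrightarrow> lim (\<lambda>i. iterates (r i) x)"
      by (simp add: Cauchy_convergent_iff convergent_LIMSEQ_iff)
    moreover from this have "0 \<le> lim (\<lambda>i. iterates (r i) x)"
      by (rule LIMSEQ_le_const) (use D(1) in \<open>auto simp: cone_nonneg\<close>)
    ultimately show ?case using elim by (simp add: h_def)
  qed
  have hH: "AE x in lborel_01. norm (h x) \<le> norm (H x)"
    using lim AE01
  proof eventually_elim
    case (elim x)
    then have "h x \<le> H x" by (intro LIMSEQ_le_const2[OF elim(1)]) (use D(4) in auto)
    then show ?case using H_nonneg[of x] by (auto simp: h_def)
  qed
  have hm: "h \<in> borel_measurable borel" by measurable
  have h: "L1 h" unfolding L1_def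
    by (intro conjI hm Bochner_Integration.integrable_bound[OF L1_integrable[OF L1_H] _ hH] measurable_lborel_01)
  have sub: "(\<lambda>i. L1_norm (\<lambda>x. iterates (r i) x - h x)) \<longlonglongrightarrow> 0"
  proof -
    have "(\<lambda>i. \<integral>x. \<bar>iterates (r i) x - h x\<bar> \<partial>lborel_01) \<longlonglongrightarrow> (\<integral>x. 0 \<partial>lborel_01)"
    proof (rule integral_dominated_convergence[where w = "\<lambda>x. 2 * H x"])
      show "integrable lborel_01 (\<lambda>x. 2 * H x)" using L1_integrable[OF L1_H] by simp
      show "AE x in lborel_01. (\<lambda>i. \<bar>iterates (r i) x - h x\<bar>) \<longlonglongrightarrow> 0"
        using lim
      proof eventually_elim
        case (elim x)
        from tendsto_rabs[OF tendsto_diff[OF elim tendsto_const[of "h x"]]] show ?case by simp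
      qed
      show "AE x in lborel_01. norm \<bar>iterates (r i) x - h x\<bar> \<le> 2 * H x" for i
        using hH AE01
      proof eventually_elim
        case (elim x)
        then show ?case using D(4)[of x "r i"] cone_nonneg[OF D(1), of "r i" x] H_nonneg[of x] by auto
      qed
    qed (intro measurable_lborel_01; measurable)+
    then show ?thesis by (simp add: L1_norm_def)
  qed
  have conv: "(\<lambda>n. L1_norm (\<lambda>x. iterates n x - h x)) \<longlonglongrightarrow> 0"
  proof (rule LIMSEQ_I)
    fix \<epsilon> :: real assume \<epsilon>: "\<epsilon> > 0"
    obtain M where M: "\<forall>i\<ge>M. \<forall>j\<ge>M. L1_norm (\<lambda>x. iterates i x - iterates j x) \<le> \<epsilon> / 4"
      using iterates_Cauchy[of "\<epsilon> / 4"] \<epsilon> by auto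
    have "\<forall>\<^sub>F i in sequentially. L1_norm (\<lambda>x. iterates (r i) x - h x) < \<epsilon> / 4"
      using sub \<epsilon> by (intro order_tendstoD) auto
    moreover have "\<forall>\<^sub>F i in sequentially. i \<ge> M" by (rule eventually_ge_at_top)
    ultimately have "\<forall>\<^sub>F i in sequentially. L1_norm (\<lambda>x. iterates (r i) x - h x) < \<epsilon> / 4 \<and> i \<ge> M"
      by eventually_elim auto
    then obtain i where i: "L1_norm (\<lambda>x. iterates (r i) x - h x) < \<epsilon> / 4" "i \<ge> M"
      by (auto dest: eventually_happens)
    have ri: "r i \<ge> M" using i r(1) by (meson order.trans seq_suble)
    have "norm (L1_norm (\<lambda>x. iterates n x - h x) - 0) < \<epsilon>" if "n \<ge> M" for n
      using L1_norm_diff_triangle[OF D(2)[of n] D(2)[of "r i"] h] M[rule_format, OF that ri] i \<epsilon> by auto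
    then show "\<exists>M. \<forall>n\<ge>M. norm (L1_norm (\<lambda>x. iterates n x - h x) - 0) < \<epsilon>" by blast
  qed
  \<comment> \<open>All iterates have mass 1, so the uniform bound with \<epsilon> = 1 applies to
    them from index n on and passes to the limit.\<close>
  obtain n c where c: "c > 0" and low: "\<And>f x. dom_cone f \<Longrightarrow> 1 \<le> (\<integral>y. f y \<partial>lborel_01) \<Longrightarrow> x \<in> {0..<1} \<Longrightarrow> c \<le> (P ^^ n) f x"
    by (rule uniform_lower_bound[OF zero_less_one], rule that)
  have low': "c \<le> iterates i x" if "i \<ge> n" "x \<in> {0..<1}" for i x
  proof -
    have "iterates i = (P ^^ n) (iterates (i - n))"
      using that by (simp add: iterates_def funpow_add [symmetric, THEN fun_cong, unfolded comp_def])
    then show ?thesis using low[OF dom_cone_iterates[of "i - n"] _ that(2)] by (simp add: integral_iterates)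
  qed
  have "AE x in lborel_01. c \<le> h x"
    using lim AE01
  proof eventually_elim
    case (elim x)
    have "c \<le> iterates (r i) x" if "i \<ge> n" for i
      using that low'[of "r i" x] elim(2) r(1) by (meson order.trans seq_suble)
    then show ?case by (intro LIMSEQ_le_const[OF elim(1)]) auto
  qed
  with c have "\<exists>c>0. AE x in lborel_01. c \<le> h x" by blast
  moreover have "0 \<le> h x" for x by (simp add: h_def)
  ultimately show thesis using that[OF h _ conv] by blast
qed

end

locale limit_system = dominated_system +
  fixes h :: "real \<Rightarrow> real"
  assumes h_L1: "L1 h" and h_nonneg: "\<And>x. 0 \<le> h x"
    and h_lim: "(\<lambda>n. L1_norm (\<lambda>x. iterates n x - h x)) \<longlonglongrightarrow> 0"
begin

lemma iterates_L1: "L1 (iterates n)"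
  by (rule dom_coneD(2)[OF dom_cone_iterates])

lemma integral_h: "(\<integral>x. h x \<partial>lborel_01) = 1"
proof -
  have "\<bar>1 - (\<integral>x. h x \<partial>lborel_01)\<bar> \<le> L1_norm (\<lambda>x. iterates n x - h x)" for n
    using abs_integral_le_L1_norm[OF L1_diff[OF iterates_L1[of n] h_L1]]
    by (simp add: integral_iterates L1_integrable[OF iterates_L1] L1_integrable[OF h_L1])
  then have "\<bar>1 - (\<integral>x. h x \<partial>lborel_01)\<bar> \<le> 0"
    by (intro LIMSEQ_le_const[OF h_lim]) auto
  then show ?thesis by simp
qed

lemma L1_norm_h: "L1_norm h = 1"
  using h_nonneg integral_h by (simp add: L1_norm_nonneg_eq)

text \<open>As h is determined only up to null sets, invariance is expressed in the norm. It follows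
  because \<open>P\<close> does not increase the norm and maps \<open>iterates n\<close> to
  \<open>iterates (Suc n)\<close>.\<close>

lemma P_h: "L1_norm (\<lambda>x. P h x - h x) = 0"
proof -
  have "L1_norm (\<lambda>x. P h x - h x) \<le>
      L1_norm (\<lambda>x. iterates n x - h x) + L1_norm (\<lambda>x. iterates (Suc n) x - h x)" for n
  proof -
    have "L1_norm (\<lambda>x. P h x - h x) \<le> L1_norm (\<lambda>x. P h x - P (iterates n) x) + L1_norm (\<lambda>x. P (iterates n) x - h x)"
      by (intro L1_norm_diff_triangle L1_P h_L1 iterates_L1)
    also have "L1_norm (\<lambda>x. P h x - P (iterates n) x) \<le> L1_norm (\<lambda>x. h x - iterates n x)"
      using L1_norm_P_le[OF L1_diff[OF h_L1 iterates_L1[of n]]] by (simp only: P_diff)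
    also have "L1_norm (\<lambda>x. h x - iterates n x) = L1_norm (\<lambda>x. iterates n x - h x)"
      by (rule L1_norm_commute)
    finally show ?thesis by (simp add: iterates_def)
  qed
  moreover have "(\<lambda>n. L1_norm (\<lambda>x. iterates n x - h x) + L1_norm (\<lambda>x. iterates (Suc n) x - h x)) \<longlonglongrightarrow> 0 + 0"
    using h_lim by (intro tendsto_add) (auto dest: LIMSEQ_Suc)
  ultimately have "L1_norm (\<lambda>x. P h x - h x) \<le> 0 + 0"
    by (intro LIMSEQ_le_const) auto
  then show ?thesis using L1_norm_nonneg[of "\<lambda>x. P h x - h x"] by linarith
qed

text \<open>Asymptotic stability of a single function. Such functions form a closed linear subspace,
  which is then shown to be all of L1.\<close>

definition mixes :: "(real \<Rightarrow> real) \<Rightarrow> bool" where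
  "mixes f \<longleftrightarrow> L1 f \<and> (\<lambda>n. L1_norm (\<lambda>x. (P ^^ n) f x - (\<integral>y. f y \<partial>lborel_01) * h x)) \<longlonglongrightarrow> 0"

lemma mixes_L1: "mixes f \<Longrightarrow> L1 f"
  by (simp add: mixes_def)

lemma mixes_const: "mixes (\<lambda>x. c)"
proof -
  have "(\<lambda>x. (P ^^ n) (\<lambda>x. c) x - c * h x) = (\<lambda>x. c * (iterates n x - h x))" for n
    using iter_cmult[of n c "\<lambda>x. 1"] by (simp add: iterates_def right_diff_distrib)
  then have "L1_norm (\<lambda>x. (P ^^ n) (\<lambda>x. c) x - c * h x) = \<bar>c\<bar> * L1_norm (\<lambda>x. iterates n x - h x)" for n
    by (simp only: L1_norm_cmult)
  moreover have "(\<lambda>n. \<bar>c\<bar> * L1_norm (\<lambda>x. iterates n x - h x)) \<longlonglongrightarrow> \<bar>c\<bar> * 0"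
    by (intro tendsto_mult tendsto_const h_lim)
  ultimately show ?thesis by (simp add: mixes_def measure_def emeasure_lborel_01)
qed

lemma mixes_add:
  assumes f: "mixes f" and g: "mixes g"
  shows "mixes (\<lambda>x. f x + g x)"
  unfolding mixes_def
proof
  note L1 = mixes_L1[OF f] mixes_L1[OF g]
  show "L1 (\<lambda>x. f x + g x)" using L1 by (rule L1_add)
  show "(\<lambda>n. L1_norm (\<lambda>x. (P ^^ n) (\<lambda>x. f x + g x) x - (\<integral>y. f y + g y \<partial>lborel_01) * h x)) \<longlonglongrightarrow> 0"
  proof (rule tendsto_sandwich[OF _ _ tendsto_const])
    show "\<forall>\<^sub>F n in sequentially. L1_norm (\<lambda>x. (P ^^ n) (\<lambda>x. f x + g x) x - (\<integral>y. f y + g y \<partial>lborel_01) * h x) \<le>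
      L1_norm (\<lambda>x. (P ^^ n) f x - (\<integral>y. f y \<partial>lborel_01) * h x) + L1_norm (\<lambda>x. (P ^^ n) g x - (\<integral>y. g y \<partial>lborel_01) * h x)"
    proof (intro always_eventually allI)
      fix n
      have "L1_norm (\<lambda>x. ((P ^^ n) f x - (\<integral>y. f y \<partial>lborel_01) * h x) + ((P ^^ n) g x - (\<integral>y. g y \<partial>lborel_01) * h x)) \<le>
        L1_norm (\<lambda>x. (P ^^ n) f x - (\<integral>y. f y \<partial>lborel_01) * h x) + L1_norm (\<lambda>x. (P ^^ n) g x - (\<integral>y. g y \<partial>lborel_01) * h x)"
        by (intro L1_norm_triangle L1_diff L1_iter L1 L1_cmult h_L1)
      moreover have "(\<lambda>x. (P ^^ n) (\<lambda>x. f x + g x) x - (\<integral>y. f y + g y \<partial>lborel_01) * h x) =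
        (\<lambda>x. ((P ^^ n) f x - (\<integral>y. f y \<partial>lborel_01) * h x) + ((P ^^ n) g x - (\<integral>y. g y \<partial>lborel_01) * h x))"
        using L1_integrable[OF L1(1)] L1_integrable[OF L1(2)] by (simp add: iter_add algebra_simps)
      ultimately show "L1_norm (\<lambda>x. (P ^^ n) (\<lambda>x. f x + g x) x - (\<integral>y. f y + g y \<partial>lborel_01) * h x) \<le>
        L1_norm (\<lambda>x. (P ^^ n) f x - (\<integral>y. f y \<partial>lborel_01) * h x) + L1_norm (\<lambda>x. (P ^^ n) g x - (\<integral>y. g y \<partial>lborel_01) * h x)"
        by (simp only:)
    qed
    show "(\<lambda>n. L1_norm (\<lambda>x. (P ^^ n) f x - (\<integral>y. f y \<partial>lborel_01) * h x) +
        L1_norm (\<lambda>x. (P ^^ n) g x - (\<integral>y. g y \<partial>lborel_01) * h x)) \<longlonglongrightarrow> 0"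
      using f g unfolding mixes_def by (intro tendsto_add_zero) auto
  qed simp
qed

lemma mixes_cmult:
  assumes f: "mixes f"
  shows "mixes (\<lambda>x. c * f x)"
proof -
  have "(\<lambda>x. (P ^^ n) (\<lambda>x. c * f x) x - (\<integral>y. c * f y \<partial>lborel_01) * h x) =
      (\<lambda>x. c * ((P ^^ n) f x - (\<integral>y. f y \<partial>lborel_01) * h x))" for n
    by (simp add: iter_cmult algebra_simps)
  then have "L1_norm (\<lambda>x. (P ^^ n) (\<lambda>x. c * f x) x - (\<integral>y. c * f y \<partial>lborel_01) * h x) =
      \<bar>c\<bar> * L1_norm (\<lambda>x. (P ^^ n) f x - (\<integral>y. f y \<partial>lborel_01) * h x)" for n
    by (simp only: L1_norm_cmult)
  moreover have "(\<lambda>n. \<bar>c\<bar> * L1_norm (\<lambda>x. (P ^^ n) f x - (\<integral>y. f y \<partial>lborel_01) * h x)) \<longlonglongrightarrow> \<bar>c\<bar> * 0"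
    using f unfolding mixes_def by (intro tendsto_mult tendsto_const) auto
  ultimately show ?thesis using f by (simp add: mixes_def L1_cmult)
qed

text \<open>\<open>P\<close> does not increase the norm, so an approximation error at time 0 never
  grows, and the integrals differ by no more than that error.\<close>

lemma mixes_closed:
  assumes f: "L1 f" and approx: "\<And>\<epsilon>. \<epsilon> > 0 \<Longrightarrow> \<exists>g. mixes g \<and> L1_norm (\<lambda>x. f x - g x) \<le> \<epsilon>"
  shows "mixes f"
  unfolding mixes_def
proof (intro conjI f LIMSEQ_I)
  fix \<epsilon> :: real assume \<epsilon>: "\<epsilon> > 0"
  then obtain g where g: "mixes g" "L1_norm (\<lambda>x. f x - g x) \<le> \<epsilon> / 4"
    using approx[of "\<epsilon> / 4"] by auto
  note gL = mixes_L1[OF g(1)]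
  have "\<forall>\<^sub>F n in sequentially. L1_norm (\<lambda>x. (P ^^ n) g x - (\<integral>y. g y \<partial>lborel_01) * h x) < \<epsilon> / 4"
    using g(1) \<epsilon> unfolding mixes_def by (intro order_tendstoD) auto
  then obtain M where M: "\<And>n. n \<ge> M \<Longrightarrow> L1_norm (\<lambda>x. (P ^^ n) g x - (\<integral>y. g y \<partial>lborel_01) * h x) < \<epsilon> / 4"
    by (auto simp: eventually_sequentially)
  have "L1_norm (\<lambda>x. (P ^^ n) f x - (\<integral>y. f y \<partial>lborel_01) * h x) < \<epsilon>" if n: "n \<ge> M" for n
  proof -
    have "L1_norm (\<lambda>x. (P ^^ n) f x - (\<integral>y. f y \<partial>lborel_01) * h x) \<le>
      L1_norm (\<lambda>x. (P ^^ n) f x - (P ^^ n) g x) + L1_norm (\<lambda>x. (P ^^ n) g x - (\<integral>y. f y \<partial>lborel_01) * h x)"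
      by (intro L1_norm_diff_triangle L1_iter f gL L1_cmult h_L1)
    also have "L1_norm (\<lambda>x. (P ^^ n) g x - (\<integral>y. f y \<partial>lborel_01) * h x) \<le>
      L1_norm (\<lambda>x. (P ^^ n) g x - (\<integral>y. g y \<partial>lborel_01) * h x) +
      L1_norm (\<lambda>x. (\<integral>y. g y \<partial>lborel_01) * h x - (\<integral>y. f y \<partial>lborel_01) * h x)"
      by (intro L1_norm_diff_triangle L1_iter f gL L1_cmult h_L1)
    also have "L1_norm (\<lambda>x. (P ^^ n) f x - (P ^^ n) g x) \<le> \<epsilon> / 4"
      using L1_norm_iter_le[OF L1_diff[OF f gL], of n] g(2) by (simp add: iter_diff)
    also have "L1_norm (\<lambda>x. (\<integral>y. g y \<partial>lborel_01) * h x - (\<integral>y. f y \<partial>lborel_01) * h x) =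
        \<bar>(\<integral>y. f y \<partial>lborel_01) - (\<integral>y. g y \<partial>lborel_01)\<bar>"
      using L1_norm_cmult[of "(\<integral>y. g y \<partial>lborel_01) - (\<integral>y. f y \<partial>lborel_01)" h]
      by (simp add: left_diff_distrib L1_norm_h abs_minus_commute)
    also have "\<dots> \<le> \<epsilon> / 4"
      using abs_integral_le_L1_norm[OF L1_diff[OF f gL]] g(2) L1_integrable[OF f] L1_integrable[OF gL] by simp
    finally show ?thesis using M[OF n] \<epsilon> by simp
  qed
  then show "\<exists>M. \<forall>n\<ge>M. norm (L1_norm (\<lambda>x. (P ^^ n) f x - (\<integral>y. f y \<partial>lborel_01) * h x) - 0) < \<epsilon>"
    by auto
qed

lemma mixes_cong_AE:
  assumes "mixes g" "L1 f" "AE x in lborel_01. f x = g x"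
  shows "mixes f"
proof (rule mixes_closed[OF assms(2)])
  have "L1_norm (\<lambda>x. f x - g x) = 0"
    using assms mixes_L1[OF assms(1)] by (subst L1_norm_eq_0_iff) auto
  then show "\<exists>g. mixes g \<and> L1_norm (\<lambda>x. f x - g x) \<le> \<epsilon>" if "\<epsilon> > 0" for \<epsilon>
    using assms(1) that by (intro exI[of _ g]) auto
qed

text \<open>The comparison function is the constant with the same integral: it lies in the class,
  and its stability is the definition of h.\<close>

lemma mixes_dom_cone:
  assumes f: "dom_cone f"
  shows "mixes f"
proof -
  define a where "a = (\<integral>x. f x \<partial>lborel_01)"
  note fD = dom_coneD[OF f]
  have a: "0 \<le> a" "a \<le> 1" using fD(3) cone_nonneg[OF fD(1)] by (auto simp: a_def)
  have "(\<lambda>n. L1_norm (\<lambda>x. (P ^^ n) f x - (P ^^ n) (\<lambda>x. a) x)) \<longlonglongrightarrow> 0"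
  proof (rule LIMSEQ_I)
    fix \<epsilon> :: real assume "\<epsilon> > 0"
    then have \<epsilon>4: "\<epsilon> / 4 > 0" by simp
    obtain M where M: "\<And>m f g. m \<ge> M \<Longrightarrow> dom_cone f \<Longrightarrow> dom_cone g \<Longrightarrow>
      (\<integral>x. f x \<partial>lborel_01) = (\<integral>x. g x \<partial>lborel_01) \<Longrightarrow>
      L1_norm (\<lambda>x. (P ^^ m) f x - (P ^^ m) g x) \<le> 2 * (\<epsilon> / 4)"
      by (rule contraction[OF \<epsilon>4], rule that)
    have "(\<integral>x. f x \<partial>lborel_01) = (\<integral>x. a \<partial>lborel_01)"
      by (simp add: a_def measure_def emeasure_lborel_01)
    from M[OF _ f dom_cone_const[OF a] this]
    have "norm (L1_norm (\<lambda>x. (P ^^ n) f x - (P ^^ n) (\<lambda>x. a) x) - 0) < \<epsilon>" if "n \<ge> M" for n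
      using \<open>\<epsilon> > 0\<close> that by fastforce
    then show "\<exists>M. \<forall>n\<ge>M. norm (L1_norm (\<lambda>x. (P ^^ n) f x - (P ^^ n) (\<lambda>x. a) x) - 0) < \<epsilon>" by blast
  qed
  then have 1: "(\<lambda>n. L1_norm ((P ^^ n) (\<lambda>x. f x - a))) \<longlonglongrightarrow> 0"
    by (simp add: iter_diff)
  have "(\<integral>x. f x - a \<partial>lborel_01) = 0"
    using L1_integrable[OF fD(2)] L1_integrable[OF L1_const[of a]] by (simp add: a_def measure_def emeasure_lborel_01)
  then have "mixes (\<lambda>x. f x - a)"
    using 1 fD(2) by (simp add: mixes_def L1_diff)
  from mixes_add[OF this mixes_const[of a]] show ?thesis by simp
qed

text \<open>Half-lines {t..} are the suitable generator: their indicators are nondecreasing and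
  hence in the cone. Complements and disjoint unions follow from linearity and closedness.\<close>

lemma mixes_indicator:
  assumes "A \<in> sets borel"
  shows "mixes (indicator A)"
proof -
  have A: "A \<in> sigma_sets UNIV (range atLeast)"
    using assms by (simp add: borel_Ici)
  have Int: "Int_stable (range (atLeast :: real \<Rightarrow> real set))"
  proof (rule Int_stableI)
    fix A B :: "real set" assume "A \<in> range atLeast" "B \<in> range atLeast"
    then obtain a b where "A = {a..}" "B = {b..}" by auto
    then have "A \<inter> B = {max a b..}" by auto
    then show "A \<inter> B \<in> range atLeast" by simp
  qed
  have sub: "range (atLeast :: real \<Rightarrow> real set) \<subseteq> Pow UNIV" by simp
  show ?thesis
    using Int sub A
  proof (induction rule: sigma_sets_induct_disjoint)
    case (basic A)
    then obtain t where A: "A = {t..}" by auto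
    have L: "L1 (indicator A)" by (rule L1_indicator) (simp add: A)
    have "cone (indicator A)"
      by (auto simp: A cone_def mono_on_def split: split_indicator)
    moreover have "(\<integral>x. indicator A x \<partial>lborel_01) \<le> (\<integral>x. (1::real) \<partial>lborel_01)"
      by (intro integral_mono L1_integrable L L1_const) (simp split: split_indicator)
    moreover have "indicator A x \<le> H x" if "x \<in> {0..<1}" for x
      using H_ge1[OF that] by (auto split: split_indicator)
    ultimately have "dom_cone (indicator A)"
      using L by (auto simp: dom_cone_def measure_def emeasure_lborel_01)
    then show ?case by (rule mixes_dom_cone)
  next
    case empty
    show ?case using mixes_const[of 0] by simp
  next
    case (compl A)
    have "indicator (UNIV - A) = (\<lambda>x. 1 + (-1) * indicator A x :: real)"
      by (auto split: split_indicator)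
    then show ?case using mixes_add[OF mixes_const[of 1] mixes_cmult[OF compl.IH, of "-1"]] by simp
  next
    case (union A)
    define f where "f = (\<lambda>n x. \<Sum>i<n. indicator (A i) x :: real)"
    have Ab: "A i \<in> sets borel" for i
      using union.hyps(2) by (auto simp: borel_Ici)
    have f: "mixes (f n)" for n
      unfolding f_def by (induction n) (auto intro: mixes_const mixes_add union.IH)
    have eq: "f n = indicator (\<Union>i<n. A i)" for n
      unfolding f_def using union.hyps(1)
      by (auto simp: indicator_UN_disjoint disjoint_family_on_def)
    have L: "L1 (indicator (\<Union>i. A i))" using Ab by (intro L1_indicator) auto
    have lim: "(\<lambda>n. \<integral>x. \<bar>indicator (\<Union>i. A i) x - f n x\<bar> \<partial>lborel_01) \<longlonglongrightarrow> (\<integral>x. 0 \<partial>lborel_01)"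
    proof (rule integral_dominated_convergence[where w = "\<lambda>_. 1"])
      show "AE x in lborel_01. (\<lambda>n. \<bar>indicator (\<Union>i. A i) x - f n x\<bar>) \<longlonglongrightarrow> 0"
      proof (rule AE_I2)
        fix x
        have "(\<lambda>n. f n x) \<longlonglongrightarrow> indicator (\<Union>i. A i) x"
          unfolding eq by (rule LIMSEQ_indicator_UN)
        from tendsto_rabs[OF tendsto_diff[OF tendsto_const[of "indicator (\<Union>i. A i) x"] this]]
        show "(\<lambda>n. \<bar>indicator (\<Union>i. A i) x - f n x\<bar>) \<longlonglongrightarrow> 0" by simp
      qed
      show "AE x in lborel_01. norm \<bar>indicator (\<Union>i. A i) x - f n x\<bar> \<le> 1" for n
        unfolding eq by (intro AE_I2) (auto split: split_indicator)
      show "integrable lborel_01 (\<lambda>_. 1 :: real)" by (rule L1_integrable[OF L1_const])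
      show "(\<lambda>x. \<bar>indicator (\<Union>i. A i) x - f n x\<bar>) \<in> borel_measurable lborel_01" for n
        by (rule L1_integrable[OF L1_abs[OF L1_diff[OF L mixes_L1[OF f]]], THEN borel_measurable_integrable])
      show "(\<lambda>x. 0 :: real) \<in> borel_measurable lborel_01" by simp
    qed
    show ?case
    proof (rule mixes_closed[OF L])
      fix \<epsilon> :: real assume "\<epsilon> > 0"
      then have "\<forall>\<^sub>F n in sequentially. L1_norm (\<lambda>x. indicator (\<Union>i. A i) x - f n x) < \<epsilon>"
        using lim by (intro order_tendstoD) (auto simp: L1_norm_def)
      then obtain n where "L1_norm (\<lambda>x. indicator (\<Union>i. A i) x - f n x) < \<epsilon>"
        by (auto dest: eventually_happens)
      then show "\<exists>g. mixes g \<and> L1_norm (\<lambda>x. indicator (\<Union>i. A i) x - g x) \<le> \<epsilon>"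
        using f by (intro exI[of _ "f n"]) auto
    qed
  qed
qed

lemma L1_restrict: "integrable lborel_01 f \<Longrightarrow> L1 (\<lambda>x. indicator {0..1} x * f x)"
  for f :: "real \<Rightarrow> real"
proof -
  assume f: "integrable lborel_01 f"
  have "integrable lborel_01 (\<lambda>x. indicator {0..1} x * f x) \<longleftrightarrow> integrable lborel_01 f"
    by (rule Bochner_Integration.integrable_cong) auto
  moreover have "(\<lambda>x. indicator {0..1} x * f x) \<in> borel_measurable borel"
    using borel_measurable_integrable[OF f] by (simp add: borel_measurable_restrict_space_iff mult.commute)
  ultimately show ?thesis using f by (simp only: L1_def)
qed

text \<open>Induction from indicators through simple functions to limits. The factor
  \<open>indicator {0..1}\<close> is there because \<open>L1\<close> asks for measurability on the
  whole line, which an integrable function on the restricted space need not have.\<close>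

theorem mixes_L1_function:
  assumes f: "L1 f"
  shows "mixes f"
proof -
  have "mixes (\<lambda>x. indicator {0..1} x * f x)"
    using L1_integrable[OF f]
  proof (induction f rule: integrable_induct)
    case (base A c)
    then have A: "A \<in> sets borel" "A \<subseteq> {0..1}" by (auto simp: sets_restrict_space)
    have "(\<lambda>x. indicator {0..1} x * (indicator A x *\<^sub>R c)) = (\<lambda>x. c * indicator A x)"
      using A by (auto simp: fun_eq_iff split: split_indicator)
    then show ?case using mixes_cmult[OF mixes_indicator[OF A(1)]] by simp
  next
    case (add f g)
    then show ?case using mixes_add by (simp add: distrib_left)
  next
    case (lim f s)
    define F where "F = (\<lambda>x. indicator {0..1} x * f x)"
    define S where "S = (\<lambda>i x. indicator {0..1} x * s i x)"
    have L: "L1 F" unfolding F_def by (rule L1_restrict) fact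
    have S: "mixes (S i)" for i unfolding S_def by (rule lim.IH)
    have conv: "(\<lambda>n. \<integral>x. \<bar>F x - S n x\<bar> \<partial>lborel_01) \<longlonglongrightarrow> (\<integral>x. 0 \<partial>lborel_01)"
    \<comment> \<open>The approximants satisfy |S n x| \<le> 2 |F x|, hence the factor 3.\<close>
    proof (rule integral_dominated_convergence[where w = "\<lambda>x. 3 * \<bar>F x\<bar>"])
      show "AE x in lborel_01. (\<lambda>n. \<bar>F x - S n x\<bar>) \<longlonglongrightarrow> 0"
      proof (rule AE_I2)
        fix x assume x: "x \<in> space lborel_01"
        then have "(\<lambda>n. S n x) \<longlonglongrightarrow> F x"
          using lim.hyps(2)[OF x] by (simp add: S_def F_def)
        from tendsto_rabs[OF tendsto_diff[OF tendsto_const[of "F x"] this]]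
        show "(\<lambda>n. \<bar>F x - S n x\<bar>) \<longlonglongrightarrow> 0" by simp
      qed
      show "AE x in lborel_01. norm \<bar>F x - S n x\<bar> \<le> 3 * \<bar>F x\<bar>" for n
      proof (rule AE_I2)
        fix x assume x: "x \<in> space lborel_01"
        show "norm \<bar>F x - S n x\<bar> \<le> 3 * \<bar>F x\<bar>"
          using lim.hyps(3)[OF x, of n] x by (auto simp: S_def F_def)
      qed
      show "integrable lborel_01 (\<lambda>x. 3 * \<bar>F x\<bar>)"
        using L1_integrable[OF L1_abs[OF L]] by simp
      show "(\<lambda>x. \<bar>F x - S n x\<bar>) \<in> borel_measurable lborel_01" for n
        by (rule L1_integrable[OF L1_abs[OF L1_diff[OF L mixes_L1[OF S]]], THEN borel_measurable_integrable])
      show "(\<lambda>x. 0 :: real) \<in> borel_measurable lborel_01" by simp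
    qed
    show ?case unfolding F_def [symmetric]
    proof (rule mixes_closed[OF L])
      fix \<epsilon> :: real assume "\<epsilon> > 0"
      then have "\<forall>\<^sub>F n in sequentially. L1_norm (\<lambda>x. F x - S n x) < \<epsilon>"
        using conv by (intro order_tendstoD) (auto simp: L1_norm_def)
      then obtain n where "L1_norm (\<lambda>x. F x - S n x) < \<epsilon>"
        by (auto dest: eventually_happens)
      then show "\<exists>g. mixes g \<and> L1_norm (\<lambda>x. F x - g x) \<le> \<epsilon>"
        using S by (intro exI[of _ "S n"]) auto
    qed
  qed
  then show ?thesis
    by (rule mixes_cong_AE[OF _ f]) (auto intro!: AE_I2)
qed

text \<open>An invariant f equals all its iterates almost everywhere, and these converge to
  h.\<close>

lemma stationary_unique:
  assumes f: "L1 f" and inv: "L1_norm (\<lambda>x. P f x - f x) = 0" and int: "(\<integral>x. f x \<partial>lborel_01) = 1"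
  shows "AE x in lborel_01. f x = h x"
proof -
  have 0: "L1_norm (\<lambda>x. (P ^^ n) f x - f x) = 0" for n
  proof (induction n)
    case (Suc n)
    have "L1_norm (\<lambda>x. (P ^^ Suc n) f x - f x) \<le> L1_norm (\<lambda>x. (P ^^ Suc n) f x - (P ^^ n) f x) + L1_norm (\<lambda>x. (P ^^ n) f x - f x)"
      by (intro L1_norm_diff_triangle L1_iter f)
    also have "(\<lambda>x. (P ^^ Suc n) f x - (P ^^ n) f x) = (P ^^ n) (\<lambda>x. P f x - f x)"
      by (simp add: iter_diff funpow_swap1)
    also have "L1_norm \<dots> \<le> L1_norm (\<lambda>x. P f x - f x)"
      by (intro L1_norm_iter_le L1_diff L1_P f)
    finally show ?case using inv Suc.IH L1_norm_nonneg[of "\<lambda>x. (P ^^ Suc n) f x - f x"] by linarith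
  qed (simp add: L1_norm_def)
  have "L1_norm (\<lambda>x. f x - h x) \<le> L1_norm (\<lambda>x. (P ^^ n) f x - h x)" for n
    using L1_norm_diff_triangle[OF f L1_iter[OF f, of n] h_L1] 0[of n] L1_norm_commute[of f "(P ^^ n) f"] by simp
  moreover have "(\<lambda>n. L1_norm (\<lambda>x. (P ^^ n) f x - h x)) \<longlonglongrightarrow> 0"
    using mixes_L1_function[OF f] by (simp add: mixes_def int)
  ultimately have "L1_norm (\<lambda>x. f x - h x) \<le> 0" by (intro LIMSEQ_le_const) auto
  then have "L1_norm (\<lambda>x. f x - h x) = 0" using L1_norm_nonneg[of "\<lambda>x. f x - h x"] by linarith
  then show ?thesis using f h_L1 by (simp add: L1_norm_eq_0_iff L1_diff)
qed

end

section \<open>The skew product\<close>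

locale skew_system = limit_system +
  fixes T :: "nat \<Rightarrow> real \<Rightarrow> real"
  assumes T: "\<And>j x. j \<in> J \<Longrightarrow> x \<in> {0..1} \<Longrightarrow> T j x = branch_map (height j) (e j) x"
begin

definition symbols :: "nat measure" where
  "symbols = point_measure J (\<lambda>j. ennreal (p j))"

definition sequences :: "(nat \<Rightarrow> nat) measure" where
  "sequences = PiM UNIV (\<lambda>_. symbols)"

definition stat :: "real measure" where
  "stat = density lborel_01 (\<lambda>x. ennreal (h x))"

abbreviation F :: "(nat \<Rightarrow> nat) \<times> real \<Rightarrow> (nat \<Rightarrow> nat) \<times> real" where
  "F \<equiv> random_map T"

lemma T_range: "j \<in> J \<Longrightarrow> x \<in> {0..1} \<Longrightarrow> T j x \<in> {0..1}"
  using T branch_map_range height e_ge1 by metis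

lemma sets_lborel_01: "sets lborel_01 = sets (restrict_space borel {0..1})"
  by (rule sets_restrict_space_cong) simp

lemma measurable_T: "j \<in> J \<Longrightarrow> T j \<in> lborel_01 \<rightarrow>\<^sub>M lborel_01"
proof -
  assume j: "j \<in> J"
  have "branch_map (height j) (e j) \<in> lborel_01 \<rightarrow>\<^sub>M lborel_01"
    using branch_map_range[OF height e_ge1[OF j]]
    by (intro measurable_restrict_space3) (auto simp: measurable_lborel1)
  then show ?thesis
    by (subst measurable_cong[where g = "branch_map (height j) (e j)"]) (use T j in auto)
qed

lemma prob_space_symbols: "prob_space symbols"
proof (rule prob_spaceI)
  have "emeasure symbols (space symbols) = (\<Sum>j\<in>J. ennreal (p j))"
    unfolding symbols_def using finite_J by (simp add: space_point_measure emeasure_point_measure_finite)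
  also have "\<dots> = ennreal (\<Sum>j\<in>J. p j)" using p_pos by (intro sum_ennreal) (auto simp: less_imp_le)
  finally show "emeasure symbols (space symbols) = 1" by (simp add: p_sum)
qed

lemma space_symbols: "space symbols = J" and sets_symbols: "sets symbols = Pow J"
  by (simp_all add: symbols_def space_point_measure sets_point_measure)

lemma space_sequences: "space sequences = (UNIV \<rightarrow>\<^sub>E J)"
  by (simp add: sequences_def space_PiM space_symbols)

sublocale S: sequence_space symbols
proof -
  interpret prob_space symbols by (rule prob_space_symbols)
  show "sequence_space symbols" by standard
qed

lemma prob_space_sequences: "prob_space sequences"
  unfolding sequences_def by (rule S.prob_space_axioms)

text \<open>Prepending an independent symbol reproduces the Bernoulli measure; this allows
  conditioning on the first symbol.\<close>

lemma sequences_iter: "distr (symbols \<Otimes>\<^sub>M sequences) sequences (\<lambda>(s, \<omega>). case_nat s \<omega>) = sequences"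
  unfolding sequences_def by (rule S.PiM_iter)

lemma measurable_coord [measurable]: "(\<lambda>\<omega>. \<omega> i) \<in> sequences \<rightarrow>\<^sub>M symbols"
  unfolding sequences_def by measurable

lemma measurable_shift [measurable]: "(\<lambda>\<omega> n. \<omega> (Suc n)) \<in> sequences \<rightarrow>\<^sub>M sequences"
  unfolding sequences_def by (intro measurable_PiM_single') (auto simp: space_PiM)

lemma measurable_F: "F \<in> sequences \<Otimes>\<^sub>M lborel_01 \<rightarrow>\<^sub>M sequences \<Otimes>\<^sub>M lborel_01"
proof -
  have 1: "(\<lambda>z. fst z 0) \<in> sequences \<Otimes>\<^sub>M lborel_01 \<rightarrow>\<^sub>M count_space J"
  proof -
    have "(\<lambda>z. fst z 0) \<in> sequences \<Otimes>\<^sub>M lborel_01 \<rightarrow>\<^sub>M symbols" by measurable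
    then show ?thesis
      by (rule measurable_cong_sets[OF refl, THEN equalityD1, THEN subsetD, rotated])
        (simp add: sets_symbols)
  qed
  have "(\<lambda>z. T (fst z 0) (snd z)) \<in> sequences \<Otimes>\<^sub>M lborel_01 \<rightarrow>\<^sub>M lborel_01"
  proof (rule measurable_compose_countable'[OF _ 1])
    show "(\<lambda>z. T j (snd z)) \<in> sequences \<Otimes>\<^sub>M lborel_01 \<rightarrow>\<^sub>M lborel_01" if "j \<in> J" for j
      using measurable_T[OF that] by measurable
  qed (simp add: finite_J countable_finite)
  moreover have "(\<lambda>z n. fst z (Suc n)) \<in> sequences \<Otimes>\<^sub>M lborel_01 \<rightarrow>\<^sub>M sequences"
    using measurable_compose[OF measurable_fst measurable_shift] by simp
  ultimately have "(\<lambda>z. (\<lambda>n. fst z (Suc n), T (fst z 0) (snd z))) \<in>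
      sequences \<Otimes>\<^sub>M lborel_01 \<rightarrow>\<^sub>M sequences \<Otimes>\<^sub>M lborel_01"
    by (rule measurable_Pair[rotated])
  then show ?thesis by (simp add: random_map_def case_prod_unfold)
qed

lemma measurable_F_iter: "(F ^^ n) \<in> sequences \<Otimes>\<^sub>M lborel_01 \<rightarrow>\<^sub>M sequences \<Otimes>\<^sub>M lborel_01"
proof (induction n)
  case (Suc n)
  from measurable_compose[OF Suc measurable_F] show ?case by (simp add: comp_def)
qed (simp add: id_def)

text \<open>Turns an event of the skew product into a test function on the line with values in
  [0, 1], as required by \<open>integral_transfer\<close>.\<close>

definition fibre :: "((nat \<Rightarrow> nat) \<times> real) set \<Rightarrow> real \<Rightarrow> real" where
  "fibre E x = indicator {0..1} x * measure sequences {\<omega> \<in> space sequences. (\<omega>, x) \<in> E}"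

lemma fibre_nonneg: "0 \<le> fibre E x" and fibre_le_1: "fibre E x \<le> 1"
proof -
  interpret prob_space sequences by (rule prob_space_sequences)
  show "0 \<le> fibre E x" "fibre E x \<le> 1" by (auto simp: fibre_def split: split_indicator)
qed

lemma fibre_eq:
  assumes E: "E \<in> sets (sequences \<Otimes>\<^sub>M lborel_01)" and x: "x \<in> {0..1}"
  shows "{\<omega> \<in> space sequences. (\<omega>, x) \<in> E} = (\<lambda>\<omega>. (\<omega>, x)) -` E"
    "{\<omega> \<in> space sequences. (\<omega>, x) \<in> E} \<in> sets sequences"
proof -
  show "{\<omega> \<in> space sequences. (\<omega>, x) \<in> E} = (\<lambda>\<omega>. (\<omega>, x)) -` E"
    using sets.sets_into_space[OF E] by (auto simp: space_pair_measure)
  then show "{\<omega> \<in> space sequences. (\<omega>, x) \<in> E} \<in> sets sequences"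
    using sets_Pair2[OF E, of x] by simp
qed

lemma measurable_fibre:
  assumes E: "E \<in> sets (sequences \<Otimes>\<^sub>M lborel_01)"
  shows "fibre E \<in> borel_measurable borel"
proof -
  interpret S: prob_space sequences by (rule prob_space_sequences)
  interpret L: prob_space lborel_01 by (rule prob_space_lborel_01)
  interpret pair_sigma_finite sequences lborel_01 ..
  have "(\<lambda>x. enn2real (emeasure sequences ((\<lambda>\<omega>. (\<omega>, x)) -` E))) \<in> borel_measurable lborel_01"
    using measurable_emeasure_Pair2[OF E] by measurable
  then have "(\<lambda>x. measure sequences {\<omega> \<in> space sequences. (\<omega>, x) \<in> E}) \<in> borel_measurable lborel_01"
    by (subst measurable_cong[where g = "\<lambda>x. enn2real (emeasure sequences ((\<lambda>\<omega>. (\<omega>, x)) -` E))"])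
       (use fibre_eq(1)[OF E] in \<open>auto simp: measure_def\<close>)
  then show ?thesis
    unfolding fibre_def[abs_def] by (simp add: borel_measurable_restrict_space_iff mult.commute)
qed

text \<open>Given first symbol j, the image under \<open>F\<close> consists of the shifted sequence,
  again Bernoulli, and the point T j x.\<close>

lemma measure_first_step:
  assumes E: "E \<in> sets (sequences \<Otimes>\<^sub>M lborel_01)" and x: "x \<in> {0..1}"
  shows "measure sequences {\<omega> \<in> space sequences. \<omega> 0 \<in> Y \<and> F (\<omega>, x) \<in> E} =
    (\<Sum>j\<in>J. p j * (indicator Y j * measure sequences {\<omega> \<in> space sequences. (\<omega>, T j x) \<in> E}))"
proof -
  interpret S: prob_space sequences by (rule prob_space_sequences)
  interpret B: prob_space symbols by (rule prob_space_symbols)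
  define A where "A = {\<omega> \<in> space sequences. \<omega> 0 \<in> Y \<and> F (\<omega>, x) \<in> E}"
  define c where "c = (\<lambda>(s, \<omega>). case_nat s \<omega> :: nat \<Rightarrow> nat)"
  have "(\<lambda>\<omega>. (\<omega>, x)) \<in> sequences \<rightarrow>\<^sub>M sequences \<Otimes>\<^sub>M lborel_01"
    using x by (intro measurable_Pair) auto
  then have Fx: "(\<lambda>\<omega>. F (\<omega>, x)) \<in> sequences \<rightarrow>\<^sub>M sequences \<Otimes>\<^sub>M lborel_01"
    by (rule measurable_compose) (rule measurable_F)
  have A: "A \<in> sets sequences"
  proof -
    have "{\<omega> \<in> space sequences. \<omega> 0 \<in> Y} = (\<lambda>\<omega>. \<omega> 0) -` (Y \<inter> J) \<inter> space sequences"
      by (auto simp: space_sequences)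
    also have "\<dots> \<in> sets sequences"
      by (rule measurable_sets[OF measurable_coord]) (simp add: sets_symbols)
    finally have "{\<omega> \<in> space sequences. \<omega> 0 \<in> Y} \<inter> ((\<lambda>\<omega>. F (\<omega>, x)) -` E \<inter> space sequences) \<in> sets sequences"
      using measurable_sets[OF Fx E] by blast
    also have "{\<omega> \<in> space sequences. \<omega> 0 \<in> Y} \<inter> ((\<lambda>\<omega>. F (\<omega>, x)) -` E \<inter> space sequences) = A"
      by (auto simp: A_def)
    finally show ?thesis .
  qed
  have c: "c \<in> symbols \<Otimes>\<^sub>M sequences \<rightarrow>\<^sub>M sequences"
    unfolding c_def sequences_def by measurable
  have "emeasure sequences A = emeasure (distr (symbols \<Otimes>\<^sub>M sequences) sequences c) A"
    unfolding c_def sequences_iter ..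
  also have "\<dots> = emeasure (symbols \<Otimes>\<^sub>M sequences) (c -` A \<inter> space (symbols \<Otimes>\<^sub>M sequences))"
    by (rule emeasure_distr[OF c A])
  also have "\<dots> = (\<integral>\<^sup>+j. emeasure sequences (Pair j -` (c -` A \<inter> space (symbols \<Otimes>\<^sub>M sequences))) \<partial>symbols)"
    using measurable_sets[OF c A] by (rule S.emeasure_pair_measure_alt)
  also have "\<dots> = (\<Sum>j\<in>J. ennreal (p j) * emeasure sequences (Pair j -` (c -` A \<inter> space (symbols \<Otimes>\<^sub>M sequences))))"
    unfolding symbols_def using finite_J by (subst nn_integral_point_measure_finite) (auto simp: mult.commute)
  also have "\<dots> = (\<Sum>j\<in>J. ennreal (p j * (indicator Y j * measure sequences {\<omega> \<in> space sequences. (\<omega>, T j x) \<in> E})))"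
  proof (rule sum.cong[OF refl])
    fix j assume j: "j \<in> J"
    have "Pair j -` (c -` A \<inter> space (symbols \<Otimes>\<^sub>M sequences)) =
        (if j \<in> Y then {\<omega> \<in> space sequences. (\<omega>, T j x) \<in> E} else {})"
    proof -
      have "case_nat j \<omega> \<in> space sequences" if "\<omega> \<in> space sequences" for \<omega>
        using that j by (auto simp: space_sequences PiE_iff split: nat.split)
      then show ?thesis
        using j by (auto simp: A_def c_def random_map_def space_pair_measure space_symbols)
    qed
    then show "ennreal (p j) * emeasure sequences (Pair j -` (c -` A \<inter> space (symbols \<Otimes>\<^sub>M sequences))) =
        ennreal (p j * (indicator Y j * measure sequences {\<omega> \<in> space sequences. (\<omega>, T j x) \<in> E}))"
      using p_pos[OF j] by (auto simp: S.emeasure_eq_measure ennreal_mult')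
  qed
  also have "\<dots> = ennreal (\<Sum>j\<in>J. p j * (indicator Y j * measure sequences {\<omega> \<in> space sequences. (\<omega>, T j x) \<in> E}))"
    using p_pos by (intro sum_ennreal) (auto simp: less_imp_le)
  finally have "ennreal (measure sequences A) = \<dots>" by (simp add: S.emeasure_eq_measure)
  moreover have "0 \<le> (\<Sum>j\<in>J. p j * (indicator Y j * measure sequences {\<omega> \<in> space sequences. (\<omega>, T j x) \<in> E}))"
    using p_pos by (intro sum_nonneg mult_nonneg_nonneg) (auto simp: less_imp_le)
  ultimately show ?thesis by (simp add: A_def)
qed

text \<open>Conditioning on the first symbol, then duality: a restriction Y on that symbol selects
  which branch operators act on the density.\<close>

lemma integral_fibre_first_step:
  assumes f: "L1 f" and E: "E \<in> sets (sequences \<Otimes>\<^sub>M lborel_01)"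
    and E': "\<And>\<omega> x. \<omega> \<in> space sequences \<Longrightarrow> x \<in> {0..1} \<Longrightarrow> (\<omega>, x) \<in> E' \<longleftrightarrow> \<omega> 0 \<in> Y \<and> F (\<omega>, x) \<in> E"
  shows "(\<integral>x. f x * fibre E' x \<partial>lborel_01) =
    (\<Sum>j\<in>J. p j * (indicator Y j * (\<integral>x. branch_transfer j f x * fibre E x \<partial>lborel_01)))"
proof -
  note it = integral_transfer[OF height e_ge1 f measurable_fibre[OF E] fibre_nonneg fibre_le_1]
  have "fibre E' x = (\<Sum>j\<in>J. p j * (indicator Y j * fibre E (branch_map (height j) (e j) x)))"
    if x: "x \<in> {0..1}" for x
  proof -
    have "{\<omega> \<in> space sequences. (\<omega>, x) \<in> E'} = {\<omega> \<in> space sequences. \<omega> 0 \<in> Y \<and> F (\<omega>, x) \<in> E}"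
      using E' x by auto
    then have "fibre E' x = (\<Sum>j\<in>J. p j * (indicator Y j * measure sequences {\<omega> \<in> space sequences. (\<omega>, T j x) \<in> E}))"
      using measure_first_step[OF E x, of Y] x by (simp add: fibre_def)
    also have "\<dots> = (\<Sum>j\<in>J. p j * (indicator Y j * fibre E (branch_map (height j) (e j) x)))"
      using T_range[OF _ x] T[OF _ x] by (intro sum.cong) (auto simp: fibre_def)
    finally show ?thesis .
  qed
  then have "(\<integral>x. f x * fibre E' x \<partial>lborel_01) =
      (\<integral>x. (\<Sum>j\<in>J. p j * (indicator Y j * (f x * fibre E (branch_map (height j) (e j) x)))) \<partial>lborel_01)"
    by (intro Bochner_Integration.integral_cong) (auto simp: sum_distrib_left mult_ac)
  also have "\<dots> = (\<Sum>j\<in>J. p j * (indicator Y j * (\<integral>x. f x * fibre E (branch_map (height j) (e j) x) \<partial>lborel_01)))"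
    using it(1) by (subst Bochner_Integration.integral_sum) auto
  also have "\<dots> = (\<Sum>j\<in>J. p j * (indicator Y j * (\<integral>x. branch_transfer j f x * fibre E x \<partial>lborel_01)))"
    using it(3) by (intro sum.cong) auto
  finally show ?thesis .
qed

section \<open>Mixing\<close>

lemma prob_space_stat: "prob_space stat"
proof (rule prob_spaceI)
  note [measurable] = L1_measurable[OF h_L1]
  have hm: "(\<lambda>x. ennreal (h x)) \<in> borel_measurable lborel_01"
    by (rule measurable_lborel_01) measurable
  have "emeasure stat (space stat) = (\<integral>\<^sup>+x. ennreal (h x) * indicator {0..1} x \<partial>lborel_01)"
    unfolding stat_def space_density space_lborel_01
    by (rule emeasure_density[OF hm]) (auto simp: sets_restrict_space)
  also have "\<dots> = (\<integral>\<^sup>+x. ennreal (h x) \<partial>lborel_01)"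
    by (intro nn_integral_cong) auto
  also have "\<dots> = 1"
    using nn_integral_eq_integral[OF L1_integrable[OF h_L1]] h_nonneg integral_h by simp
  finally show "emeasure stat (space stat) = 1" .
qed

lemma sets_stat: "sets stat = sets lborel_01" and space_stat: "space stat = {0..1}"
  by (simp_all add: stat_def)

definition skew :: "((nat \<Rightarrow> nat) \<times> real) measure" where
  "skew = sequences \<Otimes>\<^sub>M stat"

lemma sets_skew: "sets skew = sets (sequences \<Otimes>\<^sub>M lborel_01)"
  unfolding skew_def by (intro sets_pair_measure_cong sets_stat refl)

lemma space_skew: "space skew = space sequences \<times> {0..1}"
  by (simp add: skew_def space_pair_measure space_stat)

lemma prob_space_skew: "prob_space skew"
proof -
  interpret S: prob_space sequences by (rule prob_space_sequences)
  interpret L: prob_space stat by (rule prob_space_stat)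
  interpret pair_prob_space sequences stat ..
  show ?thesis unfolding skew_def by (rule prob_space_axioms)
qed

lemma measurable_F_skew: "(F ^^ n) \<in> skew \<rightarrow>\<^sub>M skew"
  using measurable_F_iter[of n] sets_skew measurable_cong_sets[OF sets_skew sets_skew] by simp

text \<open>Fubini with the real coordinate as the outer variable.\<close>

lemma measure_skew:
  assumes E: "E \<in> sets skew"
  shows "measure skew E = (\<integral>x. h x * fibre E x \<partial>lborel_01)"
proof -
  interpret S: prob_space sequences by (rule prob_space_sequences)
  interpret L: prob_space stat by (rule prob_space_stat)
  interpret pair_sigma_finite sequences stat ..
  note E' = E[unfolded sets_skew]
  note [measurable] = measurable_fibre[OF E'] L1_measurable[OF h_L1]
  have hf: "L1 (\<lambda>x. h x * fibre E x)"
  proof (rule L1_bound[OF h_L1])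
    show "\<bar>h x * fibre E x\<bar> \<le> h x" for x
      using mult_left_le[OF fibre_le_1[of E x] h_nonneg[of x]] h_nonneg[of x] fibre_nonneg[of E x] by simp
  qed measurable
  have "emeasure skew E = (\<integral>\<^sup>+x. emeasure sequences ((\<lambda>\<omega>. (\<omega>, x)) -` E) \<partial>stat)"
    using E unfolding skew_def by (rule emeasure_pair_measure_alt2)
  also have "\<dots> = (\<integral>\<^sup>+x. ennreal (fibre E x) \<partial>stat)"
  proof (rule nn_integral_cong)
    fix x assume "x \<in> space stat"
    then have x: "x \<in> {0..1}" by (simp add: space_stat)
    show "emeasure sequences ((\<lambda>\<omega>. (\<omega>, x)) -` E) = ennreal (fibre E x)"
      using x fibre_eq(1)[OF E' x] by (simp add: fibre_def S.emeasure_eq_measure)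
  qed
  also have "\<dots> = (\<integral>\<^sup>+x. ennreal (h x) * ennreal (fibre E x) \<partial>lborel_01)"
    unfolding stat_def by (rule nn_integral_density) (intro measurable_lborel_01; measurable)+
  also have "\<dots> = (\<integral>\<^sup>+x. ennreal (h x * fibre E x) \<partial>lborel_01)"
    using h_nonneg fibre_nonneg by (simp add: ennreal_mult)
  also have "\<dots> = ennreal (\<integral>x. h x * fibre E x \<partial>lborel_01)"
    using h_nonneg fibre_nonneg by (intro nn_integral_eq_integral L1_integrable[OF hf]) auto
  finally show ?thesis
    using h_nonneg fibre_nonneg by (simp add: measure_def integral_nonneg)
qed

definition cylinder_return :: "nat \<Rightarrow> (nat \<Rightarrow> nat set) \<Rightarrow> ((nat \<Rightarrow> nat) \<times> real) set \<Rightarrow> ((nat \<Rightarrow> nat) \<times> real) set" where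
  "cylinder_return n X B = {z \<in> space skew. (\<forall>i. fst z i \<in> X i) \<and> (F ^^ n) z \<in> B}"

lemma sets_cylinder:
  "{z \<in> space skew. \<forall>i. fst z i \<in> X i} \<in> sets skew"
proof -
  have "{z \<in> space skew. fst z i \<in> X i} \<in> sets skew" for i
  proof -
    have "(\<lambda>z. fst z i) \<in> skew \<rightarrow>\<^sub>M symbols"
      unfolding skew_def by measurable
    then have "(\<lambda>z. fst z i) -` (X i \<inter> J) \<inter> space skew \<in> sets skew"
      by (rule measurable_sets) (simp add: sets_symbols)
    also have "(\<lambda>z. fst z i) -` (X i \<inter> J) \<inter> space skew = {z \<in> space skew. fst z i \<in> X i}"
      by (auto simp: space_skew space_sequences PiE_iff)
    finally show ?thesis .
  qed
  then have "(\<Inter>i. {z \<in> space skew. fst z i \<in> X i}) \<in> sets skew"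
    by (intro sets.countable_INT) auto
  also have "(\<Inter>i. {z \<in> space skew. fst z i \<in> X i}) = {z \<in> space skew. \<forall>i. fst z i \<in> X i}"
    by auto
  finally show ?thesis .
qed

lemma sets_cylinder_return:
  assumes "B \<in> sets skew"
  shows "cylinder_return n X B \<in> sets skew"
proof -
  have "cylinder_return n X B = {z \<in> space skew. \<forall>i. fst z i \<in> X i} \<inter> ((F ^^ n) -` B \<inter> space skew)"
    by (auto simp: cylinder_return_def)
  then show ?thesis using sets_cylinder measurable_sets[OF measurable_F_skew assms] by auto
qed

lemma cylinder_return_Suc:
  assumes "\<omega> \<in> space sequences" "x \<in> {0..1}"
  shows "(\<omega>, x) \<in> cylinder_return (Suc n) X B \<longleftrightarrow>
    \<omega> 0 \<in> X 0 \<and> F (\<omega>, x) \<in> cylinder_return n (\<lambda>i. X (Suc i)) B"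
proof -
  have z: "(\<omega>, x) \<in> space skew" using assms by (simp add: space_skew)
  have Fz: "F (\<omega>, x) \<in> space skew" using measurable_space[OF measurable_F_skew[of 1] z] by simp
  have "(\<forall>i. \<omega> i \<in> X i) \<longleftrightarrow> \<omega> 0 \<in> X 0 \<and> (\<forall>i. \<omega> (Suc i) \<in> X (Suc i))"
    by (metis not0_implies_Suc)
  moreover have "fst (F (\<omega>, x)) i = \<omega> (Suc i)" for i by (simp add: random_map_def)
  moreover have "(F ^^ Suc n) (\<omega>, x) = (F ^^ n) (F (\<omega>, x))" by (simp add: funpow_swap1)
  ultimately show ?thesis using z Fz by (simp add: cylinder_return_def)
qed

text \<open>Without restrictions on the symbols every branch operator contributes, and their
  weighted sum is \<open>P\<close>.\<close>

lemma integral_return: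
  assumes f: "L1 f" and B: "B \<in> sets skew"
  shows "(\<integral>x. f x * fibre (cylinder_return n (\<lambda>_. UNIV) B) x \<partial>lborel_01) =
    (\<integral>x. (P ^^ n) f x * fibre B x \<partial>lborel_01)"
  using f
proof (induction n arbitrary: f)
  case 0
  have "cylinder_return 0 (\<lambda>_. UNIV) B = B"
    using sets.sets_into_space[OF B] by (auto simp: cylinder_return_def)
  then show ?case by simp
next
  case (Suc n)
  define E where "E = cylinder_return n (\<lambda>_. UNIV) B"
  have E: "E \<in> sets (sequences \<Otimes>\<^sub>M lborel_01)"
    using sets_cylinder_return[OF B] by (simp add: E_def sets_skew)
  have "(\<integral>x. f x * fibre (cylinder_return (Suc n) (\<lambda>_. UNIV) B) x \<partial>lborel_01) =
    (\<Sum>j\<in>J. p j * (indicator UNIV j * (\<integral>x. branch_transfer j f x * fibre E x \<partial>lborel_01)))"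
    unfolding E_def using cylinder_return_Suc
    by (intro integral_fibre_first_step[OF Suc.prems E[unfolded E_def]]) auto
  also have "\<dots> = (\<integral>x. P f x * fibre E x \<partial>lborel_01)"
    using integral_P_mult[OF Suc.prems measurable_fibre[OF E] fibre_nonneg fibre_le_1]
      integral_transfer(3)[OF height e_ge1 Suc.prems measurable_fibre[OF E] fibre_nonneg fibre_le_1]
    by simp
  also have "\<dots> = (\<integral>x. (P ^^ n) (P f) x * fibre B x \<partial>lborel_01)"
    unfolding E_def by (rule Suc.IH) (rule L1_P[OF Suc.prems])
  finally show ?case by (simp add: funpow_swap1)
qed

lemma integral_mult_fibre_le:
  assumes "L1 f" "L1 g" "B \<in> sets skew"
  shows "\<bar>(\<integral>x. f x * fibre B x \<partial>lborel_01) - (\<integral>x. g x * fibre B x \<partial>lborel_01)\<bar> \<le> L1_norm (\<lambda>x. f x - g x)"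
proof -
  note [measurable] = measurable_fibre[OF assms(3)[unfolded sets_skew]]
  have L: "L1 (\<lambda>x. f x * fibre B x)" if "L1 f" for f
  proof (rule L1_bound[OF L1_abs[OF that]])
    note [measurable] = L1_measurable[OF that]
    show "(\<lambda>x. f x * fibre B x) \<in> borel_measurable borel" by measurable
    show "\<bar>f x * fibre B x\<bar> \<le> \<bar>f x\<bar>" for x
      using mult_left_le[OF fibre_le_1[of B x], of "\<bar>f x\<bar>"] fibre_nonneg[of B x] by (simp add: abs_mult)
  qed
  have "(\<integral>x. f x * fibre B x \<partial>lborel_01) - (\<integral>x. g x * fibre B x \<partial>lborel_01) =
      (\<integral>x. (f x - g x) * fibre B x \<partial>lborel_01)"
    using L1_integrable[OF L[OF assms(1)]] L1_integrable[OF L[OF assms(2)]] by (simp add: left_diff_distrib)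
  also have "\<bar>\<dots>\<bar> \<le> L1_norm (\<lambda>x. (f x - g x) * fibre B x)"
    by (rule abs_integral_le_L1_norm) (rule L[OF L1_diff[OF assms(1,2)]])
  also have "\<dots> \<le> L1_norm (\<lambda>x. f x - g x)"
    unfolding L1_norm_def
  proof (rule integral_mono)
    show "integrable lborel_01 (\<lambda>x. \<bar>(f x - g x) * fibre B x\<bar>)"
      by (rule L1_integrable[OF L1_abs[OF L[OF L1_diff[OF assms(1,2)]]]])
    show "integrable lborel_01 (\<lambda>x. \<bar>f x - g x\<bar>)"
      by (rule L1_integrable[OF L1_abs[OF L1_diff[OF assms(1,2)]]])
    show "\<bar>(f x - g x) * fibre B x\<bar> \<le> \<bar>f x - g x\<bar>" for x
      using mult_left_le[OF fibre_le_1[of B x], of "\<bar>f x - g x\<bar>"] fibre_nonneg[of B x] by (simp add: abs_mult)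
  qed
  finally show ?thesis .
qed

lemma measure_F_invariant:
  assumes B: "B \<in> sets skew"
  shows "measure skew ((F ^^ n) -` B \<inter> space skew) = measure skew B"
proof -
  have "L1_norm (\<lambda>x. (P ^^ n) h x - h x) = 0"
  proof (induction n)
    case (Suc n)
    have "L1_norm (\<lambda>x. (P ^^ Suc n) h x - h x) \<le>
        L1_norm (\<lambda>x. P ((P ^^ n) h) x - P h x) + L1_norm (\<lambda>x. P h x - h x)"
      using L1_norm_diff_triangle[OF L1_P[OF L1_iter[OF h_L1, of n]] L1_P[OF h_L1] h_L1] by simp
    moreover have "L1_norm (\<lambda>x. P ((P ^^ n) h) x - P h x) \<le> L1_norm (\<lambda>x. (P ^^ n) h x - h x)"
      using L1_norm_P_le[OF L1_diff[OF L1_iter[OF h_L1, of n] h_L1]] by (simp only: P_diff)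
    ultimately show ?case
      using Suc P_h L1_norm_nonneg[of "\<lambda>x. (P ^^ Suc n) h x - h x"] by linarith
  qed (simp add: L1_norm_def)
  moreover have "(F ^^ n) -` B \<inter> space skew = cylinder_return n (\<lambda>_. UNIV) B"
    by (auto simp: cylinder_return_def)
  ultimately show ?thesis
    using integral_mult_fibre_le[OF L1_iter[OF h_L1, of n] h_L1 B] sets_cylinder_return[OF B]
    by (simp add: measure_skew B integral_return[OF h_L1 B])
qed

text \<open>Induction on the number m of restricted symbols. One step replaces f by its images under
  single branch operators, which have the same integral, and yields the probability of the first
  side as a factor. With no restriction left, asymptotic stability gives the limit; f must be
  arbitrary in L1 since these images have no reason to be dominated.\<close>

lemma cylinder_return_tendsto:
  assumes B: "B \<in> sets skew"
  shows "L1 f \<Longrightarrow> (\<And>i. i \<ge> m \<Longrightarrow> X i = UNIV) \<Longrightarrow>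
    (\<lambda>n. \<integral>x. f x * fibre (cylinder_return n X B) x \<partial>lborel_01) \<longlonglongrightarrow>
    (\<integral>x. f x \<partial>lborel_01) * (\<Prod>i<m. \<Sum>j\<in>J. p j * indicator (X i) j) * measure skew B"
proof (induction m arbitrary: X f)
  case 0
  then have X: "X = (\<lambda>_. UNIV)" by auto
  define a where "a = (\<integral>x. f x \<partial>lborel_01)"
  have "(\<lambda>n. (\<integral>x. (P ^^ n) f x * fibre B x \<partial>lborel_01) - (\<integral>x. (a * h x) * fibre B x \<partial>lborel_01)) \<longlonglongrightarrow> 0"
  proof (rule Lim_null_comparison)
    show "\<forall>\<^sub>F n in sequentially. norm ((\<integral>x. (P ^^ n) f x * fibre B x \<partial>lborel_01) - (\<integral>x. (a * h x) * fibre B x \<partial>lborel_01)) \<le>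
        L1_norm (\<lambda>x. (P ^^ n) f x - a * h x)"
      using integral_mult_fibre_le[OF L1_iter[OF "0.prems"(1)] L1_cmult[OF h_L1] B] by (intro always_eventually) auto
    show "(\<lambda>n. L1_norm (\<lambda>x. (P ^^ n) f x - a * h x)) \<longlonglongrightarrow> 0"
      using mixes_L1_function[OF "0.prems"(1)] by (simp add: mixes_def a_def)
  qed
  moreover have "(\<integral>x. (a * h x) * fibre B x \<partial>lborel_01) = a * measure skew B"
    by (simp add: measure_skew[OF B] mult.assoc)
  ultimately have "(\<lambda>n. \<integral>x. (P ^^ n) f x * fibre B x \<partial>lborel_01) \<longlonglongrightarrow> a * measure skew B"
    by (simp add: LIM_zero_iff)
  then show ?case by (simp add: X integral_return[OF "0.prems"(1) B] a_def)
next
  case (Suc m)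
  define X' where "X' = (\<lambda>i. X (Suc i))"
  define \<beta> where "\<beta> = (\<Prod>i<m. \<Sum>j\<in>J. p j * indicator (X' i) j) * measure skew B"
  have step: "(\<integral>x. f x * fibre (cylinder_return (Suc n) X B) x \<partial>lborel_01) =
     (\<Sum>j\<in>J. p j * (indicator (X 0) j * (\<integral>x. branch_transfer j f x * fibre (cylinder_return n X' B) x \<partial>lborel_01)))" for n
    unfolding X'_def using cylinder_return_Suc sets_cylinder_return[OF B]
    by (intro integral_fibre_first_step[OF Suc.prems(1)]) (auto simp: sets_skew)
  have int: "(\<integral>x. branch_transfer j f x \<partial>lborel_01) = (\<integral>x. f x \<partial>lborel_01)" if "j \<in> J" for j
    using integral_transfer(3)[OF height e_ge1[OF that] Suc.prems(1), of "\<lambda>_. 1"] by simp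
  have "(\<lambda>n. \<Sum>j\<in>J. p j * (indicator (X 0) j * (\<integral>x. branch_transfer j f x * fibre (cylinder_return n X' B) x \<partial>lborel_01)))
     \<longlonglongrightarrow> (\<Sum>j\<in>J. p j * (indicator (X 0) j * ((\<integral>x. branch_transfer j f x \<partial>lborel_01) * (\<Prod>i<m. \<Sum>j\<in>J. p j * indicator (X' i) j) * measure skew B)))"
    using Suc.prems e_ge1
    by (intro tendsto_sum tendsto_mult tendsto_const Suc.IH L1_transfer height) (auto simp: X'_def)
  also have "(\<Sum>j\<in>J. p j * (indicator (X 0) j * ((\<integral>x. branch_transfer j f x \<partial>lborel_01) * (\<Prod>i<m. \<Sum>j\<in>J. p j * indicator (X' i) j) * measure skew B))) =
     (\<Sum>j\<in>J. p j * indicator (X 0) j * ((\<integral>x. f x \<partial>lborel_01) * \<beta>))"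
    using int by (intro sum.cong refl) (simp add: \<beta>_def mult_ac)
  also have "\<dots> = (\<Sum>j\<in>J. p j * indicator (X 0) j) * ((\<integral>x. f x \<partial>lborel_01) * \<beta>)"
    by (simp only: sum_distrib_right)
  also have "\<dots> = (\<integral>x. f x \<partial>lborel_01) * (\<Prod>i<Suc m. \<Sum>j\<in>J. p j * indicator (X i) j) * measure skew B"
    by (subst prod.lessThan_Suc_shift) (simp add: \<beta>_def X'_def mult_ac)
  finally have "(\<lambda>n. \<integral>x. f x * fibre (cylinder_return (Suc n) X B) x \<partial>lborel_01) \<longlonglongrightarrow>
     (\<integral>x. f x \<partial>lborel_01) * (\<Prod>i<Suc m. \<Sum>j\<in>J. p j * indicator (X i) j) * measure skew B"
    by (simp only: step)
  \<comment> \<open>One unit of time has been spent on the first symbol, so the limit was found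
    along \<open>Suc n\<close>.\<close>
  then show ?case by (rule LIMSEQ_imp_Suc)
qed

text \<open>The bound m restricts finitely many coordinates; the sides \<open>X i\<close> may be any
  sets because every subset of the alphabet is measurable.\<close>

definition boxes :: "((nat \<Rightarrow> nat) \<times> real) set set" where
  "boxes = {{z \<in> space skew. (\<forall>i. fst z i \<in> X i) \<and> snd z \<in> A} | X A m.
     A \<in> sets borel \<and> (\<forall>i\<ge>m. X i = UNIV)}"

lemma boxI:
  "A \<in> sets borel \<Longrightarrow> (\<And>i. i \<ge> m \<Longrightarrow> X i = UNIV) \<Longrightarrow>
    {z \<in> space skew. (\<forall>i. fst z i \<in> X i) \<and> snd z \<in> A} \<in> boxes"
  unfolding boxes_def by blast

lemma sets_box:
  assumes "A \<in> sets borel"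
  shows "{z \<in> space skew. (\<forall>i. fst z i \<in> X i) \<and> snd z \<in> A} \<in> sets skew"
proof -
  have "snd \<in> skew \<rightarrow>\<^sub>M stat" unfolding skew_def by (rule measurable_snd)
  then have "snd \<in> skew \<rightarrow>\<^sub>M lborel_01" by (simp only: measurable_cong_sets[OF refl sets_stat])
  then have "snd -` (A \<inter> {0..1}) \<inter> space skew \<in> sets skew"
    by (rule measurable_sets) (use assms in \<open>auto simp: sets_restrict_space\<close>)
  then have "{z \<in> space skew. \<forall>i. fst z i \<in> X i} \<inter> (snd -` (A \<inter> {0..1}) \<inter> space skew) \<in> sets skew"
    using sets_cylinder by blast
  also have "{z \<in> space skew. \<forall>i. fst z i \<in> X i} \<inter> (snd -` (A \<inter> {0..1}) \<inter> space skew) =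
      {z \<in> space skew. (\<forall>i. fst z i \<in> X i) \<and> snd z \<in> A}"
    by (auto simp: space_skew)
  finally show ?thesis .
qed

lemma boxes_subset: "boxes \<subseteq> Pow (space skew)"
  by (auto simp: boxes_def)

lemma Int_stable_boxes: "Int_stable boxes"
proof (rule Int_stableI)
  fix C D assume "C \<in> boxes" "D \<in> boxes"
  then obtain X A m Y B k where
    C: "C = {z \<in> space skew. (\<forall>i. fst z i \<in> X i) \<and> snd z \<in> A}" "A \<in> sets borel" "\<And>i. i \<ge> m \<Longrightarrow> X i = UNIV" and
    D: "D = {z \<in> space skew. (\<forall>i. fst z i \<in> Y i) \<and> snd z \<in> B}" "B \<in> sets borel" "\<And>i. i \<ge> k \<Longrightarrow> Y i = UNIV"
    unfolding boxes_def by blast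
  have "C \<inter> D = {z \<in> space skew. (\<forall>i. fst z i \<in> X i \<inter> Y i) \<and> snd z \<in> A \<inter> B}"
    using C D by auto
  also have "\<dots> \<in> boxes"
    using C D by (intro boxI[of _ "max m k"]) auto
  finally show "C \<inter> D \<in> boxes" .
qed

text \<open>The identity from the generated space to the product is measurable because each symbol
  and the real coordinate pull measurable sets back to boxes.\<close>

lemma sets_skew_boxes: "sets skew = sigma_sets (space skew) boxes"
proof
  have "(\<lambda>z. z) \<in> sigma (space skew) boxes \<rightarrow>\<^sub>M sequences \<Otimes>\<^sub>M stat"
  proof -
    have sp: "space (sigma (space skew) boxes) = space skew"
      and st: "sets (sigma (space skew) boxes) = sigma_sets (space skew) boxes"
      using boxes_subset by auto
    have "fst \<in> sigma (space skew) boxes \<rightarrow>\<^sub>M sequences"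
      unfolding sequences_def
    proof (rule measurable_PiM_single')
      show "(\<lambda>z. fst z i) \<in> sigma (space skew) boxes \<rightarrow>\<^sub>M symbols" for i
      proof (rule measurableI)
        show "fst z i \<in> space symbols" if "z \<in> space (sigma (space skew) boxes)" for z
          using that unfolding sp by (auto simp: space_skew space_sequences space_symbols)
        fix Y assume "Y \<in> sets symbols"
        have "(\<lambda>z. fst z i) -` Y \<inter> space (sigma (space skew) boxes) =
            {z \<in> space skew. (\<forall>k. fst z k \<in> (if k = i then Y else UNIV)) \<and> snd z \<in> UNIV}"
          unfolding sp by auto
        also have "\<dots> \<in> boxes" by (rule boxI[of _ "Suc i"]) auto
        finally show "(\<lambda>z. fst z i) -` Y \<inter> space (sigma (space skew) boxes) \<in> sets (sigma (space skew) boxes)"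
          unfolding st by blast
      qed
      show "(\<lambda>z i. fst z i) \<in> space (sigma (space skew) boxes) \<rightarrow> UNIV \<rightarrow>\<^sub>E space symbols"
        unfolding sp by (auto simp: space_skew space_sequences space_symbols)
    qed
    moreover have "snd \<in> sigma (space skew) boxes \<rightarrow>\<^sub>M stat"
    proof (rule measurableI)
      show "snd z \<in> space stat" if "z \<in> space (sigma (space skew) boxes)" for z
        using that unfolding sp by (auto simp: space_skew space_stat)
      fix A assume "A \<in> sets stat"
      then have A: "A \<in> sets borel" by (auto simp: sets_stat sets_restrict_space)
      have "snd -` A \<inter> space (sigma (space skew) boxes) = {z \<in> space skew. (\<forall>k. fst z k \<in> UNIV) \<and> snd z \<in> A}"
        unfolding sp by auto
      also have "\<dots> \<in> boxes" by (rule boxI[of _ 0]) (use A in auto)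
      finally show "snd -` A \<inter> space (sigma (space skew) boxes) \<in> sets (sigma (space skew) boxes)"
        unfolding st by blast
    qed
    ultimately have "(\<lambda>z. (fst z, snd z)) \<in> sigma (space skew) boxes \<rightarrow>\<^sub>M sequences \<Otimes>\<^sub>M stat"
      by (rule measurable_Pair)
    then show ?thesis by (simp only: prod.collapse)
  qed
  note id = this
  show "sets skew \<subseteq> sigma_sets (space skew) boxes"
  proof
    fix A assume A: "A \<in> sets skew"
    have "(\<lambda>z. z) -` A \<inter> space (sigma (space skew) boxes) \<in> sets (sigma (space skew) boxes)"
      using A by (intro measurable_sets[OF id]) (simp add: skew_def)
    moreover have "(\<lambda>z. z) -` A \<inter> space (sigma (space skew) boxes) = A"
      using sets.sets_into_space[OF A] boxes_subset by auto
    ultimately show "A \<in> sigma_sets (space skew) boxes" using boxes_subset by simp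
  qed
  show "sigma_sets (space skew) boxes \<subseteq> sets skew"
    by (rule sets.sigma_sets_subset) (auto simp: boxes_def intro: sets_box)
qed

text \<open>The symbols contribute a product of probabilities, the real side the density
  \<open>indicator C x * h x\<close>.\<close>

lemma box_mixing:
  assumes B: "B \<in> sets skew" and A: "A \<in> boxes"
  shows "(\<lambda>n. measure skew (A \<inter> (F ^^ n) -` B)) \<longlonglongrightarrow> measure skew A * measure skew B"
proof -
  interpret M: prob_space skew by (rule prob_space_skew)
  obtain X C m where AX: "A = {z \<in> space skew. (\<forall>i. fst z i \<in> X i) \<and> snd z \<in> C}"
    and C: "C \<in> sets borel" and X: "\<And>i. i \<ge> m \<Longrightarrow> X i = UNIV"
    using A unfolding boxes_def by blast
  define f where "f = (\<lambda>x. indicator C x * h x)"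
  have f: "L1 f"
    using C L1_measurable[OF h_L1] h_nonneg unfolding f_def
    by (intro L1_bound[OF h_L1]) (auto split: split_indicator)
  have lim: "(\<lambda>n. measure skew (A \<inter> (F ^^ n) -` D)) \<longlonglongrightarrow>
      (\<integral>x. f x \<partial>lborel_01) * (\<Prod>i<m. \<Sum>j\<in>J. p j * indicator (X i) j) * measure skew D"
    if D: "D \<in> sets skew" for D
  proof -
    have "measure skew (A \<inter> (F ^^ n) -` D) = (\<integral>x. f x * fibre (cylinder_return n X D) x \<partial>lborel_01)" for n
    proof -
      have "A \<inter> (F ^^ n) -` D = A \<inter> ((F ^^ n) -` D \<inter> space skew)" by (auto simp: AX)
      also have "\<dots> \<in> sets skew"
        using sets_box[OF C, of X] measurable_sets[OF measurable_F_skew D] by (auto simp: AX)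
      finally have s: "A \<inter> (F ^^ n) -` D \<in> sets skew" .
      have "fibre (A \<inter> (F ^^ n) -` D) x = indicator C x * fibre (cylinder_return n X D) x" for x
        by (auto simp: fibre_def AX cylinder_return_def split: split_indicator)
      then show ?thesis using measure_skew[OF s] by (simp add: f_def mult_ac)
    qed
    then show ?thesis using cylinder_return_tendsto[OF D f X] by simp
  qed
  \<comment> \<open>Taking the whole space as target makes the sequence constant, which identifies
    the limit factor with the measure of the box without computing it separately.\<close>
  have "measure skew (A \<inter> (F ^^ n) -` space skew) = measure skew A" for n
  proof -
    have "A \<inter> (F ^^ n) -` space skew = A"
      using measurable_space[OF measurable_F_skew[of n]] by (auto simp: AX)
    then show ?thesis by simp
  qed
  then have "(\<lambda>n. measure skew A) \<longlonglongrightarrow> (\<integral>x. f x \<partial>lborel_01) * (\<Prod>i<m. \<Sum>j\<in>J. p j * indicator (X i) j)"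
    using lim[OF sets.top] by (simp add: M.prob_space)
  then have "measure skew A = (\<integral>x. f x \<partial>lborel_01) * (\<Prod>i<m. \<Sum>j\<in>J. p j * indicator (X i) j)"
    by (rule LIMSEQ_unique[OF tendsto_const])
  then show ?thesis using lim[OF B] by simp
qed

text \<open>For fixed B the sets A with the required limit form a Dynkin system; complements use the
  invariance of the measure.\<close>

lemma mixing_skew: "mixing skew F"
  unfolding mixing_def
proof (intro conjI ballI)
  interpret M: prob_space skew by (rule prob_space_skew)
  show "prob_space skew" by (rule prob_space_skew)
  show F: "F \<in> skew \<rightarrow>\<^sub>M skew" using measurable_F_skew[of 1] by simp
  show "distr skew skew F = skew"
  proof (rule measure_eqI)
    fix B assume "B \<in> sets (distr skew skew F)"
    then have B: "B \<in> sets skew" by simp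
    show "emeasure (distr skew skew F) B = emeasure skew B"
      using measure_F_invariant[OF B, of 1] by (simp add: emeasure_distr[OF F B] M.emeasure_eq_measure)
  qed simp
  fix A B assume A: "A \<in> sets skew" and B: "B \<in> sets skew"
  have FB: "(F ^^ n) -` B \<inter> space skew \<in> sets skew" for n
    by (rule measurable_sets[OF measurable_F_skew B])
  have AFB: "C \<inter> (F ^^ n) -` B \<in> sets skew" if C: "C \<in> sets skew" for C n
  proof -
    have "C \<inter> (F ^^ n) -` B = C \<inter> ((F ^^ n) -` B \<inter> space skew)" using sets.sets_into_space[OF C] by auto
    then show ?thesis using C FB by auto
  qed
  have "A \<in> sigma_sets (space skew) boxes" using A sets_skew_boxes by simp
  with Int_stable_boxes boxes_subset
  show "(\<lambda>n. measure skew (A \<inter> (F ^^ n) -` B)) \<longlonglongrightarrow> measure skew A * measure skew B"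
  proof (induction rule: sigma_sets_induct_disjoint)
    case (basic A)
    then show ?case by (rule box_mixing[OF B])
  next
    case empty
    show ?case by simp
  next
    case (compl A)
    then have A: "A \<in> sets skew" using sets_skew_boxes by simp
    have "measure skew ((space skew - A) \<inter> (F ^^ n) -` B) = measure skew B - measure skew (A \<inter> (F ^^ n) -` B)" for n
    proof -
      have "(space skew - A) \<inter> (F ^^ n) -` B = ((F ^^ n) -` B \<inter> space skew) - (A \<inter> (F ^^ n) -` B)"
        using sets.sets_into_space[OF A] by auto
      moreover have "measure skew (((F ^^ n) -` B \<inter> space skew) - (A \<inter> (F ^^ n) -` B)) =
          measure skew ((F ^^ n) -` B \<inter> space skew) - measure skew (A \<inter> (F ^^ n) -` B)"
        using FB AFB[OF A] sets.sets_into_space[OF A] by (intro M.finite_measure_Diff) auto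
      ultimately show ?thesis by (simp add: measure_F_invariant[OF B])
    qed
    moreover have "(\<lambda>n. measure skew B - measure skew (A \<inter> (F ^^ n) -` B)) \<longlonglongrightarrow>
        measure skew B - measure skew A * measure skew B"
      by (intro tendsto_diff tendsto_const compl.IH)
    ultimately show ?case by (simp add: M.prob_compl[OF A] left_diff_distrib)
  next
    case (union A)
    then have A: "A i \<in> sets skew" for i using sets_skew_boxes by auto
    have sums: "(\<lambda>i. measure skew (A i)) sums measure skew (\<Union>i. A i)"
      using A union.hyps(1) by (intro M.finite_measure_UNION) auto
    have eq: "measure skew ((\<Union>i. A i) \<inter> (F ^^ n) -` B) = (\<Sum>i. measure skew (A i \<inter> (F ^^ n) -` B))" for n
    proof -
      have "(\<lambda>i. measure skew (A i \<inter> (F ^^ n) -` B)) sums measure skew (\<Union>i. A i \<inter> (F ^^ n) -` B)"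
      proof (rule M.finite_measure_UNION)
        show "range (\<lambda>i. A i \<inter> (F ^^ n) -` B) \<subseteq> sets skew" using AFB[OF A] by auto
        show "disjoint_family (\<lambda>i. A i \<inter> (F ^^ n) -` B)"
          using union.hyps(1) unfolding disjoint_family_on_def by blast
      qed
      moreover have "(\<Union>i. A i \<inter> (F ^^ n) -` B) = (\<Union>i. A i) \<inter> (F ^^ n) -` B" by auto
      ultimately show ?thesis by (simp add: sums_iff)
    qed
    \<comment> \<open>Limit and sum may be exchanged because the terms are dominated by the summable
      measures of the \<open>A i\<close>, uniformly in n.\<close>
    have "(\<lambda>n. \<Sum>i. measure skew (A i \<inter> (F ^^ n) -` B)) \<longlonglongrightarrow> (\<Sum>i. measure skew (A i) * measure skew B)"
    proof (rule tannerys_theorem[THEN conjunct2, THEN conjunct2])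
      show "(\<lambda>n. measure skew (A k \<inter> (F ^^ n) -` B)) \<longlonglongrightarrow> measure skew (A k) * measure skew B" for k
        by (rule union.IH)
      show "\<forall>\<^sub>F (k, n) in sequentially \<times>\<^sub>F sequentially. norm (measure skew (A k \<inter> (F ^^ n) -` B)) \<le> measure skew (A k)"
        using A by (intro always_eventually) (auto intro!: M.finite_measure_mono)
      show "summable (\<lambda>i. measure skew (A i))" using sums by (rule sums_summable)
    qed simp
    also have "(\<Sum>i. measure skew (A i) * measure skew B) = measure skew (\<Union>i. A i) * measure skew B"
      using sums by (simp add: suminf_mult2 [symmetric] sums_iff)
    finally show ?case by (simp only: eq)
  qed
qed

section \<open>Stationary measures\<close>

lemma emeasure_density_01:
  assumes f: "f \<in> borel_measurable borel" and A: "A \<in> sets lborel_01"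
  shows "emeasure (density lborel_01 (\<lambda>x. ennreal (f x))) A =
    (\<integral>\<^sup>+x. ennreal (f x) * indicator A x \<partial>lborel_01)"
proof (rule emeasure_density[OF _ A])
  note [measurable] = f
  show "(\<lambda>x. ennreal (f x)) \<in> borel_measurable lborel_01" by (rule measurable_lborel_01) measurable
qed

text \<open>Duality with the indicator of A for each map, then averaging. Stationarity of a density
  thus means equality with its image under \<open>P\<close>.\<close>

lemma stationary_sum:
  assumes f: "L1 f" "\<And>x. 0 \<le> f x" and A: "A \<in> sets lborel_01"
  shows "(\<Sum>j\<in>J. ennreal (p j) * emeasure (density lborel_01 (\<lambda>x. ennreal (f x))) (T j -` A \<inter> {0..1})) =
    emeasure (density lborel_01 (\<lambda>x. ennreal (P f x))) A"
proof -
  note fm = L1_measurable[OF f(1)]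
  have Ab: "A \<in> sets borel" using A by (auto simp: sets_restrict_space)
  have tm: "branch_transfer j f \<in> borel_measurable borel" for j using fm by (rule measurable_transfer)
  have single: "emeasure (density lborel_01 (\<lambda>x. ennreal (f x))) (T j -` A \<inter> {0..1}) =
      (\<integral>\<^sup>+x. ennreal (branch_transfer j f x) * indicator A x \<partial>lborel_01)" if j: "j \<in> J" for j
  proof -
    have "T j -` A \<inter> {0..1} \<in> sets lborel_01"
      using measurable_sets[OF measurable_T[OF j] A] by simp
    then have "emeasure (density lborel_01 (\<lambda>x. ennreal (f x))) (T j -` A \<inter> {0..1}) =
        (\<integral>\<^sup>+x. ennreal (f x) * indicator (T j -` A \<inter> {0..1}) x \<partial>lborel_01)"
      by (rule emeasure_density_01[OF fm])
    also have "\<dots> = (\<integral>\<^sup>+x. ennreal (f x) * indicator A (branch_map (height j) (e j) x) \<partial>lborel_01)"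
      using T[OF j] by (intro nn_integral_cong) (auto split: split_indicator)
    also have "\<dots> = (\<integral>\<^sup>+x. ennreal (branch_transfer j f x) * indicator A x \<partial>lborel_01)"
      using Ab by (intro nn_integral_transfer height e_ge1[OF j] fm f(2)) auto
    finally show ?thesis .
  qed
  have "(\<Sum>j\<in>J. ennreal (p j) * emeasure (density lborel_01 (\<lambda>x. ennreal (f x))) (T j -` A \<inter> {0..1})) =
      (\<Sum>j\<in>J. \<integral>\<^sup>+x. ennreal (p j) * (ennreal (branch_transfer j f x) * indicator A x) \<partial>lborel_01)"
  proof (rule sum.cong[OF refl])
    fix j assume j: "j \<in> J"
    note [measurable] = tm[of j] Ab
    have "(\<lambda>x. ennreal (branch_transfer j f x) * indicator A x) \<in> borel_measurable lborel_01"
      by (rule measurable_lborel_01) measurable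
    then show "ennreal (p j) * emeasure (density lborel_01 (\<lambda>x. ennreal (f x))) (T j -` A \<inter> {0..1}) =
       (\<integral>\<^sup>+x. ennreal (p j) * (ennreal (branch_transfer j f x) * indicator A x) \<partial>lborel_01)"
      unfolding single[OF j] by (simp add: nn_integral_cmult)
  qed
  also have "\<dots> = (\<integral>\<^sup>+x. (\<Sum>j\<in>J. ennreal (p j) * (ennreal (branch_transfer j f x) * indicator A x)) \<partial>lborel_01)"
  proof (rule nn_integral_sum [symmetric])
    fix j
    note [measurable] = tm[of j] Ab
    show "(\<lambda>x. ennreal (p j) * (ennreal (branch_transfer j f x) * indicator A x)) \<in> borel_measurable lborel_01"
      by (rule measurable_lborel_01) measurable
  qed
  also have "\<dots> = (\<integral>\<^sup>+x. ennreal (P f x) * indicator A x \<partial>lborel_01)"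
  proof (rule nn_integral_cong)
    fix x
    have "(\<Sum>j\<in>J. ennreal (p j) * ennreal (branch_transfer j f x)) = (\<Sum>j\<in>J. ennreal (p j * branch_transfer j f x))"
      using p_pos transfer_nonneg[OF height(1) e_ge1 f(2)]
      by (intro sum.cong) (auto simp: ennreal_mult less_imp_le)
    also have "\<dots> = ennreal (P f x)"
      unfolding P_def using p_pos transfer_nonneg[OF height(1) e_ge1 f(2)]
      by (intro sum_ennreal) (auto simp: less_imp_le)
    finally show "(\<Sum>j\<in>J. ennreal (p j) * (ennreal (branch_transfer j f x) * indicator A x)) = ennreal (P f x) * indicator A x"
      by (simp add: sum_distrib_right [symmetric] mult.assoc [symmetric])
  qed
  also have "\<dots> = emeasure (density lborel_01 (\<lambda>x. ennreal (P f x))) A"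
    by (rule emeasure_density_01 [symmetric, OF L1_measurable[OF L1_P[OF f(1)]] A])
  finally show ?thesis .
qed

lemma density_P_h: "density lborel_01 (\<lambda>x. ennreal (P h x)) = stat"
proof -
  note [measurable] = L1_measurable[OF h_L1] L1_measurable[OF L1_P[OF h_L1]]
  have "AE x in lborel_01. P h x - h x = 0"
    using P_h L1_norm_eq_0_iff[OF L1_diff[OF L1_P[OF h_L1] h_L1]] by simp
  then have "AE x in lborel_01. ennreal (P h x) = ennreal (h x)" by eventually_elim simp
  then show ?thesis unfolding stat_def
    by (intro density_cong) (auto intro!: measurable_lborel_01)
qed

lemma stat_stationary:
  "A \<in> sets lborel_01 \<Longrightarrow> (\<Sum>j\<in>J. ennreal (p j) * emeasure stat (T j -` A \<inter> {0..1})) = emeasure stat A"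
  using stationary_sum[OF h_L1 h_nonneg] by (simp add: density_P_h stat_def [symmetric])

lemma absolutely_continuous_stat: "absolutely_continuous lborel_01 stat"
proof -
  note [measurable] = L1_measurable[OF h_L1]
  have "(\<lambda>x. ennreal (h x)) \<in> borel_measurable lborel_01" by (rule measurable_lborel_01) measurable
  then show ?thesis unfolding stat_def by (rule absolutely_continuousI_density)
qed

text \<open>The Radon-Nikodym density of a finite measure is finite almost everywhere, so it can be
  replaced by a real function; that function is fixed by \<open>P\<close> up to a null set and hence
  agrees with h.\<close>

lemma stationary_eq_stat:
  assumes sets: "sets \<nu> = sets lborel_01" and ac: "absolutely_continuous lborel_01 \<nu>" and prob: "prob_space \<nu>"
    and inv: "\<And>A. A \<in> sets lborel_01 \<Longrightarrow>
      (\<Sum>j\<in>J. ennreal (p j) * emeasure \<nu> (T j -` A \<inter> {0..1})) = emeasure \<nu> A"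
  shows "\<nu> = stat"
proof -
  interpret N: prob_space \<nu> by (rule prob)
  interpret L: prob_space lborel_01 by (rule prob_space_lborel_01)
  define R where "R = RN_deriv lborel_01 \<nu>"
  have R [measurable]: "R \<in> borel_measurable lborel_01" unfolding R_def by simp
  have dR: "density lborel_01 R = \<nu>"
    unfolding R_def by (rule L.density_RN_deriv[OF ac sets])
  have "AE x in lborel_01. R x \<noteq> \<infinity>"
    unfolding R_def by (rule L.RN_deriv_finite[OF _ ac sets]) unfold_locales
  then have Rf: "AE x in lborel_01. R x = ennreal (enn2real (R x))"
    by eventually_elim (simp add: top.not_eq_extremum)
  define f where "f = (\<lambda>x. indicator {0..1} x * enn2real (R x))"
  have fm [measurable]: "f \<in> borel_measurable borel"
    using measurable_compose[OF R borel_measurable_enn2real]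
    unfolding f_def by (simp add: borel_measurable_restrict_space_iff mult.commute)
  have f0: "0 \<le> f x" for x by (simp add: f_def)
  have "AE x in lborel_01. x \<in> {0..1}" by (rule AE_I2) simp
  with Rf have fR: "AE x in lborel_01. R x = ennreal (f x)"
    by eventually_elim (simp add: f_def)
  have fme: "(\<lambda>x. ennreal (f x)) \<in> borel_measurable lborel_01" by (rule measurable_lborel_01) measurable
  have df: "\<nu> = density lborel_01 (\<lambda>x. ennreal (f x))"
    using dR density_cong[OF R fme fR] by simp
  have one: "(\<integral>\<^sup>+x. ennreal (f x) \<partial>lborel_01) = 1"
  proof -
    have "space \<nu> = {0..1}" using sets_eq_imp_space_eq[OF sets] by simp
    then have "emeasure \<nu> {0..1} = 1" using N.emeasure_space_1 by simp
    moreover have "emeasure \<nu> {0..1} = (\<integral>\<^sup>+x. ennreal (f x) * indicator {0..1} x \<partial>lborel_01)"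
      unfolding df by (rule emeasure_density_01[OF fm]) (auto simp: sets_restrict_space)
    moreover have "(\<integral>\<^sup>+x. ennreal (f x) * indicator {0..1} x \<partial>lborel_01) = (\<integral>\<^sup>+x. ennreal (f x) \<partial>lborel_01)"
      by (intro nn_integral_cong) auto
    ultimately show ?thesis by simp
  qed
  have "integrable lborel_01 f"
    using one f0 measurable_lborel_01[OF fm] by (intro integrableI_nonneg) auto
  then have f: "L1 f" using fm by (simp add: L1_def)
  have int: "(\<integral>x. f x \<partial>lborel_01) = 1"
    using one f0 measurable_lborel_01[OF fm] by (simp add: integral_eq_nn_integral)
  have Pm: "(\<lambda>x. ennreal (P f x)) \<in> borel_measurable lborel_01"
    by (intro measurable_lborel_01 measurable_compose[OF L1_measurable[OF L1_P[OF f]]]) simp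
  have "density lborel_01 (\<lambda>x. ennreal (P f x)) = density lborel_01 (\<lambda>x. ennreal (f x))"
  proof (rule measure_eqI)
    fix A assume "A \<in> sets (density lborel_01 (\<lambda>x. ennreal (P f x)))"
    then have A: "A \<in> sets lborel_01" by simp
    show "emeasure (density lborel_01 (\<lambda>x. ennreal (P f x))) A = emeasure (density lborel_01 (\<lambda>x. ennreal (f x))) A"
      using inv[OF A] stationary_sum[OF f f0 A] by (simp add: df)
  qed simp
  then have "AE x in lborel_01. ennreal (P f x) = ennreal (f x)"
    using Pm fme by (subst (asm) L.density_unique_iff) auto
  then have "AE x in lborel_01. P f x - f x = 0"
    by eventually_elim (simp add: P_nonneg[OF f0] f0)
  then have "L1_norm (\<lambda>x. P f x - f x) = 0"
    using L1_norm_eq_0_iff[OF L1_diff[OF L1_P[OF f] f]] by simp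
  then have "AE x in lborel_01. f x = h x" by (rule stationary_unique[OF f _ int])
  then have "AE x in lborel_01. ennreal (f x) = ennreal (h x)" by eventually_elim simp
  moreover have "(\<lambda>x. ennreal (h x)) \<in> borel_measurable lborel_01"
    by (intro measurable_lborel_01 measurable_compose[OF L1_measurable[OF h_L1]]) simp
  ultimately show ?thesis unfolding df stat_def using fme by (intro density_cong)
qed

lemma RN_deriv_stat_ge:
  assumes "AE x in lborel_01. c \<le> h x"
  shows "AE x in lborel_01. ennreal c \<le> RN_deriv lborel_01 stat x"
proof -
  interpret L: prob_space lborel_01 by (rule prob_space_lborel_01)
  have "(\<lambda>x. ennreal (h x)) \<in> borel_measurable lborel_01"
    by (intro measurable_lborel_01 measurable_compose[OF L1_measurable[OF h_L1]]) simp
  then have "AE x in lborel_01. ennreal (h x) = RN_deriv lborel_01 stat x"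
    by (rule L.RN_deriv_unique) (simp add: stat_def)
  with assms show ?thesis by eventually_elim (metis ennreal_leI)
qed

end

section \<open>From good and bad maps to the abstract system\<close>

lemma bad_map_eq_branch_map:
  assumes "bad_map l T" "x \<in> {0..1}"
  shows "T x = branch_map (1/2) l x"
proof (cases "x < 1/2")
  case True
  have "(1 - 2 * x) powr l = (2 * (1/2 - x)) powr l" by simp
  also have "\<dots> = 2 powr l * (1/2 - x) powr l" by (rule powr_mult)
  finally show ?thesis using assms True by (auto simp: bad_map_def branch_map_def powr_diff)
qed (use assms in \<open>auto simp: bad_map_def branch_map_def\<close>)

lemma good_map_eq_branch_map:
  assumes "good_map r T" "x \<in> {0..1}"
  shows "T x = branch_map 1 r x"
proof (cases "x < 1/2")
  case True
  have "(1 - 2 * x) powr r = (2 * (1/2 - x)) powr r" by simp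
  also have "\<dots> = 2 powr r * (1/2 - x) powr r" by (rule powr_mult)
  finally show ?thesis using assms True by (auto simp: good_map_def branch_map_def)
qed (use assms in \<open>auto simp: good_map_def branch_map_def\<close>)

theorem theorem1p2:
  fixes N :: nat and T :: "nat \<Rightarrow> real \<Rightarrow> real" and p ell :: "nat \<Rightarrow> real"
  assumes good_or_bad: "{1..N} = good_indices N T \<union> bad_indices N T"
    and good_nonempty: "good_indices N T \<noteq> {}"
    and bad_nonempty: "bad_indices N T \<noteq> {}"
    and bad_param: "\<forall>b\<in>bad_indices N T. bad_map (ell b) (T b)"
    and p_pos: "\<forall>j\<in>{1..N}. p j > 0"
    and p_sum: "(\<Sum>j\<in>{1..N}. p j) = 1"
    and theta: "(\<Sum>b\<in>bad_indices N T. p b * ell b) < 1"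
  shows "(\<exists>!\<mu>. acs_measure N T p \<mu> \<and> prob_space \<mu>) \<and>
    (\<forall>\<mu>. acs_measure N T p \<mu> \<and> prob_space \<mu> \<longrightarrow>
       mixing (bernoulli_measure N p \<Otimes>\<^sub>M \<mu>) (random_map T) \<and>
       density_bounded_away_from_zero lborel_01 \<mu>)"
proof -
  define Bad where "Bad = bad_indices N T"
  \<comment> \<open>No bound relates the exponents of the good maps, so any witness will do for
    them.\<close>
  define e where "e = (\<lambda>j. if j \<in> Bad then ell j else SOME r. good_map r (T j))"
  have Bad_sub: "Bad \<subseteq> {1..N}" by (auto simp: Bad_def bad_indices_def)
  have bad: "bad_map (e j) (T j)" if "j \<in> Bad" for j
    using bad_param that by (simp add: e_def Bad_def)
  have good: "good_map (e j) (T j)" if "j \<in> {1..N}" "j \<notin> Bad" for j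
  proof -
    have "\<exists>r. good_map r (T j)" using good_or_bad that by (auto simp: Bad_def good_indices_def)
    then show ?thesis using someI_ex[of "\<lambda>r. good_map r (T j)"] that by (simp add: e_def)
  qed
  have e_ge1: "e j \<ge> 1" if "j \<in> {1..N}" for j
    using bad[of j] good[of j] that by (cases "j \<in> Bad") (auto simp: bad_map_def good_map_def)
  have theta': "(\<Sum>j\<in>{1..N} \<inter> Bad. p j * e j) < 1"
  proof -
    have "{1..N} \<inter> Bad = Bad" using Bad_sub by auto
    then have "(\<Sum>j\<in>{1..N} \<inter> Bad. p j * e j) = (\<Sum>b\<in>bad_indices N T. p b * ell b)"
      by (simp add: e_def Bad_def)
    then show ?thesis using theta by simp
  qed
  \<comment> \<open>All exponents are at least 1, so if every index were bad the sum in theta would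
    be at least 1.\<close>
  have good_exists: "{1..N} - Bad \<noteq> {}"
  proof
    assume "{1..N} - Bad = {}"
    then have "{1..N} \<inter> Bad = {1..N}" by blast
    moreover have "(\<Sum>j\<in>{1..N}. p j) \<le> (\<Sum>j\<in>{1..N}. p j * e j)"
      using p_pos e_ge1 by (intro sum_mono) (simp add: less_imp_le)
    ultimately show False using theta' p_sum by simp
  qed
  interpret good_bad_system "{1..N}" Bad p e
    using p_pos p_sum e_ge1 theta' good_exists by unfold_locales auto
  obtain H where H: "L1 H" "\<And>x. 0 \<le> H x" "\<And>x. x \<in> {0..<1} \<Longrightarrow> 1 \<le> H x"
    "\<forall>f. cone f \<and> L1 f \<and> (\<integral>y. f y \<partial>lborel_01) \<le> 1 \<and> (\<forall>y\<in>{0..<1}. f y \<le> H y) \<longrightarrow>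
      (\<forall>x\<in>{0..<1}. P f x \<le> H x)"
    by (rule exists_majorant, rule that)
  interpret dominated_system "{1..N}" Bad p e H
    by unfold_locales (use H in blast)+
  obtain h where h: "L1 h" "\<And>x. 0 \<le> h x" "(\<lambda>n. L1_norm (\<lambda>x. iterates n x - h x)) \<longlonglongrightarrow> 0"
    and h_ge: "\<exists>c>0. AE x in lborel_01. c \<le> h x"
    by (rule exists_limit, rule that)
  have T: "T j x = branch_map (height j) (e j) x" if "j \<in> {1..N}" "x \<in> {0..1}" for j x
    using that bad_map_eq_branch_map[OF bad] good_map_eq_branch_map[OF good]
    by (cases "j \<in> Bad") (auto simp: height_def)
  interpret skew_system "{1..N}" Bad p e H h T
    by unfold_locales (use h T in blast)+
  have acs: "acs_measure N T p stat"
    unfolding acs_measure_def sets_lborel_01 [symmetric]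
    using sets_stat absolutely_continuous_stat stat_stationary by simp
  have unique: "\<mu> = stat" if "acs_measure N T p \<mu>" "prob_space \<mu>" for \<mu>
    using that unfolding acs_measure_def sets_lborel_01 [symmetric]
    by (intro stationary_eq_stat) auto
  have "bernoulli_measure N p \<Otimes>\<^sub>M stat = skew"
    unfolding bernoulli_measure_def skew_def sequences_def symbols_def ..
  then have mix: "mixing (bernoulli_measure N p \<Otimes>\<^sub>M stat) (random_map T)"
    using mixing_skew by simp
  have dens: "density_bounded_away_from_zero lborel_01 stat"
    unfolding density_bounded_away_from_zero_def using h_ge RN_deriv_stat_ge by blast
  show ?thesis using acs prob_space_stat unique mix dens by blast
qed

end
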